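(* Let $K$ be an algebraically closed field with characteristic exponent $p$. Let $r$ be an even nonnegative integer and let $m\geq r$. Let $x$ be the generic skew-symmetric $m\times m$ matrix, with variables $x_{ij}$ for $i<j$, $x_{ji}=-x_{ij}$, $x_{ii}=0$, so that polynomials in $K[x_{ij}\mid 1\le i<j\le m]$ are functions on skew-symmetric matrices in $K^{m\times m}$. Then there is no nonzero polynomial vanishing on all skew-symmetric $m\times m$ matrices of rank $\leq r$ that has fewer than $(r+1)!!=(r+1)(r-1)\cdots 3\cdot 1$ terms. Furthermore, any polynomial with exactly $(r+1)!!$ terms that vanishes on all skew-symmetric $m\times m$ matrices of rank $r$ is of the form $c\,u\cdot P^{p^e}$, where $c\in K^*$, $u$ is a monomial, $e\in\mathbb{Z}_{\ge 0}$, and $P$ is the Pfaffian of some principal $(r+2)\times(r+2)$ submatrix of $x$.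
   Context: The characteristic exponent $p$ of $K$ is $1$ if $\operatorname{char}K=0$ and $\operatorname{char}K$ otherwise. The number of terms of a polynomial is the number of monomials with nonzero coefficient. A principal submatrix is one with the same set of row and column indices. *)

theory Defs
  imports "HOL-Library.Poly_Mapping" "HOL-Combinatorics.Permutations"
    "HOL-Computational_Algebra.Polynomial" "Jordan_Normal_Form.DL_Rank"
begin

text \<open>Polynomials in the variables x_ij, represented as finitely supported maps
  from monomials (finitely supported exponent maps on variable indices (i,j)) to coefficients.\<close>
type_synonym 'a skpoly = "((nat \<times> nat) \<Rightarrow>\<^sub>0 nat) \<Rightarrow>\<^sub>0 'a"

definition char_exp :: "'a::semiring_1 itself \<Rightarrow> nat" where
  "char_exp T = (if semiring_char T = 0 then 1 else semiring_char T)"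

fun dfact :: "nat \<Rightarrow> nat" where
  "dfact 0 = 1"
| "dfact (Suc 0) = 1"
| "dfact (Suc (Suc n)) = Suc (Suc n) * dfact n"

definition skew_vars :: "nat \<Rightarrow> 'a::zero skpoly \<Rightarrow> bool" where
  "skew_vars m p \<longleftrightarrow> (\<forall>\<mu>\<in>Poly_Mapping.keys p. \<forall>v\<in>Poly_Mapping.keys \<mu>. fst v < snd v \<and> snd v < m)"

definition eval_at :: "'a::comm_semiring_1 skpoly \<Rightarrow> 'a mat \<Rightarrow> 'a" where
  "eval_at p A = (\<Sum>\<mu>\<in>Poly_Mapping.keys p. Poly_Mapping.lookup p \<mu> * (\<Prod>v\<in>Poly_Mapping.keys \<mu>. (A $$ v) ^ Poly_Mapping.lookup \<mu> v))"

definition skew_mat :: "nat \<Rightarrow> 'a::ring_1 mat \<Rightarrow> bool" where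
  "skew_mat m A \<longleftrightarrow> A \<in> carrier_mat m m \<and>
     (\<forall>i<m. \<forall>j<m. A $$ (j, i) = - A $$ (i, j)) \<and> (\<forall>i<m. A $$ (i, i) = 0)"

text \<open>Permutations of {0..<2n} indexing the perfect matchings: sigma(2k) < sigma(2k+1),
  sigma(0) < sigma(2) < ... < sigma(2n-2).\<close>
definition pf_perms :: "nat \<Rightarrow> (nat \<Rightarrow> nat) set" where
  "pf_perms n = {\<sigma>. \<sigma> permutes {..<2*n} \<and> (\<forall>k<n. \<sigma> (2*k) < \<sigma> (2*k+1)) \<and>
                    (\<forall>k. Suc k < n \<longrightarrow> \<sigma> (2*k) < \<sigma> (2*k+2))}"

definition pfaffian_poly :: "nat set \<Rightarrow> 'a::comm_ring_1 skpoly" where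
  "pfaffian_poly S = (let s = (\<lambda>i. sorted_list_of_set S ! i); n = card S div 2 in
     (\<Sum>\<sigma>\<in>pf_perms n. Poly_Mapping.single
        (\<Sum>k<n. Poly_Mapping.single (s (\<sigma> (2*k)), s (\<sigma> (2*k+1))) (1::nat))
        (of_int (sign \<sigma>))))"

definition monomial_term :: "'a::zero \<Rightarrow> ((nat \<times> nat) \<Rightarrow>\<^sub>0 nat) \<Rightarrow> 'a skpoly" where
  "monomial_term c u = Poly_Mapping.single u c"

end

(* The Gram matrices of tuples of vectors for the standard symplectic form on K^(2h) have rank at
   most 2h, so a polynomial f as in the theorem vanishes on all of them; this is all that is used
   about rank, except that generically such a Gram matrix has rank exactly 2h.  Fix a row i and
   group the terms of f by their star at i, the exponents of the variables in row i.  An extra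
   symplectic plane makes row i arbitrary, so each group vanishes on rank at most 2h - 2.  If f
   contains no smaller vanishing sum of terms, then i has one star or at least 2h + 1 of them:
   keeping repeatedly the terms of least degree in some variable of row i, while the corresponding
   entry is specialised to 0, isolates one star after fewer steps than there are stars, and each
   step uses up one of the 2h dimensions.  Induction on h gives the bound.

   If the bound is attained and common monomial factors are removed, then the same argument shows
   that the 2h + 1 stars at i involve disjoint sets of variables.  Killing all but three of them
   leaves a linear relation between three products of linear forms in two variables with general
   zeros, which is possible only for q-th powers of variables, q a power of the characteristic
   exponent.  So the terms are q-th powers of perfect matchings on a set of rows; by induction and
   a combinatorial argument this set has 2h + 2 elements and every perfect matching occurs.
   Finally, evaluating at points where only two matchings survive shows that the coefficients are
   antisymmetric in the labels, which makes f a q-th power of a Pfaffian up to a monomial. *)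
theory Submission
  imports Defs "HOL-Library.Infinite_Typeclass" "Jordan_Normal_Form.DL_Rank_Submatrix"
begin

section \<open>Polynomial functions of one variable and symplectic forms\<close>


text \<open>Algebraic closedness is used in the form that the field is infinite: density arguments
  move the vectors along a one-parameter curve, where a product of two polynomial functions vanishes
  only if one factor does. Setting an entry of row i to 0 could kill every term, so the sum is first
  divided by the lowest power of that entry. This works where \<open>b i\<close> is nonzero, since
  the far end can then be moved off the hyperplane orthogonal to \<open>b i\<close>, and it costs
  one linear condition on \<open>b i\<close>. Starting from at most 2h stars, conditions plus stars
  never exceed 2h; at the last star fewer than 2h conditions are left and a nonzero solution exists.
  This is the origin of 2h + 1. Three stars are kept in the extremal case at level h + 1 because 2h
  conditions in dimension 2h + 2 leave a plane, while two stars could be compared on a line only.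
  The induction yields supports, not coefficients, and each star class comes with its own common
  factor and its own q. The gluing of the classes therefore uses only cardinalities and the
  existence of matchings through one or two prescribed edges.\<close>

instance alg_closed_field \<subseteq> infinite
proof
  show "infinite (UNIV :: 'a set)"
  proof
    assume fin: "finite (UNIV :: 'a set)"
    \<comment> \<open>\<open>1 + ?P\<close> has positive degree but takes the value 1 at every point
      of a finite field.\<close>
    let ?P = "\<Prod>a\<in>(UNIV :: 'a set). [:- a, 1:]"
    have "degree ?P = (\<Sum>a\<in>(UNIV :: 'a set). degree [:- a, 1:])"
      by (rule degree_prod_eq_sum_degree) simp
    then have "degree ?P > 0" using fin by (simp add: card_gt_0_iff)
    then have "degree (1 + ?P) > 0" by (subst degree_add_eq_right) auto
    then obtain x where "poly (1 + ?P) x = 0" using alg_closed_imp_poly_has_root by blast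
    moreover have "poly ?P x = 0" using fin by (simp add: poly_prod)
    ultimately show False by simp
  qed
qed

section \<open>Polynomial functions of one parameter\<close>

definition polyfun :: "('a::comm_ring_1 \<Rightarrow> 'a) \<Rightarrow> bool" where
  "polyfun g \<longleftrightarrow> (\<exists>P. g = poly P)"

named_theorems polyfun_intros

lemma polyfun_const [polyfun_intros]: "polyfun (\<lambda>t. a)"
  unfolding polyfun_def by (rule exI[of _ "[:a:]"]) auto

lemma polyfun_id [polyfun_intros]: "polyfun (\<lambda>t. t)"
  unfolding polyfun_def by (rule exI[of _ "[:0,1:]"]) auto

lemma polyfun_add [polyfun_intros]: "polyfun f \<Longrightarrow> polyfun g \<Longrightarrow> polyfun (\<lambda>t. f t + g t)"
  unfolding polyfun_def by (elim exE, rule_tac x="P + Pa" in exI) auto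

lemma polyfun_diff [polyfun_intros]: "polyfun f \<Longrightarrow> polyfun g \<Longrightarrow> polyfun (\<lambda>t. f t - g t)"
  unfolding polyfun_def by (elim exE, rule_tac x="P - Pa" in exI) auto

lemma polyfun_mult [polyfun_intros]: "polyfun f \<Longrightarrow> polyfun g \<Longrightarrow> polyfun (\<lambda>t. f t * g t)"
  unfolding polyfun_def by (elim exE, rule_tac x="P * Pa" in exI) auto

lemma polyfun_power [polyfun_intros]: "polyfun f \<Longrightarrow> polyfun (\<lambda>t. f t ^ n)"
  unfolding polyfun_def by (elim exE, rule_tac x="P ^ n" in exI) auto

lemma polyfun_sum [polyfun_intros]:
  "(\<And>x. x \<in> A \<Longrightarrow> polyfun (f x)) \<Longrightarrow> polyfun (\<lambda>t. \<Sum>x\<in>A. f x t)"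
  by (induction A rule: infinite_finite_induct) (auto intro!: polyfun_intros)

lemma polyfun_prod [polyfun_intros]:
  "(\<And>x. x \<in> A \<Longrightarrow> polyfun (f x)) \<Longrightarrow> polyfun (\<lambda>t. \<Prod>x\<in>A. f x t)"
  by (induction A rule: infinite_finite_induct) (auto intro!: polyfun_intros)

lemma polyfun_finite_zeros:
  fixes g :: "'a::idom \<Rightarrow> 'a"
  assumes "polyfun g" "g a \<noteq> 0"
  shows "finite {t. g t = 0}"
proof -
  obtain P where P: "g = poly P" using assms(1) polyfun_def by blast
  then have "P \<noteq> 0" using assms(2) by auto
  then show ?thesis using P poly_roots_finite by simp
qed

lemma polyfun_eq_0:
  fixes g :: "'a::{idom,infinite} \<Rightarrow> 'a"
  assumes "polyfun g" "finite F" "\<And>t. t \<notin> F \<Longrightarrow> g t = 0"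
  shows "g t = 0"
proof (rule ccontr)
  assume "g t \<noteq> 0"
  then have "finite {t. g t = 0}" using polyfun_finite_zeros assms(1) by blast
  then have "finite ({t. g t = 0} \<union> F)" using assms(2) by blast
  moreover have "{t. g t = 0} \<union> F = UNIV" using assms(3) by blast
  ultimately show False using infinite_UNIV by metis
qed

text \<open>The affine line over an infinite field is irreducible: off the finitely many zeros of
  \<open>g\<close> the function \<open>g'\<close> vanishes, hence everywhere. Most cancellations of
  a generically nonzero factor go through this.\<close>

lemma polyfun_mult_eq_0:
  fixes g :: "'a::{idom,infinite} \<Rightarrow> 'a"
  assumes "polyfun g" "polyfun g'" "\<And>t. g t * g' t = 0" "g a \<noteq> 0"
  shows "g' t = 0"
  by (rule polyfun_eq_0[OF assms(2) polyfun_finite_zeros[OF assms(1,4)]])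
    (use assms(3) in auto)

lemma polyfun_common_nonzero:
  fixes g :: "'b \<Rightarrow> 'a::{idom,infinite} \<Rightarrow> 'a"
  assumes "finite A" "\<And>x. x \<in> A \<Longrightarrow> polyfun (g x)" "\<And>x. x \<in> A \<Longrightarrow> \<exists>a. g x a \<noteq> 0"
  obtains t where "\<And>x. x \<in> A \<Longrightarrow> g x t \<noteq> 0"
proof -
  have "finite (\<Union>x\<in>A. {t. g x t = 0})" using assms polyfun_finite_zeros by blast
  then have "(\<Union>x\<in>A. {t. g x t = 0}) \<noteq> UNIV" using infinite_UNIV by metis
  then show ?thesis using that by blast
qed

text \<open>The sum over one value of \<open>n\<close> is a coefficient of a polynomial in
  \<open>t\<close> that vanishes identically. The index is a set and not the exponent because many
  \<open>x\<close> may share an exponent.\<close>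

lemma power_sum_eq_0:
  fixes g :: "'b \<Rightarrow> 'a::{idom,infinite}"
  assumes "finite A" "\<And>t. (\<Sum>x\<in>A. g x * t ^ n x) = 0"
  shows "(\<Sum>x | x \<in> A \<and> n x = d. g x) = 0"
proof -
  define P where "P = (\<Sum>x\<in>A. monom (g x) (n x))"
  have "poly P t = 0" for t using assms(2)[of t] by (simp add: P_def poly_sum poly_monom)
  then have "{t. poly P t = 0} = UNIV" by auto
  then have "P = 0" using poly_roots_finite[of P] infinite_UNIV by metis
  then have "coeff P d = 0" by simp
  moreover have "coeff P d = (\<Sum>x\<in>A. if n x = d then g x else 0)"
    by (simp add: P_def coeff_sum)
  also have "\<dots> = (\<Sum>x | x \<in> A \<and> n x = d. g x)"
    using assms(1) by (simp add: sum.inter_filter)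
  ultimately show ?thesis by simp
qed

text \<open>Coefficient comparison one variable at a time. Summands with equal exponents on
  \<open>F\<close> stay grouped, which is how a sum of monomials splits into star classes.\<close>

lemma monomial_sum_eq_0:
  fixes g :: "'b \<Rightarrow> 'a::{idom,infinite}" and l :: "'b \<Rightarrow> 'v \<Rightarrow> nat"
  assumes "finite F" "finite A" "\<And>y. (\<Sum>x\<in>A. g x * (\<Prod>v\<in>F. y v ^ l x v)) = 0"
  shows "(\<Sum>x | x \<in> A \<and> (\<forall>v\<in>F. l x v = a v). g x) = 0"
  using assms
proof (induction F arbitrary: A g rule: finite_induct)
  case empty
  then show ?case by simp
next
  case (insert v F)
  let ?B = "{x \<in> A. l x v = a v}"
  have "(\<Sum>x\<in>?B. g x * (\<Prod>w\<in>F. y w ^ l x w)) = 0" for y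
  proof (rule power_sum_eq_0[OF \<open>finite A\<close>])
    fix t
    have "(\<Prod>w\<in>F. (y(v := t)) w ^ l x w) = (\<Prod>w\<in>F. y w ^ l x w)" for x
      using insert.hyps by (intro prod.cong) auto
    then show "(\<Sum>x\<in>A. g x * (\<Prod>w\<in>F. y w ^ l x w) * t ^ l x v) = 0"
      using insert.prems(2)[of "y(v := t)"] insert.hyps by (simp add: mult_ac)
  qed
  then have "(\<Sum>x | x \<in> ?B \<and> (\<forall>w\<in>F. l x w = a w). g x) = 0"
    by (intro insert.IH) (use insert.prems in auto)
  then show ?case by (simp add: conj_ac)
qed

section \<open>The standard symplectic form on the first 2h coordinates\<close>

definition sform :: "nat \<Rightarrow> (nat \<Rightarrow> 'a::comm_ring_1) \<Rightarrow> (nat \<Rightarrow> 'a) \<Rightarrow> 'a" where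
  "sform h x y = (\<Sum>k<h. x (2*k) * y (2*k+1) - x (2*k+1) * y (2*k))"

lemma sform_swap: "sform h x y = - sform h y x"
  by (simp add: sform_def sum_negf[symmetric] mult.commute)

lemma sform_self [simp]: "sform h x x = 0"
  by (simp add: sform_def mult.commute)

lemma sform_lin_right: "sform h y (\<lambda>k. p * u k + q * z k) = p * sform h y u + q * sform h y z"
  by (simp add: sform_def sum_distrib_left sum.distrib[symmetric] algebra_simps)

lemma sform_lin_left: "sform h (\<lambda>k. p * u k + q * z k) y = p * sform h u y + q * sform h z y"
  by (simp add: sform_def sum_distrib_left sum.distrib[symmetric] algebra_simps)

lemma sform_shift: "sform h y (\<lambda>k. u k + q * z k) = sform h y u + q * sform h y z"
  using sform_lin_right[of h y 1 u q z] by simp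

lemma polyfun_sform [polyfun_intros]:
  assumes "\<And>k. polyfun (\<lambda>t. x t k)" "\<And>k. polyfun (\<lambda>t. y t k)"
  shows "polyfun (\<lambda>t. sform h (x t) (y t))"
  unfolding sform_def by (intro polyfun_intros assms)

definition nzvec :: "nat \<Rightarrow> (nat \<Rightarrow> 'a::zero) \<Rightarrow> bool" where
  "nzvec h y \<longleftrightarrow> (\<exists>k<2*h. y k \<noteq> 0)"

lemma sform_nondegenerate:
  fixes y :: "nat \<Rightarrow> 'a::field"
  assumes "nzvec h y"
  obtains z where "sform h y z = 1"
proof -
  from assms obtain k where k: "k < 2*h" "y k \<noteq> 0" unfolding nzvec_def by blast
  have ne: "2 * i \<noteq> Suc (2 * l)" for i l :: nat by presburger
  show ?thesis
  proof (cases "even k")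
    case True
    then obtain l where l: "k = 2*l" by (elim evenE)
    have "sform h y (\<lambda>j. if j = 2*l+1 then 1 / y k else 0) = (\<Sum>i<h. if i = l then 1 else 0)"
      unfolding sform_def using k l ne by (intro sum.cong) auto
    also have "\<dots> = 1" using k l by simp
    finally show ?thesis by (rule that)
  next
    case False
    then obtain l where l: "k = 2*l+1" by (elim oddE)
    have "sform h y (\<lambda>j. if j = 2*l then - 1 / y k else 0) = (\<Sum>i<h. if i = l then 1 else 0)"
      unfolding sform_def using k l ne[symmetric] by (intro sum.cong) auto
    also have "\<dots> = 1" using k l by simp
    finally show ?thesis by (rule that)
  qed
qed

text \<open>Gaussian elimination: an equation with a nonzero coefficient at \<open>k0\<close> is
  solved for that unknown, and substitution leaves one equation and one unknown less.\<close>

lemma homogeneous_system_nontrivial: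
  fixes a :: "'j \<Rightarrow> 'i \<Rightarrow> 'a::field"
  assumes "finite J" "finite I" "card J < card I"
  shows "\<exists>y. (\<exists>k\<in>I. y k \<noteq> 0) \<and> (\<forall>j\<in>J. (\<Sum>k\<in>I. a j k * y k) = 0)"
  using assms
proof (induction J arbitrary: I a rule: finite_induct)
  case empty
  then obtain k where "k \<in> I" by fastforce
  then show ?case by (intro exI[of _ "\<lambda>_. 1"]) auto
next
  case (insert j J)
  show ?case
  proof (cases "\<forall>k\<in>I. a j k = 0")
    case True
    obtain y where "\<exists>k\<in>I. y k \<noteq> 0" "\<forall>i\<in>J. (\<Sum>k\<in>I. a i k * y k) = 0"
      using insert.IH[of I a] insert.prems insert.hyps by auto
    moreover have "(\<Sum>k\<in>I. a j k * y k) = 0" using True by simp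
    ultimately show ?thesis by blast
  next
    case False
    then obtain k0 where k0: "k0 \<in> I" "a j k0 \<noteq> 0" by blast
    define I' where "I' = I - {k0}"
    have I: "I = insert k0 I'" "k0 \<notin> I'" "finite I'" using k0 insert.prems by (auto simp: I'_def)
    have "card J < card I'" using insert.prems insert.hyps I by simp
    then obtain y where y: "\<exists>k\<in>I'. y k \<noteq> 0"
      "\<And>i. i \<in> J \<Longrightarrow> (\<Sum>k\<in>I'. (a i k - a i k0 * a j k / a j k0) * y k) = 0"
      using insert.IH[of I' "\<lambda>i k. a i k - a i k0 * a j k / a j k0"] I by blast
    define s where "s = (\<Sum>k\<in>I'. a j k * y k)"
    define y' where "y' = y(k0 := - s / a j k0)"
    have S: "(\<Sum>k\<in>I. a i k * y' k) = a i k0 * (- s / a j k0) + (\<Sum>k\<in>I'. a i k * y k)" for i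
    proof -
      have "(\<Sum>k\<in>I'. a i k * y' k) = (\<Sum>k\<in>I'. a i k * y k)"
        using I by (intro sum.cong) (auto simp: y'_def)
      then show ?thesis using I by (simp add: y'_def)
    qed
    have "(\<Sum>k\<in>I. a i k * y' k) = 0" if "i \<in> insert j J" for i
    proof (cases "i = j")
      case True
      then show ?thesis using k0 S[of j] by (simp add: s_def)
    next
      case False
      have "(\<Sum>k\<in>I'. a i k * y k - (a i k0 / a j k0) * (a j k * y k))
          = (\<Sum>k\<in>I'. (a i k - a i k0 * a j k / a j k0) * y k)"
        using k0 by (intro sum.cong) (auto simp: field_simps)
      also have "\<dots> = 0" using y(2)[of i] that False by simp
      finally have "(\<Sum>k\<in>I'. a i k * y k - (a i k0 / a j k0) * (a j k * y k)) = 0" .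
      then have "(\<Sum>k\<in>I'. a i k * y k) = (a i k0 / a j k0) * s"
        unfolding sum_subtractf sum_distrib_left[symmetric] s_def by simp
      then show ?thesis by (simp add: S)
    qed
    moreover have "\<exists>k\<in>I. y' k \<noteq> 0" using y(1) I by (auto simp: y'_def)
    ultimately show ?thesis by blast
  qed
qed

lemma sum_lessThan_double:
  "(\<Sum>k<2*h. f k) = (\<Sum>k<h. f (2*k) + f (2*k+1 :: nat) :: 'a::comm_monoid_add)"
  by (induction h) (auto simp: add_ac)

text \<open>Pairing with \<open>b j\<close> is a linear form whose coefficients are the entries of
  \<open>b j\<close>, neighbours interchanged and up to sign. The strict bound by the dimension
  \<open>2*h\<close> is the source of the bound on the number of stars.\<close>

lemma exists_orthogonal:
  fixes b :: "'j \<Rightarrow> nat \<Rightarrow> 'a::field"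
  assumes "finite J" "card J < 2*h"
  shows "\<exists>y. nzvec h y \<and> (\<forall>j\<in>J. sform h y (b j) = 0)"
proof -
  obtain y where y: "\<exists>k\<in>{..<2*h}. y k \<noteq> 0"
     "\<forall>j\<in>J. (\<Sum>k<2*h. (if even k then b j (k+1) else - b j (k-1)) * y k) = 0"
    using homogeneous_system_nontrivial[of J "{..<2*h}" "\<lambda>j k. if even k then b j (k+1) else - b j (k-1)"] assms
    by auto
  have "sform h y (b j) = 0" if "j \<in> J" for j
    using y(2)[rule_format, OF that] unfolding sum_lessThan_double sform_def
    by (simp add: mult.commute)
  with y(1) show ?thesis by (intro exI[of _ y]) (auto simp: nzvec_def)
qed

section \<open>Vanishing sums of monomials\<close>


abbreviation keys :: "('a \<Rightarrow>\<^sub>0 'b::zero) \<Rightarrow> 'a set" where "keys \<equiv> Poly_Mapping.keys"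
abbreviation lookup :: "('a \<Rightarrow>\<^sub>0 'b::zero) \<Rightarrow> 'a \<Rightarrow> 'b" where "lookup \<equiv> Poly_Mapping.lookup"

type_synonym mono = "(nat \<times> nat) \<Rightarrow>\<^sub>0 nat"

section \<open>Monomials and their stars evaluated on Gram matrices\<close>

definition edge_val :: "nat \<Rightarrow> (nat \<Rightarrow> nat \<Rightarrow> 'a::comm_ring_1) \<Rightarrow> nat \<times> nat \<Rightarrow> 'a" where
  "edge_val h b v = sform h (b (fst v)) (b (snd v))"

text \<open>The variables in \<open>F\<close> are left out instead of evaluated: they are those set
  to 0 after division by their lowest power.\<close>

definition mval :: "(nat \<times> nat) set \<Rightarrow> nat \<Rightarrow> (nat \<Rightarrow> nat \<Rightarrow> 'a::comm_ring_1) \<Rightarrow> mono \<Rightarrow> 'a" where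
  "mval F h b \<mu> = (\<Prod>v\<in>keys \<mu> - F. edge_val h b v ^ lookup \<mu> v)"

definition touch :: "nat \<Rightarrow> (nat \<times> nat) set" where
  "touch i = {v. fst v = i \<or> snd v = i}"

definition other :: "nat \<Rightarrow> nat \<times> nat \<Rightarrow> nat" where
  "other i v = (if fst v = i then snd v else fst v)"

text \<open>A variable is stored with its smaller index first; seen from \<open>i\<close>, its entry
  may therefore be the transposed one, with opposite sign.\<close>

definition orient :: "nat \<Rightarrow> nat \<times> nat \<Rightarrow> 'a::comm_ring_1" where
  "orient i v = (if fst v = i then 1 else -1)"

definition star :: "nat \<Rightarrow> mono \<Rightarrow> nat \<times> nat \<Rightarrow> nat" where
  "star i \<mu> = (\<lambda>v. if v \<in> touch i then lookup \<mu> v else 0)"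

definition edge_mons :: "mono set \<Rightarrow> bool" where
  "edge_mons X \<longleftrightarrow> (\<forall>\<mu>\<in>X. \<forall>v\<in>keys \<mu>. fst v < snd v)"

definition vanishes :: "nat \<Rightarrow> (mono \<Rightarrow> 'a::comm_ring_1) \<Rightarrow> mono set \<Rightarrow> bool" where
  "vanishes h c X \<longleftrightarrow> (\<forall>b. (\<Sum>\<mu>\<in>X. c \<mu> * mval {} h b \<mu>) = 0)"

text \<open>The relation on the locus where row \<open>i\<close> is orthogonal to the far ends of
  \<open>F\<close>. This locus also contains all \<open>b\<close> with \<open>b i = 0\<close>; they
  are excluded because the next division needs a vector with nonzero pairing against
  \<open>b i\<close>.\<close>

definition perp_vanishes ::
  "nat \<Rightarrow> (mono \<Rightarrow> 'a::comm_ring_1) \<Rightarrow> nat \<Rightarrow> (nat \<times> nat) set \<Rightarrow> mono set \<Rightarrow> bool" where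
  "perp_vanishes h c i F Y \<longleftrightarrow>
     (\<forall>b. nzvec h (b i) \<longrightarrow> (\<forall>v\<in>F. edge_val h b v = 0) \<longrightarrow> (\<Sum>\<mu>\<in>Y. c \<mu> * mval F h b \<mu>) = 0)"

lemma mval_superset:
  assumes "finite E" "keys \<mu> - F \<subseteq> E" "E \<inter> F = {}"
  shows "mval F h b \<mu> = (\<Prod>v\<in>E. edge_val h b v ^ lookup \<mu> v)"
  unfolding mval_def
proof (rule prod.mono_neutral_left[OF assms(1,2)], intro ballI)
  fix v assume "v \<in> E - (keys \<mu> - F)"
  then have "v \<notin> keys \<mu>" using assms(3) by auto
  then show "edge_val h b v ^ lookup \<mu> v = 1" by (simp add: in_keys_iff)
qed

lemma mval_add: "mval F h b (\<mu> + \<nu>) = mval F h b \<mu> * mval F h b \<nu>"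
proof -
  let ?E = "(keys \<mu> \<union> keys \<nu>) - F"
  have s: "keys (\<mu> + \<nu>) \<subseteq> keys \<mu> \<union> keys \<nu>" by (rule Poly_Mapping.keys_add)
  have "mval F h b \<kappa> = (\<Prod>v\<in>?E. edge_val h b v ^ lookup \<kappa> v)"
    if "keys \<kappa> \<subseteq> keys \<mu> \<union> keys \<nu>" for \<kappa>
    using that by (intro mval_superset) auto
  from this[of \<mu>] this[of \<nu>] this[OF s] show ?thesis
    by (simp add: lookup_add power_add prod.distrib)
qed

lemma mval_insert:
  assumes "v \<notin> F"
  shows "mval F h b \<mu> = edge_val h b v ^ lookup \<mu> v * mval (insert v F) h b \<mu>"
proof (cases "v \<in> keys \<mu>")
  case True
  have "keys \<mu> - insert v F = keys \<mu> - F - {v}" by auto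
  then show ?thesis unfolding mval_def using True assms by (simp add: prod.remove[of _ v])
next
  case False
  then have "keys \<mu> - insert v F = keys \<mu> - F" by auto
  then show ?thesis unfolding mval_def using False by (simp add: in_keys_iff)
qed

lemma mval_cong:
  assumes "\<And>v. v \<in> keys \<mu> \<Longrightarrow> v \<notin> F \<Longrightarrow> edge_val h b v = edge_val h b' v"
  shows "mval F h b \<mu> = mval F h b' \<mu>"
  unfolding mval_def using assms by (intro prod.cong) auto

lemma polyfun_edge_val [polyfun_intros]:
  "(\<And>j k. polyfun (\<lambda>t. b t j k)) \<Longrightarrow> polyfun (\<lambda>t. edge_val h (b t) v)"
  unfolding edge_val_def by (intro polyfun_intros)

lemma polyfun_mval [polyfun_intros]:
  "(\<And>j k. polyfun (\<lambda>t. b t j k)) \<Longrightarrow> polyfun (\<lambda>t. mval F h (b t) \<mu>)"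
  unfolding mval_def by (intro polyfun_intros)

lemma edge_val_touch:
  assumes "v \<in> touch i"
  shows "edge_val h b v = orient i v * sform h (b i) (b (other i v))"
  using assms sform_swap[of h "b (fst v)" "b (snd v)"]
  by (auto simp: touch_def other_def orient_def edge_val_def)

lemma orient_neq_0 [simp]: "(orient i v :: 'a::{comm_ring_1,ring_no_zero_divisors}) \<noteq> 0"
  by (simp add: orient_def)

lemma edge_val_eq_0_iff:
  assumes "v \<in> touch i"
  shows "edge_val h b v = (0 :: 'a::idom) \<longleftrightarrow> sform h (b i) (b (other i v)) = 0"
  using edge_val_touch[OF assms, of h b] by simp

lemma other_neq: "v \<in> touch i \<Longrightarrow> fst v < snd v \<Longrightarrow> other i v \<noteq> i"
  by (auto simp: touch_def other_def)

lemma other_inj: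
  assumes "v \<in> touch i" "w \<in> touch i" "fst v < snd v" "fst w < snd w" "other i v = other i w"
  shows "v = w"
  using assms by (auto simp: touch_def other_def prod_eq_iff split: if_splits)

lemma star_eq_iff: "star i \<mu> = star i \<nu> \<longleftrightarrow> (\<forall>v\<in>touch i. lookup \<mu> v = lookup \<nu> v)"
  unfolding star_def fun_eq_iff by auto

section \<open>Isolating one star by orthogonality\<close>

lemma perp_vanishes_empty: "vanishes h c Y \<Longrightarrow> perp_vanishes h c i {} Y"
  unfolding vanishes_def perp_vanishes_def by blast

text \<open>Moving the vector at the far end of the edge \<open>v\<close> off the hyperplane orthogonal to
  \<open>b i\<close> lets one divide by the lowest power of the value of \<open>v\<close>.\<close>

lemma perp_vanishes_insert:
  fixes c :: "mono \<Rightarrow> 'a::{field,infinite}"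
  assumes fin: "finite Y" and v: "v \<in> touch i" "fst v < snd v" "v \<notin> F"
    and F: "\<And>w. w \<in> F \<Longrightarrow> w \<in> touch i \<and> fst w < snd w"
    and e: "\<And>\<mu>. \<mu> \<in> Y \<Longrightarrow> e \<le> lookup \<mu> v"
    and Q: "perp_vanishes h c i F Y"
  shows "perp_vanishes h c i (insert v F) {\<mu>\<in>Y. lookup \<mu> v = e}"
  unfolding perp_vanishes_def
proof (intro allI impI)
  fix b :: "nat \<Rightarrow> nat \<Rightarrow> 'a"
  assume nz: "nzvec h (b i)" and zero: "\<forall>w\<in>insert v F. edge_val h b w = 0"
  define j where "j = other i v"
  have ij: "j \<noteq> i" using other_neq[OF v(1,2)] by (simp add: j_def)
  obtain z where z: "sform h (b i) z = 1" using sform_nondegenerate nz by blast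
  define B where "B t = b(j := \<lambda>k. b j k + t * z k)" for t
  have Bi: "B t i = b i" for t using ij by (simp add: B_def)
  have pB: "polyfun (\<lambda>t. B t l k)" for l k
    by (cases "l = j") (auto simp: B_def intro!: polyfun_intros)
  have evv: "edge_val h (B t) v = orient i v * t" for t
  proof -
    have "sform h (b i) (b j) = 0" using zero edge_val_eq_0_iff[OF v(1)] j_def by auto
    then show ?thesis unfolding edge_val_touch[OF v(1)] Bi j_def[symmetric]
      by (simp add: B_def sform_shift z)
  qed
  \<comment> \<open>Distinct edges at \<open>i\<close> have distinct far ends, so moving the far end
    of \<open>v\<close> leaves the edges of \<open>F\<close> at 0.\<close>
  have evw: "edge_val h (B t) w = 0" if "w \<in> F" for w t
  proof -
    have w: "w \<in> touch i" "fst w < snd w" using F[OF that] by auto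
    have "v = w" if "other i w = j"
      using other_inj[OF v(1) w(1) v(2) w(2)] that j_def by simp
    then have "other i w \<noteq> j" using v(3) \<open>w \<in> F\<close> by blast
    then have "edge_val h (B t) w = edge_val h b w"
      unfolding edge_val_touch[OF w(1)] Bi by (simp add: B_def)
    then show ?thesis using zero that by simp
  qed
  define s where "s = (orient i v :: 'a)"
  \<comment> \<open>\<open>G\<close> is the sum with \<open>(s * t) ^ e\<close> cancelled; at
    \<open>t = 0\<close> exactly the terms of exponent \<open>e\<close> remain.\<close>
  define G where
    "G t = (\<Sum>\<mu>\<in>Y. c \<mu> * ((s * t) ^ (lookup \<mu> v - e) * mval (insert v F) h (B t) \<mu>))" for t
  have sG: "(s * t) ^ e * G t = 0" for t
  proof -
    have "(s * t) ^ e * G t = (\<Sum>\<mu>\<in>Y. c \<mu> * mval F h (B t) \<mu>)"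
      unfolding G_def sum_distrib_left
    proof (rule sum.cong[OF refl])
      fix \<mu> assume "\<mu> \<in> Y"
      then have "(s * t) ^ lookup \<mu> v = (s * t) ^ e * (s * t) ^ (lookup \<mu> v - e)"
        using e by (simp flip: power_add)
      then show "(s * t) ^ e * (c \<mu> * ((s * t) ^ (lookup \<mu> v - e) * mval (insert v F) h (B t) \<mu>))
          = c \<mu> * mval F h (B t) \<mu>"
        unfolding mval_insert[OF v(3)] evv s_def[symmetric] by (simp add: mult_ac)
    qed
    also have "\<dots> = 0"
      using Q[unfolded perp_vanishes_def, rule_format, of "B t"] nz evw by (simp add: Bi)
    finally show ?thesis .
  qed
  have "G t = 0" if "t \<notin> {0}" for t using sG[of t] that by (simp add: s_def)
  moreover have "polyfun G" unfolding G_def by (intro polyfun_intros pB)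
  ultimately have "G 0 = 0" using polyfun_eq_0[of G "{0}" 0] by simp
  moreover have "B 0 = b" by (simp add: B_def)
  moreover have "(0::'a) ^ (lookup \<mu> v - e) = (if lookup \<mu> v = e then 1 else 0)" if "\<mu> \<in> Y" for \<mu>
    using e[OF that] by auto
  ultimately have "(\<Sum>\<mu>\<in>Y. if lookup \<mu> v = e then c \<mu> * mval (insert v F) h b \<mu> else 0) = 0"
    unfolding G_def by (simp add: if_distrib if_distribR cong: sum.cong if_cong)
  then show "(\<Sum>\<mu>\<in>{\<mu> \<in> Y. lookup \<mu> v = e}. c \<mu> * mval (insert v F) h b \<mu>) = 0"
    by (simp add: sum.inter_filter[OF fin])
qed

lemma mval_split_star:
  assumes "F \<subseteq> touch i"
  shows "mval F h b \<mu> =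
    (\<Prod>v\<in>{v. star i \<mu> v \<noteq> 0} - F. edge_val h b v ^ star i \<mu> v) * mval (touch i) h b \<mu>"
proof -
  have K: "{v. star i \<mu> v \<noteq> 0} = keys \<mu> \<inter> touch i" by (auto simp: star_def in_keys_iff)
  have "keys \<mu> - F = (keys \<mu> \<inter> touch i - F) \<union> (keys \<mu> - touch i)" using assms by auto
  then have "mval F h b \<mu> = (\<Prod>v\<in>keys \<mu> \<inter> touch i - F. edge_val h b v ^ lookup \<mu> v) * mval (touch i) h b \<mu>"
    unfolding mval_def by (simp only:) (intro prod.union_disjoint; auto)
  also have "(\<Prod>v\<in>keys \<mu> \<inter> touch i - F. edge_val h b v ^ lookup \<mu> v)
     = (\<Prod>v\<in>keys \<mu> \<inter> touch i - F. edge_val h b v ^ star i \<mu> v)"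
    by (intro prod.cong) (auto simp: star_def)
  finally show ?thesis by (simp only: K)
qed

lemma finite_star_support [simp]: "finite {v. star i \<mu> v \<noteq> 0}"
  by (rule finite_subset[of _ "keys \<mu>"]) (auto simp: star_def in_keys_iff)

lemma mval_touch_cong: "(\<And>j. j \<noteq> i \<Longrightarrow> b j = b' j) \<Longrightarrow> mval (touch i) h b \<mu> = mval (touch i) h b' \<mu>"
  by (intro mval_cong) (auto simp: touch_def edge_val_def)

lemma vanishes_star_classI:
  assumes "\<And>\<mu>. \<mu> \<in> Y \<Longrightarrow> star i \<mu> = a"
    and "\<And>b. (\<Sum>\<mu>\<in>Y. c \<mu> * mval (touch i) h b \<mu>) = 0"
  shows "vanishes h c Y"
  unfolding vanishes_def
proof
  fix b
  have "(\<Sum>\<mu>\<in>Y. c \<mu> * mval {} h b \<mu>)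
    = (\<Sum>\<mu>\<in>Y. (\<Prod>v\<in>{v. a v \<noteq> 0}. edge_val h b v ^ a v) * (c \<mu> * mval (touch i) h b \<mu>))"
    using mval_split_star[of "{}" i h b] assms(1) by (intro sum.cong) (auto simp: mult_ac)
  then show "(\<Sum>\<mu>\<in>Y. c \<mu> * mval {} h b \<mu>) = 0"
    using assms(2) by (simp flip: sum_distrib_left)
qed

text \<open>All terms share one star, a common factor \<open>S\<close> to be cancelled, and the
  cofactor does not involve \<open>b i\<close>. Hence row \<open>i\<close> may be replaced by a
  nonzero vector orthogonal to the far ends of \<open>F\<close>, which exists because
  \<open>card F < 2*h\<close>.\<close>

lemma perp_vanishes_final:
  fixes c :: "mono \<Rightarrow> 'a::{field,infinite}"
  assumes fin: "finite Y" "finite F" and cF: "card F < 2*h"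
    and F: "\<And>w. w \<in> F \<Longrightarrow> w \<in> touch i \<and> fst w < snd w"
    and Y: "edge_mons Y" "\<And>\<mu>. \<mu> \<in> Y \<Longrightarrow> star i \<mu> = a"
    and Q: "perp_vanishes h c i F Y"
  shows "vanishes h c Y"
proof (cases "Y = {}")
  case True
  then show ?thesis by (simp add: vanishes_def)
next
  case False
  then obtain \<mu>0 where mu0: "\<mu>0 \<in> Y" by blast
  have asupp: "fst v < snd v \<and> v \<in> touch i" if "a v \<noteq> 0" for v
    using Y(2)[OF mu0] that Y(1) mu0 unfolding edge_mons_def
    by (auto simp: star_def in_keys_iff split: if_splits)
  have afin: "finite {v. a v \<noteq> 0}" using Y(2)[OF mu0] finite_star_support by blast
  show ?thesis
  proof (rule vanishes_star_classI[OF Y(2)])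
    fix b0 :: "nat \<Rightarrow> nat \<Rightarrow> 'a"
    have "card (other i ` F) < 2*h" using card_image_le[OF fin(2), of "other i"] cF by linarith
    then obtain y where y: "nzvec h y" "\<forall>j\<in>other i ` F. sform h y (b0 j) = 0"
      using exists_orthogonal[OF finite_imageI[OF fin(2)], of "other i" h b0] by blast
    obtain z where z: "sform h y z = 1" using sform_nondegenerate y(1) by blast
    \<comment> \<open>The far ends outside \<open>F\<close> are shifted along \<open>z\<close> so
      that \<open>S\<close> becomes nonzero for some \<open>t\<close>; at \<open>t = 0\<close> all
      rows except \<open>i\<close> are those of \<open>b0\<close>.\<close>
    define B where
      "B t j = (if j = i then y else if j \<in> other i ` F then b0 j else (\<lambda>k. b0 j k + t * z k))" for t j
    have pB: "polyfun (\<lambda>t. B t l k)" for l k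
      by (cases "l = i"; cases "l \<in> other i ` F"; auto simp: B_def intro!: polyfun_intros)
    define S where "S t = (\<Prod>v\<in>{v. a v \<noteq> 0} - F. edge_val h (B t) v ^ a v)" for t
    define G where "G t = (\<Sum>\<mu>\<in>Y. c \<mu> * mval (touch i) h (B t) \<mu>)" for t
    have SG: "S t * G t = 0" for t
    proof -
      have "edge_val h (B t) w = 0" if "w \<in> F" for w
        using F[OF that] other_neq[of w i] y(2) that
        by (auto simp: edge_val_eq_0_iff B_def)
      then have "(\<Sum>\<mu>\<in>Y. c \<mu> * mval F h (B t) \<mu>) = 0"
        using Q y(1) unfolding perp_vanishes_def by (auto simp: B_def)
      moreover have "mval F h (B t) \<mu> = S t * mval (touch i) h (B t) \<mu>" if "\<mu> \<in> Y" for \<mu>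
      proof -
        have "F \<subseteq> touch i" using F by blast
        from mval_split_star[OF this, of h "B t" \<mu>] show ?thesis by (simp only: S_def Y(2)[OF that])
      qed
      ultimately show ?thesis unfolding G_def sum_distrib_left by (simp add: mult_ac)
    qed
    have "\<exists>t. S t \<noteq> 0"
    proof -
      have "\<exists>t. edge_val h (B t) v ^ a v \<noteq> 0" if "v \<in> {v. a v \<noteq> 0} - F" for v
      proof -
        have v: "v \<in> touch i" "fst v < snd v" "v \<notin> F" using asupp that by auto
        then have "other i v \<notin> other i ` F" using other_inj[OF v(1)] F by (metis imageE)
        then have "edge_val h (B t) v = orient i v * (sform h y (b0 (other i v)) + t)" for t
          unfolding edge_val_touch[OF v(1)] using other_neq[OF v(1,2)]
          by (simp add: B_def sform_shift z)
        from this[of "1 - sform h y (b0 (other i v))"] show ?thesis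
          by (intro exI[of _ "1 - sform h y (b0 (other i v))"]) simp
      qed
      moreover have "polyfun (\<lambda>t. edge_val h (B t) v ^ a v)" for v by (intro polyfun_intros pB)
      moreover have Ffin: "finite ({v. a v \<noteq> 0} - F)" using afin by simp
      ultimately obtain t where "\<And>v. v \<in> {v. a v \<noteq> 0} - F \<Longrightarrow> edge_val h (B t) v ^ a v \<noteq> 0"
        using polyfun_common_nonzero[of "{v. a v \<noteq> 0} - F" "\<lambda>v t. edge_val h (B t) v ^ a v"] by blast
      then have "S t \<noteq> 0" unfolding S_def prod_zero_iff[OF Ffin] by blast
      then show ?thesis by blast
    qed
    then obtain t0 where "S t0 \<noteq> 0" by blast
    have "G 0 = 0"
    proof (rule polyfun_mult_eq_0[where g = S and g' = G and a = t0])
      show "polyfun S" "polyfun G" unfolding S_def G_def by (intro polyfun_intros pB)+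
    qed (use SG \<open>S t0 \<noteq> 0\<close> in auto)
    moreover have "mval (touch i) h (B 0) \<mu> = mval (touch i) h b0 \<mu>" for \<mu>
      by (rule mval_touch_cong) (auto simp: B_def)
    ultimately show "(\<Sum>\<mu>\<in>Y. c \<mu> * mval (touch i) h b0 \<mu>) = 0" by (simp add: G_def)
  qed
qed

text \<open>Repeatedly keep the monomials of least degree in an edge at \<open>i\<close> on which they differ:
  each step costs one dimension and at least one star.\<close>

lemma perp_vanishes_subset:
  fixes c :: "mono \<Rightarrow> 'a::{field,infinite}"
  assumes "finite Y" "finite F" "Y \<noteq> {}" "edge_mons Y" "perp_vanishes h c i F Y"
    and "\<And>w. w \<in> F \<Longrightarrow> w \<in> touch i \<and> fst w < snd w"
    and "\<And>w \<mu> \<nu>. w \<in> F \<Longrightarrow> \<mu> \<in> Y \<Longrightarrow> \<nu> \<in> Y \<Longrightarrow> lookup \<mu> w = lookup \<nu> w"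
    and "card F + card (star i ` Y) \<le> 2*h"
  shows "\<exists>Z\<subseteq>Y. Z \<noteq> {} \<and> vanishes h c Z \<and> (\<exists>a. \<forall>\<mu>\<in>Z. star i \<mu> = a)"
  using assms
proof (induction "card (star i ` Y)" arbitrary: F Y rule: less_induct)
  case less
  note Y = less.prems(1,3,4) and F = less.prems(2,6,7)
  from Y(2) obtain \<mu>0 where mu0: "\<mu>0 \<in> Y" by blast
  show ?case
  proof (cases "\<forall>\<mu>\<in>Y. star i \<mu> = star i \<mu>0")
    case True
    then have "star i ` Y = {star i \<mu>0}" using mu0 by blast
    \<comment> \<open>The last star takes one unit of the budget, which leaves the strict inequality
      required for an orthogonal vector.\<close>
    then have "card F < 2*h" using less.prems(8) by simp
    then have "vanishes h c Y"
      using True by (intro perp_vanishes_final[OF Y(1) F(1) _ F(2) Y(3) _ less.prems(5)]) blast+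
    then show ?thesis using Y(2) True by blast
  next
    case False
    then obtain \<mu>1 v where mu1: "\<mu>1 \<in> Y" "v \<in> touch i" "lookup \<mu>1 v \<noteq> lookup \<mu>0 v"
      unfolding star_eq_iff by blast
    have "v \<in> keys \<mu>1 \<or> v \<in> keys \<mu>0" using mu1(3) by (auto simp: in_keys_iff)
    then have v: "fst v < snd v" using Y(3) mu1 mu0 unfolding edge_mons_def by blast
    have vF: "v \<notin> F" using F(3) mu0 mu1 by blast
    define e where "e = Min ((\<lambda>\<mu>. lookup \<mu> v) ` Y)"
    have e: "e \<le> lookup \<mu> v" if "\<mu> \<in> Y" for \<mu> unfolding e_def using that Y(1) by simp
    have "e \<in> (\<lambda>\<mu>. lookup \<mu> v) ` Y" unfolding e_def using Y by (intro Min_in) auto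
    define Y' where "Y' = {\<mu>\<in>Y. lookup \<mu> v = e}"
    have Y': "Y' \<subseteq> Y" "Y' \<noteq> {}" using \<open>e \<in> _\<close> by (auto simp: Y'_def)
    obtain \<mu>2 where mu2: "\<mu>2 \<in> Y" "lookup \<mu>2 v \<noteq> e" using mu0 mu1 by metis
    have "star i \<mu>2 \<notin> star i ` Y'" using mu2 mu1(2) by (auto simp: Y'_def star_eq_iff)
    then have "star i ` Y' \<subset> star i ` Y" using Y' mu2(1) by auto
    then have card: "card (star i ` Y') < card (star i ` Y)" using Y(1) by (simp add: psubset_card_mono)
    have "\<exists>Z\<subseteq>Y'. Z \<noteq> {} \<and> vanishes h c Z \<and> (\<exists>a. \<forall>\<mu>\<in>Z. star i \<mu> = a)"
    proof (rule less.hyps[OF card, of "insert v F"])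
      show "finite Y'" using Y(1) Y'(1) by (rule rev_finite_subset)
      show "finite (insert v F)" using F(1) by simp
      show "Y' \<noteq> {}" by (rule Y'(2))
      show "edge_mons Y'" using Y(3) Y'(1) unfolding edge_mons_def by blast
      show "perp_vanishes h c i (insert v F) Y'" unfolding Y'_def
        by (rule perp_vanishes_insert[OF Y(1) mu1(2) v vF F(2) e less.prems(5)])
      show "card (insert v F) + card (star i ` Y') \<le> 2 * h" using card vF F(1) less.prems(8) by simp
      fix w assume w: "w \<in> insert v F"
      show "w \<in> touch i \<and> fst w < snd w" using w F(2) mu1(2) v by blast
      fix \<mu> \<nu> assume "\<mu> \<in> Y'" "\<nu> \<in> Y'"
      then have "lookup \<mu> v = e" "lookup \<nu> v = e" "\<mu> \<in> Y" "\<nu> \<in> Y" by (auto simp: Y'_def)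
      then show "lookup \<mu> w = lookup \<nu> w" using w F(3) by (metis insertE)
    qed
    then show ?thesis using Y'(1) by blast
  qed
qed

text \<open>An additional symplectic block makes the row of \<open>i\<close> arbitrary without changing the
  other entries.\<close>

lemma vanishes_star_class:
  fixes c :: "mono \<Rightarrow> 'a::{field,infinite}"
  assumes fin: "finite X" and X: "edge_mons X" and van: "vanishes (Suc h) c X"
  shows "vanishes h c {\<mu>\<in>X. star i \<mu> = a}"
proof (rule vanishes_star_classI[where i = i and a = a])
  fix b :: "nat \<Rightarrow> nat \<Rightarrow> 'a"
  define E where "E = (\<Union>\<mu>\<in>X. keys \<mu>) \<inter> touch i"
  have E: "finite E" "E \<subseteq> touch i" "\<And>v. v \<in> E \<Longrightarrow> fst v < snd v"
    using fin X by (auto simp: E_def edge_mons_def)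
  have cl: "star i \<mu> = star i \<nu> \<longleftrightarrow> (\<forall>v\<in>E. lookup \<mu> v = lookup \<nu> v)" if "\<mu> \<in> X" "\<nu> \<in> X" for \<mu> \<nu>
  proof -
    have "lookup \<mu> v = 0 \<and> lookup \<nu> v = 0" if "v \<in> touch i" "v \<notin> E" for v
      using that \<open>\<mu> \<in> X\<close> \<open>\<nu> \<in> X\<close> by (auto simp: E_def in_keys_iff)
    then show ?thesis unfolding star_eq_iff using E(2) by (metis subsetD)
  qed
  show "(\<Sum>\<mu>\<in>{\<mu>\<in>X. star i \<mu> = a}. c \<mu> * mval (touch i) h b \<mu>) = 0"
  proof (cases "{\<mu>\<in>X. star i \<mu> = a} = {}")
    case True
    then show ?thesis by (simp only: sum.empty)
  next
    case False
    then obtain \<mu>0 where mu0: "\<mu>0 \<in> X" "star i \<mu>0 = a" by blast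
    have "(\<Sum>\<mu>\<in>X. (c \<mu> * mval (touch i) h b \<mu>) * (\<Prod>v\<in>E. y v ^ lookup \<mu> v)) = 0" for y :: "nat \<times> nat \<Rightarrow> 'a"
    proof -
      \<comment> \<open>Row \<open>i\<close> is the first basis vector of the new plane, and row
        \<open>j\<close> stores the wanted entry of row \<open>i\<close> as its coordinate
        \<open>2*h+1\<close>, negated for \<open>j < i\<close>. The other rows have coordinate
        \<open>2*h\<close> equal to 0, so their mutual pairings do not change.\<close>
      define B where "B j k = (if k < 2*h then (if j = i then 0 else b j k)
        else if k = 2*h then (if j = i then 1 else 0)
        else (if j = i then 0 else if i < j then y (i,j) else - y (j,i)))" for j k
      have S: "sform (Suc h) (B j) (B l) = sform h (b j) (b l)" if "j \<noteq> i" "l \<noteq> i" for j l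
      proof -
        have "sform h (B j) (B l) = sform h (b j) (b l)"
          unfolding sform_def using that by (intro sum.cong) (auto simp: B_def)
        then show ?thesis using that by (simp add: sform_def B_def)
      qed
      have S': "sform (Suc h) (B i) (B j) = (if i < j then y (i,j) else - y (j,i))" if "j \<noteq> i" for j
      proof -
        have "sform h (B i) (B j) = 0" unfolding sform_def by (intro sum.neutral) (auto simp: B_def)
        then show ?thesis using that by (simp add: sform_def B_def)
      qed
      have ev: "edge_val (Suc h) B v = y v" if "v \<in> E" for v
      proof -
        have v: "v \<in> touch i" "fst v < snd v" using E(2,3) that by blast+
        then show ?thesis unfolding edge_val_touch[OF v(1)] S'[OF other_neq[OF v]]
          by (cases v) (auto simp: touch_def other_def orient_def)
      qed
      have "mval (touch i) (Suc h) B \<mu> = mval (touch i) h b \<mu>" for \<mu>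
        unfolding mval_def by (intro prod.cong) (auto simp: touch_def edge_val_def S)
      moreover have "mval {} (Suc h) B \<mu> = (\<Prod>v\<in>E. y v ^ lookup \<mu> v) * mval (touch i) (Suc h) B \<mu>"
        if "\<mu> \<in> X" for \<mu>
      proof -
        let ?U = "\<Union>\<mu>\<in>X. keys \<mu>"
        have "mval {} (Suc h) B \<mu> = (\<Prod>v\<in>?U. edge_val (Suc h) B v ^ lookup \<mu> v)"
          using that fin by (intro mval_superset) auto
        also have "?U = E \<union> (?U - touch i)" by (auto simp: E_def)
        also have "(\<Prod>v\<in>E \<union> (?U - touch i). edge_val (Suc h) B v ^ lookup \<mu> v)
           = (\<Prod>v\<in>E. edge_val (Suc h) B v ^ lookup \<mu> v) * (\<Prod>v\<in>?U - touch i. edge_val (Suc h) B v ^ lookup \<mu> v)"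
          using E fin by (intro prod.union_disjoint) auto
        also have "(\<Prod>v\<in>?U - touch i. edge_val (Suc h) B v ^ lookup \<mu> v) = mval (touch i) (Suc h) B \<mu>"
          using that fin by (intro mval_superset[symmetric]) auto
        also have "(\<Prod>v\<in>E. edge_val (Suc h) B v ^ lookup \<mu> v) = (\<Prod>v\<in>E. y v ^ lookup \<mu> v)"
          by (intro prod.cong) (auto simp: ev)
        finally show ?thesis .
      qed
      moreover have "(\<Sum>\<mu>\<in>X. c \<mu> * mval {} (Suc h) B \<mu>) = 0" using van by (simp add: vanishes_def)
      ultimately show ?thesis by (simp add: mult_ac)
    qed
    from monomial_sum_eq_0[OF E(1) fin this, of "lookup \<mu>0"]
    have "(\<Sum>\<mu>\<in>{\<mu>\<in>X. \<forall>v\<in>E. lookup \<mu> v = lookup \<mu>0 v}. c \<mu> * mval (touch i) h b \<mu>) = 0" .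
    moreover have "{\<mu>\<in>X. \<forall>v\<in>E. lookup \<mu> v = lookup \<mu>0 v} = {\<mu>\<in>X. star i \<mu> = a}"
      using cl mu0 by auto
    ultimately show ?thesis by simp
  qed
qed auto

section \<open>The lower bound\<close>


lemma card_image_eq_1I: "X \<noteq> {} \<Longrightarrow> (\<And>x. x \<in> X \<Longrightarrow> f x = a) \<Longrightarrow> card (f ` X) = 1"
  by (subgoal_tac "f ` X = {a}") auto

lemma card_image_eq_1D: "card (f ` X) = 1 \<Longrightarrow> x \<in> X \<Longrightarrow> y \<in> X \<Longrightarrow> f x = f y"
  by (metis card_1_singletonE imageI singletonD)

section \<open>Minimal vanishing sums\<close>

definition minimal_vanishing :: "nat \<Rightarrow> (mono \<Rightarrow> 'a::comm_ring_1) \<Rightarrow> mono set \<Rightarrow> bool" where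
  "minimal_vanishing h c X \<longleftrightarrow> finite X \<and> X \<noteq> {} \<and> edge_mons X \<and> vanishes h c X \<and>
     (\<forall>Z\<subseteq>X. Z \<noteq> {} \<longrightarrow> vanishes h c Z \<longrightarrow> Z = X)"

lemma minimal_vanishingD:
  "minimal_vanishing h c X \<Longrightarrow> Z \<subseteq> X \<Longrightarrow> Z \<noteq> {} \<Longrightarrow> vanishes h c Z \<Longrightarrow> Z = X"
  by (simp add: minimal_vanishing_def)

lemma exists_minimal_vanishing:
  assumes "finite X" "X \<noteq> {}" "edge_mons X" "vanishes h c X"
  shows "\<exists>Z\<subseteq>X. minimal_vanishing h c Z"
  using assms
proof (induction X rule: finite_psubset_induct)
  case (psubset X)
  show ?case
  proof (cases "minimal_vanishing h c X")
    case True
    then show ?thesis by blast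
  next
    case False
    then obtain Z where Z: "Z \<subset> X" "Z \<noteq> {}" "vanishes h c Z"
      using psubset unfolding minimal_vanishing_def by blast
    moreover have "edge_mons Z" using Z(1) psubset.prems(2) unfolding edge_mons_def by blast
    ultimately obtain Z' where "Z' \<subseteq> Z" "minimal_vanishing h c Z'" using psubset.IH by blast
    then show ?thesis using Z(1) by blast
  qed
qed

lemma minimal_vanishing_stars:
  fixes c :: "mono \<Rightarrow> 'a::{field,infinite}"
  assumes X: "minimal_vanishing h c X" and "card (star i ` X) \<noteq> 1"
  shows "2 * h < card (star i ` X)"
proof (rule ccontr)
  assume "\<not> 2 * h < card (star i ` X)"
  then have "card {} + card (star i ` X) \<le> 2 * h" by simp
  then obtain Z a where Z: "Z \<subseteq> X" "Z \<noteq> {}" "vanishes h c Z" "\<forall>\<mu>\<in>Z. star i \<mu> = a"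
    using perp_vanishes_subset[of X "{}" h c i] X perp_vanishes_empty[of h c X i]
    unfolding minimal_vanishing_def by blast
  then have "Z = X" using X unfolding minimal_vanishing_def by blast
  then have "card (star i ` X) = 1" using Z(2,4) by (intro card_image_eq_1I[of X _ a]) auto
  then show False using assms(2) by simp
qed

lemma sform_plane:
  assumes "h > 0" and "\<And>k. k \<ge> 2 \<Longrightarrow> x k = 0"
  shows "sform h x y = x 0 * y 1 - x 1 * y 0"
proof -
  have "sform h x y = (\<Sum>k<h. if k = 0 then x 0 * y 1 - x 1 * y 0 else 0)"
    unfolding sform_def using assms(2) by (intro sum.cong) auto
  then show ?thesis using assms(1) by simp
qed

text \<open>All rows are put into one symplectic plane, at the points \<open>(1, g j)\<close>, whose
  pairings are differences of distinct values.\<close>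

lemma exists_generic_points:
  assumes "h > 0"
  shows "\<exists>b :: nat \<Rightarrow> nat \<Rightarrow> 'a::{field,infinite}. \<forall>v. fst v \<noteq> snd v \<longrightarrow> edge_val h b v \<noteq> 0"
proof -
  obtain g :: "nat \<Rightarrow> 'a" where g: "inj g"
    using infinite_countable_subset[OF infinite_UNIV] by blast
  define b where "b j k = (if k = 0 then 1 else if k = 1 then g j else 0)" for j k :: nat
  have "edge_val h b v = g (snd v) - g (fst v)" for v
    unfolding edge_val_def by (subst sform_plane[OF assms]) (auto simp: b_def)
  then have "edge_val h b v \<noteq> 0" if "fst v \<noteq> snd v" for v
    using g that by (auto dest: injD)
  then show ?thesis by blast
qed

lemma not_vanishes_singleton:
  fixes c :: "mono \<Rightarrow> 'a::{field,infinite}"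
  assumes "h > 0" "c \<mu> \<noteq> 0" "edge_mons {\<mu>}"
  shows "\<not> vanishes h c {\<mu>}"
proof
  assume "vanishes h c {\<mu>}"
  obtain b :: "nat \<Rightarrow> nat \<Rightarrow> 'a" where b: "\<forall>v. fst v \<noteq> snd v \<longrightarrow> edge_val h b v \<noteq> 0"
    using exists_generic_points[OF assms(1)] by blast
  have "mval {} h b \<mu> \<noteq> 0" unfolding mval_def using b assms(3) by (auto simp: edge_mons_def)
  then show False using \<open>vanishes h c {\<mu>}\<close> assms(2) by (auto simp: vanishes_def)
qed

lemma mono_eqI_stars:
  assumes "\<And>i. star i \<mu> = star i \<nu>"
  shows "\<mu> = \<nu>"
proof (rule poly_mapping_eqI)
  fix v
  have "v \<in> touch (fst v)" by (simp add: touch_def)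
  then show "lookup \<mu> v = lookup \<nu> v" using assms[of "fst v"] star_eq_iff by blast
qed

text \<open>If no row branches, all monomials coincide, and a single monomial with nonzero
  coefficient does not vanish at generic points.\<close>

lemma minimal_vanishing_branches:
  fixes c :: "mono \<Rightarrow> 'a::{field,infinite}"
  assumes "h > 0" and X: "minimal_vanishing h c X" and c: "\<And>\<mu>. \<mu> \<in> X \<Longrightarrow> c \<mu> \<noteq> 0"
  obtains i where "card (star i ` X) \<noteq> 1"
proof (rule ccontr)
  assume "\<not> thesis"
  then have one: "card (star i ` X) = 1" for i using that by blast
  obtain \<mu> where mu: "\<mu> \<in> X" using X unfolding minimal_vanishing_def by blast
  have "\<nu> = \<mu>" if "\<nu> \<in> X" for \<nu>
  proof (rule mono_eqI_stars)
    fix i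
    show "star i \<nu> = star i \<mu>" using card_image_eq_1D[OF one that mu] .
  qed
  then have "X = {\<mu>}" using mu by blast
  then show False using X not_vanishes_singleton[OF assms(1)] c[OF mu]
    unfolding minimal_vanishing_def by blast
qed

lemma card_by_stars:
  "finite X \<Longrightarrow> card X = (\<Sum>a\<in>star i ` X. card {\<mu>\<in>X. star i \<mu> = a})"
  using sum.image_gen[of X "\<lambda>_. 1::nat" "star i"] by simp

lemma edge_mons_subset: "edge_mons X \<Longrightarrow> Z \<subseteq> X \<Longrightarrow> edge_mons Z"
  unfolding edge_mons_def by blast

theorem vanishes_lower_bound:
  fixes c :: "mono \<Rightarrow> 'a::{field,infinite}"
  assumes "finite X" "X \<noteq> {}" "edge_mons X" "\<And>\<mu>. \<mu> \<in> X \<Longrightarrow> c \<mu> \<noteq> 0" "vanishes h c X"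
  shows "dfact (2*h+1) \<le> card X"
  using assms
proof (induction h arbitrary: X)
  case 0
  then have "card X > 0" by (simp add: card_gt_0_iff)
  then show ?case by simp
next
  case (Suc h)
  obtain Z where Z: "Z \<subseteq> X" "minimal_vanishing (Suc h) c Z"
    using exists_minimal_vanishing[OF Suc.prems(1,2,3,5)] by blast
  have cZ: "c \<mu> \<noteq> 0" if "\<mu> \<in> Z" for \<mu> using that Z(1) Suc.prems(4) by blast
  have Zf: "finite Z" "edge_mons Z" "vanishes (Suc h) c Z" using Z(2) by (auto simp: minimal_vanishing_def)
  obtain i where i: "card (star i ` Z) \<noteq> 1"
    using minimal_vanishing_branches[OF zero_less_Suc Z(2) cZ] by blast
  then have n: "2 * Suc h < card (star i ` Z)" using minimal_vanishing_stars[OF Z(2)] by blast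
  \<comment> \<open>More than \<open>2*h+2\<close> stars give the new factor \<open>2*h+3\<close> of
    the double factorial.\<close>
  have "(2*h+3) * dfact (2*h+1) \<le> card (star i ` Z) * dfact (2*h+1)" using n by simp
  also have "\<dots> = (\<Sum>a\<in>star i ` Z. dfact (2*h+1))" by simp
  also have "\<dots> \<le> (\<Sum>a\<in>star i ` Z. card {\<mu>\<in>Z. star i \<mu> = a})"
  proof (rule sum_mono)
    fix a assume "a \<in> star i ` Z"
    then show "dfact (2*h+1) \<le> card {\<mu>\<in>Z. star i \<mu> = a}"
      using Zf(1) cZ vanishes_star_class[OF Zf] edge_mons_subset[OF Zf(2)]
      by (intro Suc.IH) auto
  qed
  also have "\<dots> = card Z" by (rule card_by_stars[OF Zf(1), symmetric])
  also have "\<dots> \<le> card X" using Z(1) Suc.prems(1) card_mono by blast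
  finally show ?case by (simp add: algebra_simps)
qed

section \<open>Sums attaining the bound\<close>

definition extremal :: "nat \<Rightarrow> (mono \<Rightarrow> 'a::comm_ring_1) \<Rightarrow> mono set \<Rightarrow> bool" where
  "extremal h c X \<longleftrightarrow> finite X \<and> edge_mons X \<and> (\<forall>\<mu>\<in>X. c \<mu> \<noteq> 0) \<and> vanishes h c X \<and>
     card X = dfact (2*h+1)"

text \<open>The monomials have greatest common divisor 1.\<close>

definition reduced :: "mono set \<Rightarrow> bool" where
  "reduced X \<longleftrightarrow> (\<forall>v. \<exists>\<mu>\<in>X. lookup \<mu> v = 0)"

lemma dfact_pos: "dfact n > 0"
  by (induction n rule: dfact.induct) auto

text \<open>A proper vanishing part would have fewer terms than the lower bound allows.\<close>

lemma extremal_minimal_vanishing: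
  fixes c :: "mono \<Rightarrow> 'a::{field,infinite}"
  assumes "extremal h c X"
  shows "minimal_vanishing h c X"
proof -
  have X: "finite X" "edge_mons X" "\<And>\<mu>. \<mu> \<in> X \<Longrightarrow> c \<mu> \<noteq> 0" "vanishes h c X" "card X = dfact (2*h+1)"
    using assms by (auto simp: extremal_def)
  have "X \<noteq> {}" using X(5) dfact_pos[of "2*h+1"] by (metis card.empty less_irrefl)
  moreover have "Z = X" if "Z \<subseteq> X" "Z \<noteq> {}" "vanishes h c Z" for Z
  proof -
    have "finite Z" using that(1) X(1) finite_subset by blast
    then have "dfact (2*h+1) \<le> card Z"
      using that X(3) edge_mons_subset[OF X(2) that(1)] by (intro vanishes_lower_bound) blast+
    then show ?thesis using X(1,5) that(1) by (simp add: card_seteq)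
  qed
  ultimately show ?thesis using X unfolding minimal_vanishing_def by blast
qed

text \<open>The count by stars uses two inequalities, at least \<open>2*h+3\<close> classes and at
  least \<open>N\<close> terms in each; a total of \<open>(2*h+3) * N\<close> makes both
  tight.\<close>

lemma extremal_stars:
  fixes c :: "mono \<Rightarrow> 'a::{field,infinite}"
  assumes X: "extremal (Suc h) c X" and i: "card (star i ` X) \<noteq> 1"
  shows "card (star i ` X) = 2*h+3"
    and "\<And>a. a \<in> star i ` X \<Longrightarrow> extremal h c {\<mu>\<in>X. star i \<mu> = a}"
proof -
  have Xf: "finite X" "edge_mons X" "\<And>\<mu>. \<mu> \<in> X \<Longrightarrow> c \<mu> \<noteq> 0" "vanishes (Suc h) c X"
     "card X = dfact (2*Suc h+1)"
    using X by (auto simp: extremal_def)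
  define N where "N = dfact (2*h+1)"
  have N: "N > 0" "card X = (2*h+3) * N" using Xf(5) dfact_pos by (simp_all add: N_def algebra_simps)
  have n: "2*h+3 \<le> card (star i ` X)"
    using minimal_vanishing_stars[OF extremal_minimal_vanishing[OF X] i] by simp
  have cl: "vanishes h c {\<mu>\<in>X. star i \<mu> = a}" "edge_mons {\<mu>\<in>X. star i \<mu> = a}" for a
    using vanishes_star_class[OF Xf(1,2,4)] edge_mons_subset[OF Xf(2)] by auto
  have le: "N \<le> card {\<mu>\<in>X. star i \<mu> = a}" if "a \<in> star i ` X" for a
    unfolding N_def using that Xf(1,3) cl[of a] by (intro vanishes_lower_bound) auto
  have tot: "(\<Sum>a\<in>star i ` X. card {\<mu>\<in>X. star i \<mu> = a}) = (2*h+3) * N"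
    using card_by_stars[OF Xf(1), of i] N(2) by simp
  have "(\<Sum>a\<in>star i ` X. N) \<le> (\<Sum>a\<in>star i ` X. card {\<mu>\<in>X. star i \<mu> = a})"
    by (rule sum_mono) (rule le)
  then have "card (star i ` X) * N \<le> (2*h+3) * N" using tot by simp
  then show c: "card (star i ` X) = 2*h+3" using n N(1) by simp
  fix a assume a: "a \<in> star i ` X"
  have "card {\<mu>\<in>X. star i \<mu> = a} = N"
  proof (rule ccontr)
    assume "card {\<mu>\<in>X. star i \<mu> = a} \<noteq> N"
    then have "N < card {\<mu>\<in>X. star i \<mu> = a}" using le[OF a] by simp
    then have "(\<Sum>a\<in>star i ` X. N) < (\<Sum>a\<in>star i ` X. card {\<mu>\<in>X. star i \<mu> = a})"
      using Xf(1) le a by (intro sum_strict_mono_ex1) auto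
    then show False using tot c by simp
  qed
  then show "extremal h c {\<mu>\<in>X. star i \<mu> = a}"
    unfolding extremal_def using cl[of a] Xf by (simp add: N_def)
qed

text \<open>A variable shared by two stars would remove both when set to 0, at the cost of one
  dimension: \<open>1 + (2*h+1)\<close> still fits into \<open>2 * Suc h\<close>, so elimination
  would find a vanishing part free of that variable, against minimality. Reducedness guarantees that
  terms of exponent 0 exist.\<close>

lemma extremal_star_disjoint:
  fixes c :: "mono \<Rightarrow> 'a::{field,infinite}"
  assumes X: "extremal (Suc h) c X" and red: "reduced X"
    and v: "v \<in> touch i" and mu: "\<mu> \<in> X" "lookup \<mu> v \<noteq> 0" and nu: "\<nu> \<in> X" "lookup \<nu> v \<noteq> 0"
  shows "star i \<mu> = star i \<nu>"
proof (rule ccontr)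
  assume ne: "star i \<mu> \<noteq> star i \<nu>"
  have Xf: "finite X" "edge_mons X" "vanishes (Suc h) c X" using X by (auto simp: extremal_def)
  have v2: "fst v < snd v" using Xf(2) mu by (auto simp: edge_mons_def in_keys_iff)
  have "card (star i ` X) \<noteq> 1" using ne card_image_eq_1D[OF _ mu(1) nu(1)] by metis
  then have c: "card (star i ` X) = 2*h+3" using extremal_stars(1) X by blast
  define Y where "Y = {\<mu>\<in>X. lookup \<mu> v = 0}"
  have Y: "Y \<subseteq> X" "Y \<noteq> {}" using red[unfolded reduced_def, rule_format, of v] by (auto simp: Y_def)
  have pv: "perp_vanishes (Suc h) c i {v} Y"
    unfolding Y_def by (rule perp_vanishes_insert[OF Xf(1) v v2 _ _ _ perp_vanishes_empty[OF Xf(3)]]) auto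
  have "star i ` Y \<subseteq> star i ` X - {star i \<mu>, star i \<nu>}"
    using v mu nu by (auto simp: Y_def star_eq_iff)
  then have "card (star i ` Y) \<le> card (star i ` X - {star i \<mu>, star i \<nu>})"
    using Xf(1) by (intro card_mono) auto
  also have "\<dots> = 2*h+1" using c ne mu(1) nu(1) Xf(1) by (simp add: card_Diff_subset)
  finally have "card {v} + card (star i ` Y) \<le> 2 * Suc h" by simp
  moreover have "finite Y" by (rule finite_subset[OF Y(1) Xf(1)])
  moreover have "edge_mons Y" by (rule edge_mons_subset[OF Xf(2) Y(1)])
  ultimately have "\<exists>Z\<subseteq>Y. Z \<noteq> {} \<and> vanishes (Suc h) c Z \<and> (\<exists>a. \<forall>\<mu>\<in>Z. star i \<mu> = a)"
    using v v2 by (intro perp_vanishes_subset[OF _ _ Y(2) _ pv]) (auto simp: Y_def)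
  then obtain Z where Z: "Z \<subseteq> Y" "Z \<noteq> {}" "vanishes (Suc h) c Z" by blast
  have "Z = X"
    using minimal_vanishingD[OF extremal_minimal_vanishing[OF X] _ Z(2,3)] Z(1) Y(1) by simp
  then have "\<mu> \<in> Y" using Z(1) mu(1) by blast
  then show False using mu(2) by (simp add: Y_def)
qed

definition star_deg :: "(nat \<times> nat \<Rightarrow> nat) \<Rightarrow> nat" where
  "star_deg a = (\<Sum>v | a v \<noteq> 0. a v)"

text \<open>Scaling row \<open>i\<close> by \<open>t\<close> multiplies each term by
  \<open>t\<close> to the degree of its star, so every homogeneous part vanishes; by minimality
  there is only one.\<close>

lemma minimal_vanishing_star_deg:
  fixes c :: "mono \<Rightarrow> 'a::{field,infinite}"
  assumes X: "minimal_vanishing h c X" and mu: "\<mu> \<in> X" and nu: "\<nu> \<in> X"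
  shows "star_deg (star i \<mu>) = star_deg (star i \<nu>)"
proof -
  have Xf: "finite X" "edge_mons X" "vanishes h c X" using X by (auto simp: minimal_vanishing_def)
  let ?Z = "{\<kappa>\<in>X. star_deg (star i \<kappa>) = star_deg (star i \<mu>)}"
  have "vanishes h c ?Z"
    unfolding vanishes_def
  proof
    fix b :: "nat \<Rightarrow> nat \<Rightarrow> 'a"
    have "(\<Sum>\<kappa>\<in>X. (c \<kappa> * mval {} h b \<kappa>) * t ^ star_deg (star i \<kappa>)) = 0" for t
    proof -
      define B where "B = b(i := \<lambda>k. t * b i k)"
      have ev: "edge_val h B v = t * edge_val h b v" if "v \<in> touch i" "fst v < snd v" for v
        using other_neq[OF that] sform_lin_left[of h t "b i" 0 "\<lambda>_. 0" "b (other i v)"]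
        unfolding edge_val_touch[OF that(1)] by (simp add: B_def mult_ac)
      have "mval {} h B \<kappa> = t ^ star_deg (star i \<kappa>) * mval {} h b \<kappa>" if "\<kappa> \<in> X" for \<kappa>
      proof -
        have "(\<Prod>v\<in>{v. star i \<kappa> v \<noteq> 0}. edge_val h B v ^ star i \<kappa> v)
          = (\<Prod>v\<in>{v. star i \<kappa> v \<noteq> 0}. t ^ star i \<kappa> v * edge_val h b v ^ star i \<kappa> v)"
        proof (rule prod.cong[OF refl])
          fix v assume "v \<in> {v. star i \<kappa> v \<noteq> 0}"
          then have "v \<in> touch i" "v \<in> keys \<kappa>" by (auto simp: star_def in_keys_iff split: if_splits)
          then have "edge_val h B v = t * edge_val h b v"
            using ev Xf(2) that by (auto simp: edge_mons_def)
          then show "edge_val h B v ^ star i \<kappa> v = t ^ star i \<kappa> v * edge_val h b v ^ star i \<kappa> v"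
            by (simp add: power_mult_distrib)
        qed
        also have "\<dots> = t ^ star_deg (star i \<kappa>) * (\<Prod>v\<in>{v. star i \<kappa> v \<noteq> 0}. edge_val h b v ^ star i \<kappa> v)"
          by (simp add: prod.distrib star_deg_def power_sum)
        finally have p: "(\<Prod>v\<in>{v. star i \<kappa> v \<noteq> 0}. edge_val h B v ^ star i \<kappa> v) =
          t ^ star_deg (star i \<kappa>) * (\<Prod>v\<in>{v. star i \<kappa> v \<noteq> 0}. edge_val h b v ^ star i \<kappa> v)" .
        have "mval (touch i) h B \<kappa> = mval (touch i) h b \<kappa>"
          by (rule mval_touch_cong) (simp add: B_def)
        then show ?thesis
          using mval_split_star[of "{}" i h B \<kappa>] mval_split_star[of "{}" i h b \<kappa>] p
          by (simp add: mult_ac)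
      qed
      then have "(\<Sum>\<kappa>\<in>X. (c \<kappa> * mval {} h b \<kappa>) * t ^ star_deg (star i \<kappa>)) = (\<Sum>\<kappa>\<in>X. c \<kappa> * mval {} h B \<kappa>)"
        by (intro sum.cong) (auto simp: mult_ac)
      then show ?thesis using Xf(3) by (simp add: vanishes_def)
    qed
    from power_sum_eq_0[OF Xf(1) this] show "(\<Sum>\<kappa>\<in>?Z. c \<kappa> * mval {} h b \<kappa>) = 0" by simp
  qed
  moreover have "?Z \<noteq> {}" using mu by blast
  ultimately have "?Z = X" by (intro minimal_vanishingD[OF X]) auto
  then have "\<nu> \<in> ?Z" using nu by simp
  then show ?thesis by simp
qed

lemma star_deg_eq_0_iff: "star_deg (star i \<mu>) = 0 \<longleftrightarrow> star i \<mu> = (\<lambda>_. 0)"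
  unfolding star_deg_def using finite_star_support[of i \<mu>] by (subst sum_eq_0_iff) (auto simp: fun_eq_iff)

text \<open>Stars at one row have equal degree, so one empty star would make all of them empty and
  hence equal.\<close>

lemma extremal_star_nonzero:
  fixes c :: "mono \<Rightarrow> 'a::{field,infinite}"
  assumes X: "extremal h c X" and i: "card (star i ` X) \<noteq> 1" and mu: "\<mu> \<in> X"
  obtains v where "v \<in> touch i" "fst v < snd v" "star i \<mu> v \<noteq> 0"
proof -
  have "star i \<mu> \<noteq> (\<lambda>_. 0)"
  proof
    assume "star i \<mu> = (\<lambda>_. 0)"
    then have "star i \<nu> = (\<lambda>_. 0)" if "\<nu> \<in> X" for \<nu>
      using minimal_vanishing_star_deg[OF extremal_minimal_vanishing[OF X] mu that] star_deg_eq_0_iff by metis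
    then show False using i mu card_image_eq_1I[of X "star i"] by blast
  qed
  then obtain v where v: "star i \<mu> v \<noteq> 0" by blast
  then have "v \<in> touch i" "v \<in> keys \<mu>" by (auto simp: star_def in_keys_iff split: if_splits)
  moreover have "edge_mons X" using X by (simp add: extremal_def)
  ultimately show ?thesis using that v mu by (auto simp: edge_mons_def)
qed

text \<open>Each star of \<open>S\<close> is killed through one of its own variables. As distinct
  stars are disjoint, this variable occurs in no other star, and setting it to 0 loses exactly the
  terms with that star.\<close>

lemma extremal_kill_stars:
  fixes c :: "mono \<Rightarrow> 'a::{field,infinite}"
  assumes X: "extremal (Suc h) c X" and red: "reduced X" and i: "card (star i ` X) \<noteq> 1"
    and "finite S" "S \<subseteq> star i ` X"
  shows "\<exists>F. finite F \<and> card F \<le> card S \<and> (\<forall>w\<in>F. w \<in> touch i \<and> fst w < snd w \<and> (\<exists>a\<in>S. a w \<noteq> 0)) \<and>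
    perp_vanishes (Suc h) c i F {\<mu>\<in>X. star i \<mu> \<notin> S}"
  using assms(4,5)
proof (induction S rule: finite_induct)
  case empty
  have "perp_vanishes (Suc h) c i {} X" using X perp_vanishes_empty by (auto simp: extremal_def)
  then show ?case by (intro exI[of _ "{}"]) auto
next
  case (insert a S)
  then obtain F where F: "finite F" "card F \<le> card S"
    "\<And>w. w \<in> F \<Longrightarrow> w \<in> touch i \<and> fst w < snd w \<and> (\<exists>a\<in>S. a w \<noteq> 0)"
    "perp_vanishes (Suc h) c i F {\<mu>\<in>X. star i \<mu> \<notin> S}" by auto
  from insert.prems obtain \<mu>0 where mu0: "\<mu>0 \<in> X" "a = star i \<mu>0" by blast
  obtain v where v: "v \<in> touch i" "fst v < snd v" "star i \<mu>0 v \<noteq> 0"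
    using extremal_star_nonzero[OF X i mu0(1)] by blast
  have uniq: "star i \<mu> = a" if "\<mu> \<in> X" "star i \<mu> v \<noteq> 0" for \<mu>
    using extremal_star_disjoint[OF X red v(1) that(1) _ mu0(1)] that(2) v(1,3) mu0(2)
    by (simp add: star_def)
  have vF: "v \<notin> F"
  proof
    assume "v \<in> F"
    then obtain a' where a': "a' \<in> S" "a' v \<noteq> 0" using F(3) by blast
    then obtain \<mu> where "\<mu> \<in> X" "a' = star i \<mu>" using insert.prems by blast
    then show False using uniq a' insert.hyps(2) by blast
  qed
  have "lookup \<mu> v = 0 \<longleftrightarrow> star i \<mu> \<noteq> a" if "\<mu> \<in> X" for \<mu>
  proof
    assume "lookup \<mu> v = 0"
    then have "star i \<mu> v = 0" by (simp add: star_def)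
    then show "star i \<mu> \<noteq> a" using v(3) mu0(2) by metis
  next
    assume "star i \<mu> \<noteq> a"
    then have "star i \<mu> v = 0" using uniq[OF that] by metis
    then show "lookup \<mu> v = 0" using v(1) by (simp add: star_def)
  qed
  then have "{\<mu>\<in>{\<mu>\<in>X. star i \<mu> \<notin> S}. lookup \<mu> v = 0} = {\<mu>\<in>X. star i \<mu> \<notin> insert a S}"
    by auto
  moreover have "perp_vanishes (Suc h) c i (insert v F) {\<mu>\<in>{\<mu>\<in>X. star i \<mu> \<notin> S}. lookup \<mu> v = 0}"
    using X F(3) by (intro perp_vanishes_insert[OF _ v(1,2) vF _ _ F(4)]) (auto simp: extremal_def)
  moreover have "card (insert v F) \<le> card (insert a S)" using vF F(1,2) insert.hyps by simp
  moreover have "w \<in> touch i \<and> fst w < snd w \<and> (\<exists>a\<in>insert a S. a w \<noteq> 0)" if "w \<in> insert v F" for w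
  proof (cases "w = v")
    case True
    then show ?thesis using v mu0(2) by simp
  next
    case False
    then have "w \<in> F" using that by simp
    then show ?thesis using F(3)[of w] by auto
  qed
  moreover have "finite (insert v F)" using F(1) by simp
  ultimately show ?case by (intro exI[of _ "insert v F"] conjI ballI) simp_all
qed

section \<open>Stars of extremal sums\<close>


definition star_val :: "nat \<Rightarrow> (nat \<Rightarrow> nat \<Rightarrow> 'a::comm_ring_1) \<Rightarrow> (nat \<times> nat \<Rightarrow> nat) \<Rightarrow> 'a" where
  "star_val h b a = (\<Prod>v | a v \<noteq> 0. edge_val h b v ^ a v)"

text \<open>The cofactor of the star \<open>a\<close> when the sum is expanded along row
  \<open>i\<close>. It does not depend on \<open>b i\<close>, so a relation between stars can be
  read as a relation in the vector placed there.\<close>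

definition class_val ::
  "nat \<Rightarrow> (mono \<Rightarrow> 'a::comm_ring_1) \<Rightarrow> mono set \<Rightarrow> nat \<Rightarrow> (nat \<times> nat \<Rightarrow> nat) \<Rightarrow>
   (nat \<Rightarrow> nat \<Rightarrow> 'a) \<Rightarrow> 'a" where
  "class_val h c X i a b = (\<Sum>\<mu>\<in>{\<mu>\<in>X. star i \<mu> = a}. c \<mu> * mval (touch i) h b \<mu>)"

lemma polyfun_star_val [polyfun_intros]:
  "(\<And>j k. polyfun (\<lambda>t. b t j k)) \<Longrightarrow> polyfun (\<lambda>t. star_val h (b t) a)"
  unfolding star_val_def by (intro polyfun_intros)

lemma polyfun_class_val [polyfun_intros]:
  "(\<And>j k. polyfun (\<lambda>t. b t j k)) \<Longrightarrow> polyfun (\<lambda>t. class_val h c X i a (b t))"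
  unfolding class_val_def by (intro polyfun_intros)

lemma class_val_upd: "class_val h c X i a (b(i := y)) = class_val h c X i a b"
  unfolding class_val_def
proof (rule sum.cong[OF refl])
  fix \<mu>
  have "mval (touch i) h (b(i := y)) \<mu> = mval (touch i) h b \<mu>" by (rule mval_touch_cong) simp
  then show "c \<mu> * mval (touch i) h (b(i := y)) \<mu> = c \<mu> * mval (touch i) h b \<mu>" by simp
qed

lemma polyfun_nonzero2:
  fixes f g :: "'a::{idom,infinite} \<Rightarrow> 'a"
  assumes "polyfun f" "polyfun g" "f a \<noteq> 0" "g b \<noteq> 0"
  obtains t where "f t \<noteq> 0" "g t \<noteq> 0"
  using polyfun_mult_eq_0[OF assms(1,2) _ assms(3), of b] assms(4) mult_eq_0_iff by blast

lemma fiberD: "x \<in> {x\<in>X. f x = a} \<Longrightarrow> f x = a"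
  by simp

text \<open>A cofactor vanishing identically would make the class of its star a vanishing part,
  hence all of \<open>X\<close>, and row \<open>i\<close> would have only one star.\<close>

lemma class_val_nonzero:
  fixes c :: "mono \<Rightarrow> 'a::{field,infinite}"
  assumes X: "extremal h c X" and i: "card (star i ` X) \<noteq> 1" and mu: "\<mu> \<in> X"
  obtains b where "class_val h c X i (star i \<mu>) b \<noteq> 0"
proof (rule ccontr)
  assume "\<not> thesis"
  then have zero: "class_val h c X i (star i \<mu>) b = 0" for b using that by blast
  have "vanishes h c {\<nu>\<in>X. star i \<nu> = star i \<mu>}"
  proof (rule vanishes_star_classI[where i = i and a = "star i \<mu>"])
    show "star i \<nu> = star i \<mu>" if "\<nu> \<in> {\<nu>\<in>X. star i \<nu> = star i \<mu>}" for \<nu>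
      using that by (rule fiberD)
    show "(\<Sum>\<nu>\<in>{\<nu>\<in>X. star i \<nu> = star i \<mu>}. c \<nu> * mval (touch i) h b \<nu>) = 0" for b
      by (rule zero[unfolded class_val_def])
  qed
  then have "{\<nu>\<in>X. star i \<nu> = star i \<mu>} = X"
    using mu by (intro minimal_vanishingD[OF extremal_minimal_vanishing[OF X]]) auto
  then have "star i \<nu> = star i \<mu>" if "\<nu> \<in> X" for \<nu>
    using that fiberD[of \<nu> X "star i" "star i \<mu>"] by simp
  then have "card (star i ` X) = 1" by (intro card_image_eq_1I) (use mu in blast)
  then show False using i by simp
qed

lemma edge_val_upd:
  assumes "v \<in> touch i" "fst v < snd v"
  shows "edge_val h (b(i := y)) v = orient i v * sform h y (b (other i v))"
  using other_neq[OF assms] by (simp add: edge_val_touch[OF assms(1)])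

lemma star_support:
  assumes "edge_mons X" "\<mu> \<in> X" "star i \<mu> v \<noteq> 0"
  shows "v \<in> touch i" "fst v < snd v" "lookup \<mu> v \<noteq> 0"
proof -
  show "v \<in> touch i" using assms(3) by (simp add: star_def split: if_splits)
  then show "lookup \<mu> v \<noteq> 0" using assms(3) by (simp add: star_def)
  then have "v \<in> keys \<mu>" by (simp add: in_keys_iff)
  then show "fst v < snd v" using assms(1,2) by (simp add: edge_mons_def)
qed

lemma extremal_star_unique:
  fixes c :: "mono \<Rightarrow> 'a::{field,infinite}"
  assumes X: "extremal (Suc h) c X" and red: "reduced X"
    and mu: "\<mu> \<in> X" "star i \<mu> v \<noteq> 0" and nu: "\<nu> \<in> X" "star i \<nu> v \<noteq> 0"
  shows "star i \<mu> = star i \<nu>"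
proof -
  have "edge_mons X" using X by (simp add: extremal_def)
  note s = star_support[OF this]
  show ?thesis
    using extremal_star_disjoint[OF X red s(1)[OF mu] mu(1) s(3)[OF mu] nu(1) s(3)[OF nu]] .
qed

text \<open>Killing all but three of the \<open>2*h+3\<close> stars imposes at most
  \<open>2*h\<close> linear conditions on the vector \<open>y\<close> of row \<open>i\<close> in
  dimension \<open>2*h+2\<close>, so at least a plane remains. The killed variables avoid the three
  surviving stars by disjointness, hence these are evaluated in full.\<close>

lemma extremal_three_stars:
  fixes c :: "mono \<Rightarrow> 'a::{field,infinite}"
  assumes X: "extremal (Suc h) c X" and red: "reduced X" and i: "card (star i ` X) \<noteq> 1"
    and a: "a1 \<in> star i ` X" "a2 \<in> star i ` X" "a3 \<in> star i ` X"
    and ne: "a1 \<noteq> a2" "a1 \<noteq> a3" "a2 \<noteq> a3"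
  shows "\<exists>F. finite F \<and> card F \<le> 2*h \<and>
    (\<forall>w\<in>F. w \<in> touch i \<and> fst w < snd w \<and> a1 w = 0 \<and> a2 w = 0 \<and> a3 w = 0) \<and>
    (\<forall>b y. nzvec (Suc h) y \<longrightarrow> (\<forall>w\<in>F. sform (Suc h) y (b (other i w)) = 0) \<longrightarrow>
       star_val (Suc h) (b(i := y)) a1 * class_val (Suc h) c X i a1 b +
       (star_val (Suc h) (b(i := y)) a2 * class_val (Suc h) c X i a2 b +
        star_val (Suc h) (b(i := y)) a3 * class_val (Suc h) c X i a3 b) = 0)"
proof -
  have fX: "finite X" using X by (simp add: extremal_def)
  define S where "S = star i ` X - {a1, a2, a3}"
  have "card S = 2*h"
    using fX a ne extremal_stars(1)[OF X i] by (simp add: S_def card_Diff_subset)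
  moreover have "finite S" "S \<subseteq> star i ` X" using fX by (auto simp: S_def)
  ultimately have "\<exists>F. finite F \<and> card F \<le> 2*h \<and>
    (\<forall>w\<in>F. w \<in> touch i \<and> fst w < snd w \<and> (\<exists>a\<in>S. a w \<noteq> 0)) \<and>
    perp_vanishes (Suc h) c i F {\<mu>\<in>X. star i \<mu> \<notin> S}"
    using extremal_kill_stars[OF X red i, of S] by simp
  then obtain F where "finite F \<and> card F \<le> 2*h \<and>
    (\<forall>w\<in>F. w \<in> touch i \<and> fst w < snd w \<and> (\<exists>a\<in>S. a w \<noteq> 0)) \<and>
    perp_vanishes (Suc h) c i F {\<mu>\<in>X. star i \<mu> \<notin> S}" ..
  then have F: "finite F" "card F \<le> 2*h"
    "\<And>w. w \<in> F \<Longrightarrow> w \<in> touch i \<and> fst w < snd w \<and> (\<exists>a\<in>S. a w \<noteq> 0)"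
    "perp_vanishes (Suc h) c i F {\<mu>\<in>X. star i \<mu> \<notin> S}"
    by simp_all
  have F0: "a' w = 0" if "w \<in> F" "a' \<in> {a1, a2, a3}" for w a'
  proof (rule ccontr)
    assume n: "a' w \<noteq> 0"
    obtain a'' where a'': "a'' \<in> S" "a'' w \<noteq> 0" using F(3)[OF \<open>w \<in> F\<close>] by blast
    then have "a'' \<in> star i ` X" by (simp add: S_def)
    then obtain \<mu> where mu: "\<mu> \<in> X" "a'' = star i \<mu>" by (elim imageE) simp
    have "a' \<in> star i ` X" using that(2) a by auto
    then obtain \<nu> where nu: "\<nu> \<in> X" "a' = star i \<nu>" by (elim imageE) simp
    have "a' = a''" using extremal_star_unique[OF X red nu(1) _ mu(1)] mu(2) nu(2) n a''(2) by simp
    then show False using a''(1) that(2) by (simp add: S_def)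
  qed
  have A1: "\<forall>w\<in>F. w \<in> touch i \<and> fst w < snd w \<and> a1 w = 0 \<and> a2 w = 0 \<and> a3 w = 0"
    by (rule ballI) (use F(3) F0 in simp)
  have rel: "star_val (Suc h) (b(i := y)) a1 * class_val (Suc h) c X i a1 b +
       (star_val (Suc h) (b(i := y)) a2 * class_val (Suc h) c X i a2 b +
        star_val (Suc h) (b(i := y)) a3 * class_val (Suc h) c X i a3 b) = 0"
    if y: "nzvec (Suc h) y" "\<forall>w\<in>F. sform (Suc h) y (b (other i w)) = 0"
    for b :: "nat \<Rightarrow> nat \<Rightarrow> 'a" and y
  proof -
    let ?b = "b(i := y)"
    have "edge_val (Suc h) ?b w = 0" if "w \<in> F" for w
      using y(2)[rule_format, OF that] F(3)[OF that] by (simp add: edge_val_upd)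
    then have "(\<Sum>\<mu>\<in>{\<mu>\<in>X. star i \<mu> \<notin> S}. c \<mu> * mval F (Suc h) ?b \<mu>) = 0"
      using F(4)[unfolded perp_vanishes_def, rule_format, of ?b] y(1) by simp
    also have "{\<mu>\<in>X. star i \<mu> \<notin> S} =
       {\<mu>\<in>X. star i \<mu> = a1} \<union> ({\<mu>\<in>X. star i \<mu> = a2} \<union> {\<mu>\<in>X. star i \<mu> = a3})"
      by (auto simp: S_def)
    also have "(\<Sum>\<mu>\<in>\<dots>. c \<mu> * mval F (Suc h) ?b \<mu>) =
       (\<Sum>\<mu>\<in>{\<mu>\<in>X. star i \<mu> = a1}. c \<mu> * mval F (Suc h) ?b \<mu>) +
       ((\<Sum>\<mu>\<in>{\<mu>\<in>X. star i \<mu> = a2}. c \<mu> * mval F (Suc h) ?b \<mu>) +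
        (\<Sum>\<mu>\<in>{\<mu>\<in>X. star i \<mu> = a3}. c \<mu> * mval F (Suc h) ?b \<mu>))"
      using fX ne by (subst sum.union_disjoint; (subst sum.union_disjoint)?; auto)
    finally have tot: "\<dots> = 0" .
    have "(\<Sum>\<mu>\<in>{\<mu>\<in>X. star i \<mu> = a'}. c \<mu> * mval F (Suc h) ?b \<mu>) =
       star_val (Suc h) ?b a' * class_val (Suc h) c X i a' b" if "a' \<in> {a1, a2, a3}" for a'
    proof -
      have "mval F (Suc h) ?b \<mu> = star_val (Suc h) ?b a' * mval (touch i) (Suc h) ?b \<mu>"
        if "star i \<mu> = a'" for \<mu>
      proof -
        have "{v. a' v \<noteq> 0} \<inter> F = {}"
          using F0[OF _ \<open>a' \<in> {a1, a2, a3}\<close>] by (intro equals0I) (metis IntE mem_Collect_eq)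
        then have "{v. a' v \<noteq> 0} - F = {v. a' v \<noteq> 0}" by (rule Diff_triv)
        moreover have "F \<subseteq> touch i" using F(3) by blast
        ultimately show ?thesis using mval_split_star[of F i "Suc h" ?b \<mu>]
          by (simp only: that star_val_def)
      qed
      then have "(\<Sum>\<mu>\<in>{\<mu>\<in>X. star i \<mu> = a'}. c \<mu> * mval F (Suc h) ?b \<mu>) =
        (\<Sum>\<mu>\<in>{\<mu>\<in>X. star i \<mu> = a'}. star_val (Suc h) ?b a' * (c \<mu> * mval (touch i) (Suc h) ?b \<mu>))"
        by (intro sum.cong) (simp_all add: mult_ac)
      also have "\<dots> = star_val (Suc h) ?b a' * class_val (Suc h) c X i a' ?b"
        by (simp add: class_val_def sum_distrib_left)
      finally show ?thesis by (simp only: class_val_upd)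
    qed
    then show ?thesis using tot by simp
  qed
  have A2: "\<forall>b y. nzvec (Suc h) y \<longrightarrow> (\<forall>w\<in>F. sform (Suc h) y (b (other i w)) = 0) \<longrightarrow>
       star_val (Suc h) (b(i := y)) a1 * class_val (Suc h) c X i a1 b +
       (star_val (Suc h) (b(i := y)) a2 * class_val (Suc h) c X i a2 b +
        star_val (Suc h) (b(i := y)) a3 * class_val (Suc h) c X i a3 b) = 0"
    by (intro allI impI) (rule rel)
  show ?thesis by (rule exI[of _ F], rule conjI[OF F(1) conjI[OF F(2) conjI[OF A1 A2]]])
qed

lemma star_val_eq_0:
  assumes "finite {v. a v \<noteq> 0}" "a v \<noteq> 0" "edge_val h b v = 0"
  shows "star_val h b a = 0"
proof -
  have "edge_val h b v ^ a v = 0" unfolding assms(3) using assms(2) by (cases "a v") auto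
  then show ?thesis unfolding star_val_def using assms(1,2)
    by (intro prod_zero bexI[of _ v]) simp_all
qed

lemma star_val_neq_0:
  fixes b :: "nat \<Rightarrow> nat \<Rightarrow> 'a::idom"
  assumes "finite {v. a v \<noteq> 0}" "\<And>v. a v \<noteq> 0 \<Longrightarrow> edge_val h b v \<noteq> 0"
  shows "star_val h b a \<noteq> 0"
  unfolding star_val_def using assms by (subst prod_zero_iff) auto

lemma obtain_two_more:
  assumes "finite A" "card A \<ge> 3" "a \<in> A"
  obtains a2 a3 where "a2 \<in> A" "a3 \<in> A" "a \<noteq> a2" "a \<noteq> a3" "a2 \<noteq> a3"
proof -
  have "2 \<le> card (A - {a})" using assms by simp
  then obtain B where B: "B \<subseteq> A - {a}" "card B = 2" by (metis obtain_subset_with_card_n)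
  then obtain x y where "B = {x, y}" "x \<noteq> y" by (auto simp: card_2_iff)
  then show ?thesis using B(1) by (intro that[of x y]) auto
qed

text \<open>If a star had two edges \<open>v\<close>, \<open>v'\<close>, then the ratio of the other two star values would be the
  same at the vector orthogonal to the far end of \<open>v\<close> and at the one orthogonal to the far end of
  \<open>v'\<close>; but these two star values involve further vectors that can be moved freely.\<close>

lemma extremal_star_single:
  fixes c :: "mono \<Rightarrow> 'a::{field,infinite}"
  assumes X: "extremal (Suc h) c X" and red: "reduced X" and i: "card (star i ` X) \<noteq> 1"
    and mu: "\<mu> \<in> X" "star i \<mu> v \<noteq> 0" "star i \<mu> v' \<noteq> 0"
  shows "v = v'"
proof (rule ccontr)
  assume vv': "v \<noteq> v'"
  define H where "H = Suc h"
  have fX: "finite X" and eX: "edge_mons X" using X by (auto simp: extremal_def)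
  define a1 where "a1 = star i \<mu>"
  have a1: "a1 \<in> star i ` X" using mu(1) by (simp add: a1_def)
  have "3 \<le> card (star i ` X)" using extremal_stars(1)[OF X i] by simp
  from obtain_two_more[OF finite_imageI[OF fX] this a1]
  obtain a2 a3 where a: "a2 \<in> star i ` X" "a3 \<in> star i ` X" "a1 \<noteq> a2" "a1 \<noteq> a3" "a2 \<noteq> a3" .
  obtain \<mu>2 where mu2: "\<mu>2 \<in> X" "a2 = star i \<mu>2" using a(1) by (elim imageE) simp
  obtain \<mu>3 where mu3: "\<mu>3 \<in> X" "a3 = star i \<mu>3" using a(2) by (elim imageE) simp
  note uniq = extremal_star_unique[OF X red]
  have d12: "a2 w = 0" if "a1 w \<noteq> 0" for w
    using uniq[OF mu(1) _ mu2(1), of i w] that a(3) a1_def mu2(2) by metis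
  have d13: "a3 w = 0" if "a1 w \<noteq> 0" for w
    using uniq[OF mu(1) _ mu3(1), of i w] that a(4) a1_def mu3(2) by metis
  have d23: "a3 w = 0" if "a2 w \<noteq> 0" for w
    using uniq[OF mu2(1) _ mu3(1), of i w] that a(5) mu2(2) mu3(2) by metis
  have fin: "finite {w. a1 w \<noteq> 0}" "finite {w. a2 w \<noteq> 0}" "finite {w. a3 w \<noteq> 0}"
    unfolding a1_def mu2(2) mu3(2) by (rule finite_star_support)+
  have supp1: "w \<in> touch i" "fst w < snd w" if "a1 w \<noteq> 0" for w
    using star_support[OF eX mu(1)] that unfolding a1_def by blast+
  have supp2: "w \<in> touch i" "fst w < snd w" if "a2 w \<noteq> 0" for w
    using star_support[OF eX mu2(1)] that unfolding mu2(2) by blast+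
  have supp3: "w \<in> touch i" "fst w < snd w" if "a3 w \<noteq> 0" for w
    using star_support[OF eX mu3(1)] that unfolding mu3(2) by blast+
  obtain F where F: "finite F" "card F \<le> 2*h"
    "\<forall>w\<in>F. w \<in> touch i \<and> fst w < snd w \<and> a1 w = 0 \<and> a2 w = 0 \<and> a3 w = 0"
    "\<forall>b y. nzvec H y \<longrightarrow> (\<forall>w\<in>F. sform H y (b (other i w)) = 0) \<longrightarrow>
       star_val H (b(i := y)) a1 * class_val H c X i a1 b +
       (star_val H (b(i := y)) a2 * class_val H c X i a2 b +
        star_val H (b(i := y)) a3 * class_val H c X i a3 b) = 0"
    using extremal_three_stars[OF X red i a1 a(1,2) a(3,4,5), folded H_def]
    by (elim exE conjE) (rule that)
  note F = F(1,2) F(3)[rule_format] F(4)[rule_format]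
  have v: "a1 v \<noteq> 0" "a1 v' \<noteq> 0" using mu(2,3) by (simp_all add: a1_def)
  define j where "j = other i v"
  define j' where "j' = other i v'"
  define J where "J = other i ` F"
  define W where "W = {w. a2 w \<noteq> 0 \<or> a3 w \<noteq> 0}"
  have oinj: "other i w \<noteq> other i w'"
    if "w \<in> touch i" "fst w < snd w" "w' \<in> touch i" "fst w' < snd w'" "w \<noteq> w'" for w w'
    using other_inj that by blast
  have jj': "j \<noteq> j'" unfolding j_def j'_def by (rule oinj[OF supp1[OF v(1)] supp1[OF v(2)] vv'])
  have jJ: "other i w \<notin> J" if "w \<in> touch i" "fst w < snd w" "w \<notin> F" for w
    
  proof
    assume "other i w \<in> J"
    then obtain w' where w': "w' \<in> F" "other i w = other i w'" unfolding J_def by (elim imageE) simp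
    then have "w = w'" using oinj[OF that(1,2), of w'] F(3)[of w'] by blast
    then show False using w'(1) that(3) by simp
  qed
  have vF: "v \<notin> F" "v' \<notin> F" using F(3)[of v] F(3)[of v'] v by blast+
  have jJ': "j \<notin> J" "j' \<notin> J"
    unfolding j_def j'_def using jJ supp1 v vF by blast+
  have Wt: "w \<in> touch i" "fst w < snd w" "w \<notin> F" "a1 w = 0" if "w \<in> W" for w
  proof -
    have w: "a2 w \<noteq> 0 \<or> a3 w \<noteq> 0" using that by (simp add: W_def)
    then show "w \<in> touch i" "fst w < snd w" using supp2 supp3 by blast+
    show "w \<notin> F" using F(3)[of w] w by auto
    show "a1 w = 0" using d12[of w] d13[of w] w by blast
  qed
  have WJ: "other i w \<notin> J" "other i w \<noteq> j" "other i w \<noteq> j'" if "w \<in> W" for w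
  proof -
    show "other i w \<notin> J" by (rule jJ[OF Wt(1-3)[OF that]])
    have "w \<noteq> v" "w \<noteq> v'" using Wt(4)[OF that] v by auto
    then show "other i w \<noteq> j" "other i w \<noteq> j'" unfolding j_def j'_def
      using oinj[OF Wt(1,2)[OF that] supp1[OF v(1)]] oinj[OF Wt(1,2)[OF that] supp1[OF v(2)]] by simp_all
  qed
  have finJ: "finite J" "card J \<le> 2*h"
    using F(1,2) card_image_le[OF F(1), of "other i"] unfolding J_def by simp_all
  obtain b0 where b0: "class_val H c X i a2 b0 \<noteq> 0"
    by (rule class_val_nonzero[OF X i mu2(1), folded H_def mu2(2)])
  have "card (insert j J) < 2 * H" "card (insert j' J) < 2 * H"
    using finJ jJ' by (simp_all add: H_def)
  note cJ = this
  \<comment> \<open>At most \<open>2*h+1\<close> conditions in dimension \<open>2*h+2\<close> allow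
    one more far end to be made orthogonal: \<open>y\<close> kills the first star through
    \<open>v\<close>, and later \<open>y'\<close> kills it through \<open>v'\<close>.\<close>
  obtain y where y: "nzvec H y" "\<forall>k\<in>insert j J. sform H y (b0 k) = 0"
    using exists_orthogonal[OF finite.insertI[OF finJ(1)] cJ(1), of b0] by (elim exE conjE) (rule that)
  obtain z where z: "sform H y z = 1" using sform_nondegenerate y(1) by blast
  \<comment> \<open>Moving the far end of \<open>v'\<close> off the hyperplane of \<open>y\<close>
    forces the later \<open>y'\<close> to be independent of \<open>y\<close>; the parameter is
    chosen such that the cofactor of \<open>a2\<close> stays nonzero.\<close>
  define B1 where "B1 t = b0(j' := \<lambda>k. b0 j' k + t * z k)" for t
  have pB1: "polyfun (\<lambda>t. B1 t l k)" for l k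
    by (cases "l = j'") (auto simp: B1_def intro!: polyfun_intros)
  have "B1 0 = b0" by (simp add: B1_def)
  have "polyfun (\<lambda>t. class_val H c X i a2 (B1 t))" "polyfun (\<lambda>t. sform H y (B1 t j'))"
    by (intro polyfun_intros pB1)+
  moreover have "class_val H c X i a2 (B1 0) \<noteq> 0" using b0 \<open>B1 0 = b0\<close> by simp
  moreover have "sform H y (B1 (1 - sform H y (b0 j')) j') \<noteq> 0"
    by (simp add: B1_def sform_shift z)
  ultimately obtain t1 where t1: "class_val H c X i a2 (B1 t1) \<noteq> 0" "sform H y (B1 t1 j') \<noteq> 0"
    using polyfun_nonzero2[of "\<lambda>t. class_val H c X i a2 (B1 t)" "\<lambda>t. sform H y (B1 t j')"] by blast
  define b1 where "b1 = B1 t1"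
  have b1: "class_val H c X i a2 b1 \<noteq> 0" "sform H y (b1 j') \<noteq> 0"
    using t1 by (simp_all add: b1_def)
  have yb1: "sform H y (b1 k) = 0" if "k \<in> insert j J" for k
  proof -
    have "k \<noteq> j'" using that jJ' jj' by auto
    then show ?thesis using y(2)[rule_format, OF that] by (simp add: b1_def B1_def)
  qed
  obtain y' where y': "nzvec H y'" "\<forall>k\<in>insert j' J. sform H y' (b1 k) = 0"
    using exists_orthogonal[OF finite.insertI[OF finJ(1)] cJ(2), of b1] by (elim exE conjE) (rule that)
  \<comment> \<open>The normalised far end of \<open>v'\<close> pairs to 1 with \<open>y\<close> and
    to 0 with \<open>y'\<close>, and \<open>z1\<close> below pairs to 1 with both. The zero summand
    gives the term the shape of \<open>sform_lin_right\<close>.\<close>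
  define z2 where "z2 = (\<lambda>k. 0 * b1 j' k + (1 / sform H y (b1 j')) * b1 j' k)"
  have z2: "sform H y z2 = 1" "sform H y' z2 = 0"
    unfolding z2_def sform_lin_right using b1(2) y'(2) by auto
  obtain z' where z': "sform H y' z' = 1" using sform_nondegenerate y'(1) by blast
  define z1 where "z1 = (\<lambda>k. z' k + (1 - sform H y z') * z2 k)"
  have z1: "sform H y z1 = 1" "sform H y' z1 = 1"
    unfolding z1_def sform_shift by (simp_all add: z2 z')
  obtain w3 where "w3 \<in> touch i" "fst w3 < snd w3" and w3: "a3 w3 \<noteq> 0"
    by (rule extremal_star_nonzero[OF X i mu3(1), folded mu3(2)])
  \<comment> \<open>Target positions for \<open>t = 1\<close>: the edge \<open>w3\<close> of the
    third star becomes 0 for \<open>y'\<close> but not for \<open>y\<close>, all other edges of the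
    second and third star are nonzero for both.\<close>
  define T where "T k = (if k = other i w3 then z2 else z1)" for k
  define B where
    "B t k = (if k \<in> other i ` W then (\<lambda>l. (1 - t) * b1 k l + t * T k l) else b1 k)" for t k
  have pB: "polyfun (\<lambda>t. B t l k)" for l k
    by (cases "l \<in> other i ` W") (auto simp: B_def intro!: polyfun_intros)
  have B0: "B 0 = b1" by (auto simp: B_def fun_eq_iff)
  have Bk: "B t k = b1 k" if "k \<in> insert j (insert j' J)" for t k
  proof -
    have "k \<notin> other i ` W"
    proof
      assume "k \<in> other i ` W"
      then obtain w where "w \<in> W" "k = other i w" by (elim imageE) simp
      then show False using WJ[of w] \<open>k \<in> insert j (insert j' J)\<close> by simp
    qed
    then show ?thesis by (simp add: B_def)
  qed
  define M where "M Y a t = star_val H ((B t)(i := Y)) a" for Y a t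
  define G where "G a t = class_val H c X i a (B t)" for a t
  have pM: "polyfun (\<lambda>t. M Y a t)" for Y a
  proof -
    have "polyfun (\<lambda>t. ((B t)(i := Y)) l k)" for l k
      by (cases "l = i") (auto intro!: polyfun_intros pB)
    then show ?thesis unfolding M_def by (intro polyfun_intros)
  qed
  have rel: "M Y a2 t * G a2 t + M Y a3 t * G a3 t = 0"
    if "nzvec H Y" "\<And>k. k \<in> J \<Longrightarrow> sform H Y (b1 k) = 0" "a1 u \<noteq> 0" "sform H Y (b1 (other i u)) = 0"
      "u \<in> {v, v'}" for Y t u
  proof -
    have "sform H Y (B t (other i w)) = 0" if "w \<in> F" for w
      using Bk[of "other i w"] \<open>\<And>k. k \<in> J \<Longrightarrow> sform H Y (b1 k) = 0\<close>[of "other i w"] that by (simp add: J_def)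
    then have "\<forall>w\<in>F. sform H Y (B t (other i w)) = 0" by blast
    with F(4)[of Y "B t"] \<open>nzvec H Y\<close>
    have "M Y a1 t * G a1 t + (M Y a2 t * G a2 t + M Y a3 t * G a3 t) = 0"
      unfolding M_def G_def by blast
    moreover have "M Y a1 t = 0"
    proof -
      have "B t (other i u) = b1 (other i u)" using that(5) by (intro Bk) (auto simp: j_def j'_def)
      then have "edge_val H ((B t)(i := Y)) u = 0"
        unfolding edge_val_upd[OF supp1[OF that(3)]] using that(4) by simp
      then show ?thesis unfolding M_def by (rule star_val_eq_0[OF fin(1) that(3)])
    qed
    ultimately show ?thesis by simp
  qed
  have r1: "M y a2 t * G a2 t + M y a3 t * G a3 t = 0" for t
    using yb1 v by (intro rel[of y v]) (auto simp: y(1) j_def)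
  have r2: "M y' a2 t * G a2 t + M y' a3 t * G a3 t = 0" for t
    using y' v by (intro rel[of y' v']) (auto simp: j'_def)
  \<comment> \<open>The two relations form a linear system with solution
    \<open>(G a2 t, G a3 t)\<close> and determinant \<open>D t\<close>. As \<open>G a2\<close> is
    not identically 0, the determinant is; the target positions contradict this at
    \<open>t = 1\<close>.\<close>
  define D where "D t = M y a2 t * M y' a3 t - M y' a2 t * M y a3 t" for t
  have "G a2 t * D t = 0" for t
  proof -
    have "G a2 t * D t = M y' a3 t * (M y a2 t * G a2 t + M y a3 t * G a3 t)
        - M y a3 t * (M y' a2 t * G a2 t + M y' a3 t * G a3 t)"
      unfolding D_def by (simp add: algebra_simps)
    then show ?thesis unfolding r1 r2 by simp
  qed
  moreover have "polyfun (G a2)" "polyfun D"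
    unfolding G_def D_def by (intro polyfun_intros pB pM)+
  moreover have "G a2 0 \<noteq> 0" using b1(1) by (simp add: G_def B0)
  ultimately have D1: "D 1 = 0" using polyfun_mult_eq_0[of "G a2" D 0 1] by blast
  have BT: "B 1 (other i w) = T (other i w)" if "w \<in> W" for w
    using that by (simp add: B_def)
  have ev: "edge_val H ((B 1)(i := Y)) w = orient i w * sform H Y (T (other i w))" if "w \<in> W" for w Y
    unfolding edge_val_upd[OF Wt(1,2)[OF that]] BT[OF that] ..
  have "M y' a3 1 = 0"
    unfolding M_def using w3 by (intro star_val_eq_0[OF fin(3) w3]) (simp add: ev W_def T_def z2)
  moreover have "M y' a2 1 \<noteq> 0"
    unfolding M_def
  proof (rule star_val_neq_0[OF fin(2)])
    fix w assume w: "a2 w \<noteq> 0"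
    then have "w \<noteq> w3" using d23[of w] w3 by auto
    then have "other i w \<noteq> other i w3" by (rule oinj[OF supp2[OF w] supp3[OF w3]])
    then show "edge_val H ((B 1)(i := y')) w \<noteq> 0" using w by (simp add: ev W_def T_def z1)
  qed
  moreover have "M y a3 1 \<noteq> 0"
    unfolding M_def
    by (rule star_val_neq_0[OF fin(3)]) (simp add: ev W_def T_def z1 z2)
  ultimately show False using D1 by (simp add: D_def)
qed

text \<open>The hypothesis says \<open>(t + 1) ^ D = 1 + t ^ D\<close>. In characteristic p write
  \<open>D = q * m\<close> with \<open>q\<close> a power of p and \<open>m\<close> prime to p: the
  left side is \<open>(t ^ q + 1) ^ m\<close>, and for \<open>m > 1\<close> its coefficient
  \<open>m\<close> at \<open>t ^ q\<close> would have to be 0. In characteristic 0 the binomial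
  \<open>D choose 1\<close> already decides.\<close>

lemma prime_power_of_binomials:
  assumes D: "D > 0" and bin: "\<And>k. 0 < k \<Longrightarrow> k < D \<Longrightarrow> of_nat (D choose k) = (0 :: 'a::{field,infinite})"
  shows "\<exists>e. D = char_exp TYPE('a) ^ e"
proof (cases "CHAR('a) = 0")
  case True
  have "D = 1"
  proof (rule ccontr)
    assume "D \<noteq> 1"
    then have "of_nat D = (0::'a)" using bin[of 1] D by simp
    then show False using D True by (simp add: of_nat_eq_0_iff_char_dvd)
  qed
  then show ?thesis by (intro exI[of _ 0]) simp
next
  case False
  define p where "p = CHAR('a)"
  have p: "prime p" using False prime_CHAR_semidom[where ?'a = 'a] by (simp add: p_def)
  obtain e m where em: "D = p ^ e * m" "\<not> p dvd m"
    using D p by (metis multiplicity_decompose' not_prime_unit neq0_conv)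
  have "m = 1"
  proof (rule ccontr)
    assume "m \<noteq> 1"
    then have m: "m > 1" using D em(1) by (cases m) auto
    define q where "q = p ^ e"
    have q: "q > 0" "D = q * m" using p em(1) by (auto simp: q_def prime_gt_0_nat)
    \<comment> \<open>\<open>g l\<close> is the coefficient of \<open>t ^ (q * l)\<close> in
      \<open>(t ^ q + 1) ^ m - 1 - t ^ D\<close>.\<close>
    define g where "g l = (of_nat (m choose l) :: 'a) - (if l = 0 then 1 else 0) - (if l = m then 1 else 0)" for l
    have "(\<Sum>l\<in>{..m}. g l * t ^ (q * l)) = 0" for t :: 'a
    proof -
      have "(t + 1) ^ D = (\<Sum>k\<le>D. of_nat (D choose k) * t ^ k)"
        by (simp add: binomial_ring)
      also have "\<dots> = (\<Sum>k\<in>{0, D}. of_nat (D choose k) * t ^ k)"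
        by (intro sum.mono_neutral_right) (auto simp: bin)
      also have "\<dots> = 1 + t ^ D" using D by simp
      finally have 1: "(t + 1) ^ D = 1 + t ^ D" .
      have "(t + 1) ^ D = (t ^ q + 1) ^ m"
        using freshmans_dream'[of q e t 1] p
        by (simp add: q(2) power_mult p_def[symmetric] q_def[symmetric])
      also have "\<dots> = (\<Sum>l\<le>m. of_nat (m choose l) * t ^ (q * l))"
        by (simp add: binomial_ring power_mult)
      finally have 2: "(\<Sum>l\<le>m. of_nat (m choose l) * t ^ (q * l)) = 1 + t ^ D" using 1 by simp
      have "(\<Sum>l\<in>{..m}. g l * t ^ (q * l)) = (\<Sum>l\<le>m. of_nat (m choose l) * t ^ (q * l))
        - (\<Sum>l\<le>m. (if l = 0 then t ^ (q * l) else 0)) - (\<Sum>l\<le>m. (if l = m then t ^ (q * l) else 0))"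
        unfolding g_def sum_subtractf[symmetric] by (intro sum.cong) (auto simp: algebra_simps)
      also have "\<dots> = 0" unfolding 2 using m q(2) by (simp add: sum.delta)
      finally show ?thesis .
    qed
    from power_sum_eq_0[OF _ this, of q]
    have "(\<Sum>l | l \<in> {..m} \<and> q * l = q. g l) = 0" by simp
    moreover have "{l. l \<in> {..m} \<and> q * l = q} = {1}" using q(1) m by auto
    ultimately have "g 1 = 0" by simp
    then have "of_nat m = (0::'a)" using m by (simp add: g_def)
    then show False using em(2) by (simp add: of_nat_eq_0_iff_char_dvd p_def)
  qed
  then show ?thesis using em(1) False by (intro exI[of _ e]) (simp add: char_exp_def p_def)
qed

lemma sform_nonzero_nzvec: "sform h y z \<noteq> 0 \<Longrightarrow> nzvec h y"
proof (rule ccontr)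
  assume "sform h y z \<noteq> 0" "\<not> nzvec h y"
  then have "y (2*k) = 0" "y (2*k+1) = 0" if "k < h" for k using that by (auto simp: nzvec_def)
  then have "sform h y z = 0" unfolding sform_def by (intro sum.neutral) auto
  then show False using \<open>sform h y z \<noteq> 0\<close> by simp
qed

text \<open>Each star is a single variable to the power \<open>D\<close>. On the pencil
  \<open>s * y1 + y2\<close>, where \<open>y1\<close> kills the second and \<open>y2\<close> the
  first of three stars, the relation reads
  \<open>K1 * s ^ D + K2 + K3 * (s * A + A') ^ D = 0\<close>. Its middle coefficients are nonzero
  multiples of the binomials, so these vanish in the field.\<close>

lemma extremal_star_deg:
  fixes c :: "mono \<Rightarrow> 'a::{field,infinite}"
  assumes X: "extremal (Suc h) c X" and red: "reduced X" and i: "card (star i ` X) \<noteq> 1"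
    and mu1: "\<mu>1 \<in> X"
  shows "\<exists>e. star_deg (star i \<mu>1) = char_exp TYPE('a) ^ e"
proof -
  define H where "H = Suc h"
  define D where "D = star_deg (star i \<mu>1)"
  have fX: "finite X" and eX: "edge_mons X" using X by (auto simp: extremal_def)
  have edge: "\<exists>v. v \<in> touch i \<and> fst v < snd v \<and> (\<forall>w. star i \<mu> w = (if w = v then D else 0))"
    if mu: "\<mu> \<in> X" for \<mu>
  proof -
    obtain v where v: "v \<in> touch i" "fst v < snd v" "star i \<mu> v \<noteq> 0"
      by (rule extremal_star_nonzero[OF X i mu])
    have single: "w = v" if "star i \<mu> w \<noteq> 0" for w
      by (rule extremal_star_single[OF X red i mu that v(3)])
    have "{w. star i \<mu> w \<noteq> 0} = {v}"
    proof
      show "{w. star i \<mu> w \<noteq> 0} \<subseteq> {v}"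
      proof
        fix w assume "w \<in> {w. star i \<mu> w \<noteq> 0}"
        then have "star i \<mu> w \<noteq> 0" by simp
        then have "w = v" by (rule single)
        then show "w \<in> {v}" by simp
      qed
      show "{v} \<subseteq> {w. star i \<mu> w \<noteq> 0}" using v(3) by simp
    qed
    then have "star_deg (star i \<mu>) = star i \<mu> v" by (simp add: star_deg_def)
    moreover have "star i \<mu> w = 0" if "w \<noteq> v" for w using single[of w] that by blast
    moreover have "star_deg (star i \<mu>) = D"
      unfolding D_def by (rule minimal_vanishing_star_deg[OF extremal_minimal_vanishing[OF X] mu mu1])
    ultimately show ?thesis using v by (intro exI[of _ v]) auto
  qed
  obtain v0 where "v0 \<in> touch i" "fst v0 < snd v0" "star i \<mu>1 v0 \<noteq> 0"
    by (rule extremal_star_nonzero[OF X i mu1])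
  then have "star i \<mu>1 \<noteq> (\<lambda>_. 0)" by auto
  then have D0: "D > 0" unfolding D_def using star_deg_eq_0_iff[of i \<mu>1] by simp
  have a1: "star i \<mu>1 \<in> star i ` X" using mu1 by simp
  have "3 \<le> card (star i ` X)" using extremal_stars(1)[OF X i] by simp
  from obtain_two_more[OF finite_imageI[OF fX] this a1]
  obtain a2 a3 where a: "a2 \<in> star i ` X" "a3 \<in> star i ` X"
      "star i \<mu>1 \<noteq> a2" "star i \<mu>1 \<noteq> a3" "a2 \<noteq> a3" .
  obtain \<mu>2 where mu2: "\<mu>2 \<in> X" "a2 = star i \<mu>2" using a(1) by (elim imageE) simp
  obtain \<mu>3 where mu3: "\<mu>3 \<in> X" "a3 = star i \<mu>3" using a(2) by (elim imageE) simp
  obtain v1 where v1: "v1 \<in> touch i" "fst v1 < snd v1" "\<And>w. star i \<mu>1 w = (if w = v1 then D else 0)"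
    using edge[OF mu1] by blast
  obtain v2 where v2: "v2 \<in> touch i" "fst v2 < snd v2" "\<And>w. a2 w = (if w = v2 then D else 0)"
    using edge[OF mu2(1)] mu2(2) by blast
  obtain v3 where v3: "v3 \<in> touch i" "fst v3 < snd v3" "\<And>w. a3 w = (if w = v3 then D else 0)"
    using edge[OF mu3(1)] mu3(2) by blast
  have vne: "v1 \<noteq> v2" "v1 \<noteq> v3" "v2 \<noteq> v3" using a(3-5) v1(3) v2(3) v3(3) by (auto simp: fun_eq_iff)
  obtain F where F: "finite F" "card F \<le> 2*h"
    "\<forall>w\<in>F. w \<in> touch i \<and> fst w < snd w \<and> star i \<mu>1 w = 0 \<and> a2 w = 0 \<and> a3 w = 0"
    "\<forall>b y. nzvec H y \<longrightarrow> (\<forall>w\<in>F. sform H y (b (other i w)) = 0) \<longrightarrow>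
       star_val H (b(i := y)) (star i \<mu>1) * class_val H c X i (star i \<mu>1) b +
       (star_val H (b(i := y)) a2 * class_val H c X i a2 b +
        star_val H (b(i := y)) a3 * class_val H c X i a3 b) = 0"
    using extremal_three_stars[OF X red i a1 a(1,2) a(3,4,5), folded H_def]
    by (elim exE conjE) (rule that)
  note F = F(1,2) F(3)[rule_format] F(4)[rule_format]
  have sv: "star_val H b a' = edge_val H b v ^ D" if "\<And>w. a' w = (if w = v then D else 0)" for a' v and b :: "nat \<Rightarrow> nat \<Rightarrow> 'a"
  proof -
    have "{w. a' w \<noteq> 0} = {v}" using that D0 by auto
    then show ?thesis by (simp add: star_val_def that)
  qed
  define j1 where "j1 = other i v1"
  define j2 where "j2 = other i v2"
  define j3 where "j3 = other i v3"
  define J where "J = other i ` F"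
  have oinj: "other i w \<noteq> other i w'"
    if "w \<in> touch i" "fst w < snd w" "w' \<in> touch i" "fst w' < snd w'" "w \<noteq> w'" for w w'
    using other_inj that by blast
  have jne: "j1 \<noteq> j2" "j1 \<noteq> j3" "j2 \<noteq> j3"
    unfolding j1_def j2_def j3_def using oinj v1(1,2) v2(1,2) v3(1,2) vne by blast+
  have jJ: "other i w \<notin> J" if "w \<in> touch i" "fst w < snd w" "w \<notin> F" for w
    
  proof
    assume "other i w \<in> J"
    then obtain w' where w': "w' \<in> F" "other i w = other i w'" unfolding J_def by (elim imageE) simp
    then have "w = w'" using oinj[OF that(1,2), of w'] F(3)[of w'] by blast
    then show False using w'(1) that(3) by simp
  qed
  have "v1 \<notin> F" "v2 \<notin> F" "v3 \<notin> F" 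
    using F(3)[of v1] F(3)[of v2] F(3)[of v3] v1(3) v2(3) v3(3) D0 by auto
  then have jJ': "j1 \<notin> J" "j2 \<notin> J" "j3 \<notin> J"
    unfolding j1_def j2_def j3_def using jJ v1(1,2) v2(1,2) v3(1,2) by blast+
  have finJ: "finite J" "card J \<le> 2*h"
    using F(1,2) card_image_le[OF F(1), of "other i"] unfolding J_def by simp_all
  have cJ: "card (insert j1 J) < 2 * H" "card (insert j2 J) < 2 * H"
    using finJ jJ' by (simp_all add: H_def)
  obtain b0 where b0: "class_val H c X i a3 b0 \<noteq> 0"
    by (rule class_val_nonzero[OF X i mu3(1), folded H_def mu3(2)])
  obtain y1 where y1: "nzvec H y1" "\<forall>k\<in>insert j2 J. sform H y1 (b0 k) = 0"
    using exists_orthogonal[OF finite.insertI[OF finJ(1)] cJ(2), of b0] by (elim exE conjE) (rule that)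
  obtain y2 where y2: "nzvec H y2" "\<forall>k\<in>insert j1 J. sform H y2 (b0 k) = 0"
    using exists_orthogonal[OF finite.insertI[OF finJ(1)] cJ(1), of b0] by (elim exE conjE) (rule that)
  obtain z1 where z1: "sform H y1 z1 = 1" using sform_nondegenerate y1(1) by blast
  obtain z2 where z2: "sform H y2 z2 = 1" using sform_nondegenerate y2(1) by blast
  have "polyfun (\<lambda>s. sform H y1 (\<lambda>k. z1 k + s * z2 k))" "polyfun (\<lambda>s. sform H y2 (\<lambda>k. z1 k + s * z2 k))"
    by (intro polyfun_intros)+
  moreover have "sform H y1 (\<lambda>k. z1 k + 0 * z2 k) \<noteq> 0" using z1 by simp
  moreover have "sform H y2 (\<lambda>k. z1 k + (1 - sform H y2 z1) * z2 k) \<noteq> 0" by (simp add: sform_shift z2)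
  ultimately obtain s0 where s0: "sform H y1 (\<lambda>k. z1 k + s0 * z2 k) \<noteq> 0"
      "sform H y2 (\<lambda>k. z1 k + s0 * z2 k) \<noteq> 0"
    using polyfun_nonzero2[of "\<lambda>s. sform H y1 (\<lambda>k. z1 k + s * z2 k)" "\<lambda>s. sform H y2 (\<lambda>k. z1 k + s * z2 k)"]
    by blast
  define z where "z = (\<lambda>k. z1 k + s0 * z2 k)"
  have z: "sform H y1 z \<noteq> 0" "sform H y2 z \<noteq> 0" using s0 by (simp_all add: z_def)
  \<comment> \<open>The third far end moves in a direction that neither \<open>y1\<close> nor
    \<open>y2\<close> annihilates, so that \<open>A\<close>, \<open>A'\<close> and the third
    cofactor are simultaneously nonzero for some \<open>t\<close>.\<close>
  define B where "B t = b0(j3 := \<lambda>k. b0 j3 k + t * z k)" for t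
  have pB: "polyfun (\<lambda>t. B t l k)" for l k
    by (cases "l = j3") (auto simp: B_def intro!: polyfun_intros)
  have nz: "\<exists>t. sform H Y (B t j3) \<noteq> 0" if "sform H Y z \<noteq> 0" for Y
    using that by (intro exI[of _ "(1 - sform H Y (b0 j3)) / sform H Y z"]) (simp only: B_def fun_upd_same sform_shift, simp)
  obtain t1 where t1: "sform H y1 (B t1 j3) \<noteq> 0" "sform H y2 (B t1 j3) \<noteq> 0"
  proof -
    obtain ta tb where "sform H y1 (B ta j3) \<noteq> 0" "sform H y2 (B tb j3) \<noteq> 0" using nz z by blast
    moreover have "polyfun (\<lambda>t. sform H Y (B t j3))" for Y by (intro polyfun_intros pB)
    ultimately show ?thesis
      using polyfun_nonzero2[of "\<lambda>t. sform H y1 (B t j3)" "\<lambda>t. sform H y2 (B t j3)"] that by blast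
  qed
  obtain t where t: "class_val H c X i a3 (B t) \<noteq> 0" "sform H y1 (B t j3) * sform H y2 (B t j3) \<noteq> 0"
  proof -
    have "class_val H c X i a3 (B 0) \<noteq> 0" using b0 by (simp add: B_def)
    moreover have "sform H y1 (B t1 j3) * sform H y2 (B t1 j3) \<noteq> 0" using t1 by simp
    moreover have "polyfun (\<lambda>t. class_val H c X i a3 (B t))"
      "polyfun (\<lambda>t. sform H y1 (B t j3) * sform H y2 (B t j3))"
      by (intro polyfun_intros pB)+
    ultimately show ?thesis
      using polyfun_nonzero2[of "\<lambda>t. class_val H c X i a3 (B t)"
          "\<lambda>t. sform H y1 (B t j3) * sform H y2 (B t j3)"] that by blast
  qed
  define b where "b = B t"
  define A where "A = sform H y1 (b j3)"
  define A' where "A' = sform H y2 (b j3)"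
  have A: "A \<noteq> 0" "A' \<noteq> 0" using t(2) by (auto simp: A_def A'_def b_def)
  have bk: "b k = b0 k" if "k \<noteq> j3" for k using that by (simp add: b_def B_def)
  define K1 where "K1 = (orient i v1 * sform H y1 (b j1)) ^ D * class_val H c X i (star i \<mu>1) b"
  define K2 where "K2 = (orient i v2 * sform H y2 (b j2)) ^ D * class_val H c X i a2 b"
  define K3 where "K3 = orient i v3 ^ D * class_val H c X i a3 b"
  have K3: "K3 \<noteq> 0" using t(1) by (simp add: K3_def b_def)
  define P where "P s = K1 * s ^ D + (K2 + K3 * (s * A + A') ^ D)" for s
  \<comment> \<open>For the excluded value of \<open>s\<close> the vector \<open>y\<close> might be
    zero, and the relation is available for nonzero vectors; polynomiality in \<open>s\<close> fills
    the gap.\<close>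
  have Pz: "P s = 0" if "s \<notin> {- A' / A}" for s
  proof -
    define y where "y = (\<lambda>k. s * y1 k + 1 * y2 k)"
    have yb: "sform H y x = s * sform H y1 x + sform H y2 x" for x
      unfolding y_def using sform_lin_left[of H s y1 1 y2 x] by simp
    have "sform H y (b j3) \<noteq> 0"
      using that A(1) by (auto simp: yb A_def[symmetric] A'_def[symmetric] field_simps add_eq_0_iff)
    then have "nzvec H y" by (rule sform_nonzero_nzvec)
    moreover have "sform H y (b (other i w)) = 0" if "w \<in> F" for w
    proof -
      have o: "other i w \<in> J" using that by (simp add: J_def)
      then have "other i w \<noteq> j3" using jJ'(3) by auto
      then show ?thesis using y1(2) y2(2) o by (simp add: yb bk)
    qed
    ultimately have "star_val H (b(i := y)) (star i \<mu>1) * class_val H c X i (star i \<mu>1) b +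
       (star_val H (b(i := y)) a2 * class_val H c X i a2 b +
        star_val H (b(i := y)) a3 * class_val H c X i a3 b) = 0"
      by (intro F(4)) blast+
    moreover have "sform H y (b j1) = s * sform H y1 (b j1)"
      using y2(2) jne by (simp add: yb bk)
    moreover have "sform H y (b j2) = sform H y2 (b j2)"
      using y1(2) jne by (simp add: yb bk)
    moreover have "sform H y (b j3) = s * A + A'" by (simp add: yb A_def A'_def)
    ultimately show ?thesis
      unfolding sv[OF v1(3)] sv[OF v2(3)] sv[OF v3(3)]
        edge_val_upd[OF v1(1,2)] edge_val_upd[OF v2(1,2)] edge_val_upd[OF v3(1,2)]
        j1_def[symmetric] j2_def[symmetric] j3_def[symmetric] P_def K1_def K2_def K3_def
      by (simp add: power_mult_distrib mult_ac)
  qed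
  have "polyfun P" unfolding P_def by (intro polyfun_intros)
  from polyfun_eq_0[OF this finite.insertI[OF finite.emptyI] Pz]
  have P0: "P s = 0" for s .
  define g where "g k = K3 * (of_nat (D choose k) * A ^ k * A' ^ (D - k))
     + ((if k = D then K1 else 0) + (if k = 0 then K2 else 0))" for k
  have "(\<Sum>k\<in>{..D}. g k * s ^ k) = 0" for s
  proof -
    have "(\<Sum>k\<in>{..D}. g k * s ^ k) = (\<Sum>k\<le>D. K3 * (of_nat (D choose k) * (s * A) ^ k * A' ^ (D - k)))
      + ((\<Sum>k\<le>D. (if k = D then K1 * s ^ k else 0)) + (\<Sum>k\<le>D. (if k = 0 then K2 * s ^ k else 0)))"
      unfolding g_def sum.distrib[symmetric]
      by (intro sum.cong) (auto simp: algebra_simps power_mult_distrib)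
    also have "\<dots> = P s"
      unfolding P_def binomial_ring sum_distrib_left by (simp add: sum.delta)
    finally show ?thesis using P0 by simp
  qed
  from power_sum_eq_0[OF _ this]
  have g0: "(\<Sum>k | k \<in> {..D} \<and> k = d. g k) = 0" for d by simp
  have "of_nat (D choose k) = (0::'a)" if "0 < k" "k < D" for k
  proof -
    have "{l. l \<in> {..D} \<and> l = k} = {k}" using that by auto
    then have "g k = 0" using g0[of k] by simp
    then show ?thesis using that K3 A by (simp add: g_def)
  qed
  from prime_power_of_binomials[OF D0 this] show ?thesis unfolding D_def by blast
qed

section \<open>Perfect matchings\<close>


text \<open>Here \<open>P \<mu> i\<close> is the partner of \<open>i\<close> in the matching \<open>\<mu>\<close>, and \<open>S\<close> collects the vertices
  whose partner varies among the matchings through a fixed edge.  If an edge \<open>g\<close> lies in the set of an edge \<open>e\<close>,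
  then \<open>e\<close> lies in the set of \<open>g\<close>; this symmetry forces \<open>V\<close> to be small.\<close>

lemma matching_family_card:
  fixes P :: "'m \<Rightarrow> 'v \<Rightarrow> 'v"
  defines "T \<equiv> \<lambda>X i a. {\<mu>\<in>X. P \<mu> i = a}"
  defines "S \<equiv> \<lambda>X V i a. {v\<in>V. \<exists>\<mu>\<in>T X i a. \<exists>\<nu>\<in>T X i a. P \<mu> v \<noteq> P \<nu> v}"
  assumes fin: "finite X" "finite V" and ne: "X \<noteq> {}" "V \<noteq> {}" and n: "4 \<le> n"
    and P: "\<And>\<mu> i. \<mu> \<in> X \<Longrightarrow> i \<in> V \<Longrightarrow> P \<mu> i \<in> V \<and> P \<mu> i \<noteq> i \<and> P \<mu> (P \<mu> i) = i"
    and deg: "\<And>i. i \<in> V \<Longrightarrow> card ((\<lambda>\<mu>. P \<mu> i) ` X) = n + 1"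
    and cT: "\<And>i \<mu>. i \<in> V \<Longrightarrow> \<mu> \<in> X \<Longrightarrow> card (T X i (P \<mu> i)) = N"
    and cS: "\<And>i \<mu>. i \<in> V \<Longrightarrow> \<mu> \<in> X \<Longrightarrow> card (S X V i (P \<mu> i)) = n"
    and B: "\<And>i \<mu> v w. i \<in> V \<Longrightarrow> \<mu> \<in> X \<Longrightarrow> v \<in> S X V i (P \<mu> i) \<Longrightarrow> w \<in> S X V i (P \<mu> i) \<Longrightarrow> v \<noteq> w \<Longrightarrow>
        \<exists>\<nu>\<in>T X i (P \<mu> i). P \<nu> v = w"
    and B2: "\<And>i \<mu> v w x y. i \<in> V \<Longrightarrow> \<mu> \<in> X \<Longrightarrow> {v,w,x,y} \<subseteq> S X V i (P \<mu> i) \<Longrightarrow> distinct [v,w,x,y] \<Longrightarrow>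
        \<exists>\<nu>\<in>T X i (P \<mu> i). P \<nu> v = w \<and> P \<nu> x = y"
  shows "card V = n + 2"
proof (rule ccontr)
  assume cV: "card V \<noteq> n + 2"
  define TT where "TT = T X"
  define SS where "SS = S X V"
  define E where "E i a \<longleftrightarrow> i \<in> V \<and> (\<exists>\<mu>\<in>X. P \<mu> i = a)" for i a
  have TTm: "\<mu> \<in> TT i a \<longleftrightarrow> \<mu> \<in> X \<and> P \<mu> i = a" for \<mu> i a by (simp add: TT_def T_def)
  have SSm: "v \<in> SS i a \<longleftrightarrow> v \<in> V \<and> (\<exists>\<mu>\<in>TT i a. \<exists>\<nu>\<in>TT i a. P \<mu> v \<noteq> P \<nu> v)" for v i a
    by (simp add: SS_def S_def TT_def)
  have cTT: "card (TT i a) = N" if "E i a" for i a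
  proof -
    from that[unfolded E_def] obtain \<mu> where m: "i \<in> V" "\<mu> \<in> X" "P \<mu> i = a" by blast
    from cT[OF m(1,2), unfolded m(3), folded TT_def] show ?thesis .
  qed
  have cSS: "card (SS i a) = n" if "E i a" for i a
  proof -
    from that[unfolded E_def] obtain \<mu> where m: "i \<in> V" "\<mu> \<in> X" "P \<mu> i = a" by blast
    from cS[OF m(1,2), unfolded m(3), folded SS_def] show ?thesis .
  qed
  have BB: "\<exists>\<nu>\<in>TT i a. P \<nu> v = w" if "E i a" "v \<in> SS i a" "w \<in> SS i a" "v \<noteq> w" for i a v w
  proof -
    from that(1)[unfolded E_def] obtain \<mu> where m: "i \<in> V" "\<mu> \<in> X" "P \<mu> i = a" by blast
    from B[OF m(1,2), unfolded m(3), folded TT_def SS_def, OF that(2-4)] show ?thesis .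
  qed
  have BB2: "\<exists>\<nu>\<in>TT i a. P \<nu> v = w \<and> P \<nu> x = y"
    if "E i a" "{v,w,x,y} \<subseteq> SS i a" "distinct [v,w,x,y]" for i a v w x y
  proof -
    from that(1)[unfolded E_def] obtain \<mu> where m: "i \<in> V" "\<mu> \<in> X" "P \<mu> i = a" by blast
    from B2[OF m(1,2), unfolded m(3), folded TT_def SS_def, OF that(2,3)] show ?thesis .
  qed
  have Esym: "E a i" "TT a i = TT i a" "SS a i = SS i a" if "E i a" for i a
  proof -
    from that[unfolded E_def] obtain \<mu> where m: "i \<in> V" "\<mu> \<in> X" "P \<mu> i = a" by blast
    from P[OF m(2,1), unfolded m(3)] have a: "a \<in> V" "P \<mu> a = i" by simp_all
    show "E a i" using a m(2) by (auto simp: E_def)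
    show T: "TT a i = TT i a"
    proof (rule Set.set_eqI)
      fix \<nu>
      show "\<nu> \<in> TT a i \<longleftrightarrow> \<nu> \<in> TT i a" using P[of \<nu> i] P[of \<nu> a] a(1) m(1) by (auto simp: TTm)
    qed
    show "SS a i = SS i a" by (rule Set.set_eqI) (simp add: SSm T)
  qed
  have EV: "i \<in> V" "a \<in> V" "a \<noteq> i" if "E i a" for i a
    using that P unfolding E_def by blast+
  have SV: "SS i a \<subseteq> V" for i a by (auto simp: SSm)
  have notin: "i \<notin> SS i a" "a \<notin> SS i a" if "E i a" for i a
  proof -
    have "P \<mu> a = i" if "\<mu> \<in> TT i a" for \<mu>
      using that P[of \<mu> i] EV(1)[OF \<open>E i a\<close>] by (auto simp: TTm)
    then show "i \<notin> SS i a" "a \<notin> SS i a" by (auto simp: SSm TTm)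
  qed
  have const: "P \<mu> v = P \<nu> v" if "v \<in> V" "v \<notin> SS i a" "\<mu> \<in> TT i a" "\<nu> \<in> TT i a" for v i a \<mu> \<nu>
    using that unfolding SSm by blast
  have finT: "finite (TT i a)" for i a using fin(1) by (simp add: TT_def T_def)
  have finS: "finite (SS i a)" for i a using fin(2) SV finite_subset by blast
  \<comment> \<open>Otherwise every matching through \<open>v w\<close> also contains
    \<open>i a\<close>, and equal cardinalities identify the two families; but the partner of
    \<open>v\<close> varies among the matchings through \<open>i a\<close>.\<close>
  have half: "E v w \<and> i \<in> SS v w" if e: "E i a" and vw: "v \<in> SS i a" "w \<in> SS i a" "v \<noteq> w" for i a v w
  proof -
    obtain \<mu> where mu: "\<mu> \<in> TT i a" "P \<mu> v = w" using BB[OF e vw] by blast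
    have Evw: "E v w" using mu vw(1) SV by (auto simp: E_def TTm)
    have "i \<in> SS v w"
    proof (rule ccontr)
      assume "i \<notin> SS v w"
      have "TT v w \<subseteq> TT i a"
      proof
        fix \<nu> assume nu: "\<nu> \<in> TT v w"
        have "\<mu> \<in> TT v w" "P \<mu> i = a" using mu by (simp_all add: TTm)
        then have "P \<nu> i = a" using const[OF EV(1)[OF e] \<open>i \<notin> SS v w\<close> nu] by simp
        then show "\<nu> \<in> TT i a" using nu by (simp add: TTm)
      qed
      then have eq: "TT v w = TT i a"
        using cTT[OF e] cTT[OF Evw] finT by (simp add: card_subset_eq)
      have "\<exists>\<mu>\<in>TT i a. \<exists>\<nu>\<in>TT i a. P \<mu> v \<noteq> P \<nu> v" using vw(1) by (simp add: SSm)
      then show False unfolding eq[symmetric] by (auto simp: TTm)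
    qed
    with Evw show ?thesis by simp
  qed
  have claim: "E v w" "i \<in> SS v w" "a \<in> SS v w"
    if "E i a" "v \<in> SS i a" "w \<in> SS i a" "v \<noteq> w" for i a v w
    using half[OF that] half[OF Esym(1)[OF that(1)], of v w] Esym(3)[OF that(1)] that by auto
  have two: "\<exists>v w. v \<in> A \<and> w \<in> A \<and> v \<noteq> w" if A2: "2 \<le> card A" for A :: "'v set"
  proof -
    obtain C where "C \<subseteq> A" "card C = 2" by (rule obtain_subset_with_card_n[OF A2])
    then show ?thesis by (auto simp: card_2_iff)
  qed
  obtain i \<mu>0 where i: "i \<in> V" and mu0: "\<mu>0 \<in> X" using ne by blast
  define a where "a = P \<mu>0 i"
  define A where "A = SS i a"
  have Eia: "E i a" using i mu0 by (auto simp: E_def a_def)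
  have cA: "card A = n" "finite A" "A \<subseteq> V" using cSS[OF Eia] finS SV by (auto simp: A_def)
  have ia: "i \<notin> A" "a \<notin> A" "i \<noteq> a" "a \<in> V" using notin[OF Eia] EV[OF Eia] by (auto simp: A_def)
  have mu0T: "\<mu>0 \<in> TT i a" using mu0 by (simp add: TTm a_def)
  \<comment> \<open>A vertex \<open>b\<close> outside has the same partner \<open>c\<close> in all
    matchings through \<open>i a\<close>; by cardinality the edge \<open>b c\<close> then lies in
    exactly the same matchings as \<open>i a\<close>.\<close>
  have outside: "E b c" "TT b c = TT i a" "SS b c = A" "c \<noteq> i" "c \<noteq> a" "c \<noteq> b" "c \<notin> A"
    if b: "b \<in> V" "b \<notin> A" "b \<noteq> i" "b \<noteq> a" and c: "c = P \<mu>0 b" for b c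
  proof -
    show Ebc: "E b c" using b(1) mu0 c by (auto simp: E_def)
    have "TT i a \<subseteq> TT b c"
    proof
      fix \<nu> assume nu: "\<nu> \<in> TT i a"
      then have "P \<nu> b = P \<mu>0 b" using const[OF b(1) _ nu mu0T] b(2) A_def by blast
      then show "\<nu> \<in> TT b c" using nu c by (simp add: TTm)
    qed
    then show T: "TT b c = TT i a" using cTT[OF Ebc] cTT[OF Eia] finT by (metis card_subset_eq)
    then show SA: "SS b c = A" unfolding A_def by (auto simp: SSm)
    show "c \<notin> A" using notin[OF Ebc] SA by simp
    show "c \<noteq> b" using EV[OF Ebc] by simp
    have "P \<mu>0 c = b" using P[OF mu0 b(1)] c by simp
    then show "c \<noteq> i" "c \<noteq> a" using b P[OF mu0 i] by (auto simp: a_def)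
  qed
  have "card (insert i (insert a A)) = n + 2" using cA ia by simp
  moreover have "insert i (insert a A) \<subseteq> V" using cA ia i by simp
  ultimately have "insert i (insert a A) \<noteq> V" using cV by metis
  then obtain b where b: "b \<in> V" "b \<notin> A" "b \<noteq> i" "b \<noteq> a"
    using \<open>insert i (insert a A) \<subseteq> V\<close> by blast
  define c where "c = P \<mu>0 b"
  note out = outside[OF b c_def]
  define Q where "Q = {i, a, b, c}"
  have QS: "Q \<subseteq> SS v w" "E v w" if "v \<in> A" "w \<in> A" "v \<noteq> w" for v w
    using claim[OF Eia, of v w] claim[OF out(1), of v w] that out(3) by (auto simp: A_def Q_def)
  have cQ: "card Q = 4" using ia b out by (simp add: Q_def)
  \<comment> \<open>For \<open>n > 4\<close> some matching would contain \<open>v w\<close>,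
    \<open>i a\<close> and an edge from \<open>b\<close> to a vertex other than \<open>c\<close>,
    although \<open>i a\<close> forces \<open>b c\<close>. This leaves the configuration of two
    blocks \<open>A\<close> and \<open>Q\<close> with four vertices each.\<close>
  have n4: "n = 4"
  proof (rule ccontr)
    assume "n \<noteq> 4"
    obtain v w where vw: "v \<in> A" "w \<in> A" "v \<noteq> w" using two[of A] cA(1) n by auto
    have "\<not> SS v w \<subseteq> Q"
    proof
      assume "SS v w \<subseteq> Q"
      then have "card (SS v w) \<le> card Q" by (intro card_mono) (simp_all add: Q_def)
      then show False using cSS[OF QS(2)[OF vw]] cQ n \<open>n \<noteq> 4\<close> by simp
    qed
    then obtain x where x: "x \<in> SS v w" "x \<notin> Q" by blast
    have "{i, a, b, x} \<subseteq> SS v w" using QS(1)[OF vw] x(1) by (auto simp: Q_def)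
    moreover have "distinct [i, a, b, x]" using x(2) ia b by (auto simp: Q_def)
    ultimately obtain \<nu> where nu: "\<nu> \<in> TT v w" "P \<nu> i = a" "P \<nu> b = x"
      using BB2[OF QS(2)[OF vw], of i a b x] by blast
    then have "\<nu> \<in> TT i a" by (simp add: TTm)
    then have "\<nu> \<in> TT b c" using out(2) by simp
    then have "x = c" using nu(3) by (simp add: TTm)
    then show False using x(2) by (simp add: Q_def)
  qed
  have SQ: "SS v w = Q" if "v \<in> A" "w \<in> A" "v \<noteq> w" for v w
    using QS[OF that] cSS[of v w] cQ n4 finS by (metis card_subset_eq)
  obtain v0 w0 where vw0: "v0 \<in> A" "w0 \<in> A" "v0 \<noteq> w0" using two[of A] cA(1) n by auto
  have AQ: "A \<inter> Q = {}" using ia b out by (auto simp: Q_def)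
  have VAQ: "V \<subseteq> A \<union> Q"
  proof
    fix b' assume b': "b' \<in> V"
    show "b' \<in> A \<union> Q"
    proof (rule ccontr)
      assume n': "b' \<notin> A \<union> Q"
      then have bb: "b' \<notin> A" "b' \<noteq> i" "b' \<noteq> a" by (auto simp: Q_def)
      note o = outside[OF b' bb refl]
      have "b' \<in> SS v0 w0" using claim(2)[OF o(1), of v0 w0] vw0 o(3) by simp
      then show False using SQ[OF vw0] n' by simp
    qed
  qed
  have SA: "SS v w = A" if vw: "v \<in> Q" "w \<in> Q" "v \<noteq> w" "E v w" for v w
  proof -
    have "x \<in> SS v w" if "x \<in> A" for x
    proof -
      have "\<exists>y\<in>A. y \<noteq> x" using vw0 by metis
      then obtain y where y: "y \<in> A" "y \<noteq> x" by blast
      then show ?thesis using claim(2)[OF QS(2)[OF that y(1)], of v w] SQ[OF that y(1)] vw by auto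
    qed
    then have "A \<subseteq> SS v w" by blast
    then show ?thesis using cSS[OF vw(4)] cA finS by (metis card_subset_eq)
  qed
  \<comment> \<open>The block \<open>Q\<close> offers only three partners for \<open>i\<close>, but
    five occur, so some edge \<open>i x\<close> joins the blocks. Two of its four varying vertices
    lie in one block, and the symmetry puts \<open>x\<close> into \<open>Q\<close> or
    \<open>i\<close> into \<open>A\<close>.\<close>
  have "\<not> (\<lambda>\<mu>. P \<mu> i) ` X \<subseteq> Q - {i}"
  proof
    assume "(\<lambda>\<mu>. P \<mu> i) ` X \<subseteq> Q - {i}"
    then have "card ((\<lambda>\<mu>. P \<mu> i) ` X) \<le> card (Q - {i})" by (intro card_mono) (simp_all add: Q_def)
    moreover have "card (Q - {i}) = 3" using cQ by (subst card_Diff_singleton) (simp_all add: Q_def)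
    ultimately show False using deg[OF i] n4 by simp
  qed
  then obtain \<nu> where nu: "\<nu> \<in> X" "P \<nu> i \<notin> Q - {i}"
    unfolding image_subset_iff by blast
  define x where "x = P \<nu> i"
  have x: "x \<in> A" "E i x" using nu P[OF nu(1) i] VAQ i by (auto simp: x_def E_def)
  let ?S = "SS i x"
  have "?S = (?S \<inter> A) \<union> (?S \<inter> Q)" using SV VAQ by blast
  then have "card ?S \<le> card (?S \<inter> A) + card (?S \<inter> Q)" by (metis card_Un_le)
  then have "2 \<le> card (?S \<inter> A) \<or> 2 \<le> card (?S \<inter> Q)" using cSS[OF x(2)] n4 by linarith
  then show False
  proof
    assume "2 \<le> card (?S \<inter> A)"
    then obtain v w where "v \<in> ?S" "w \<in> ?S" "v \<noteq> w" "v \<in> A" "w \<in> A" using two by blast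
    then have "x \<in> Q" using claim(3)[OF x(2), of v w] SQ[of v w] by simp
    then show False using x(1) AQ by blast
  next
    assume "2 \<le> card (?S \<inter> Q)"
    then obtain v w where vw: "v \<in> ?S" "w \<in> ?S" "v \<noteq> w" "v \<in> Q" "w \<in> Q" using two by blast
    then have "i \<in> A" using claim(1,2)[OF x(2), of v w] SA[of v w] by simp
    then show False using ia by simp
  qed
qed

section \<open>Perfect matchings as monomials\<close>

definition edge :: "nat \<Rightarrow> nat \<Rightarrow> nat \<times> nat" where
  "edge i j = (min i j, max i j)"

lemma edge_commute: "edge i j = edge j i"
  by (simp add: edge_def min.commute max.commute)

lemma edge_touch [simp]: "edge i j \<in> touch i" "edge i j \<in> touch j"
  by (auto simp: edge_def touch_def min_def max_def)

lemma edge_less: "i \<noteq> j \<Longrightarrow> fst (edge i j) < snd (edge i j)"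
  by (auto simp: edge_def)

lemma edge_other: "v \<in> touch i \<Longrightarrow> fst v < snd v \<Longrightarrow> v = edge i (other i v)"
  by (cases v) (auto simp: edge_def touch_def other_def)

lemma other_edge [simp]: "other i (edge i j) = j"
  by (auto simp: edge_def other_def min_def max_def)

lemma edge_inj: "edge i j = edge i k \<Longrightarrow> j = k"
  by (metis other_edge)

lemma edge_fst_snd: "fst v < snd v \<Longrightarrow> edge (fst v) (snd v) = v"
  by (cases v) (simp add: edge_def)

lemma touch_edge: "edge i j \<in> touch k \<Longrightarrow> k = i \<or> k = j"
  by (auto simp: edge_def touch_def min_def max_def split: if_splits)

lemma keys_add_mono: "keys (\<mu> + \<nu> :: mono) = keys \<mu> \<union> keys \<nu>"
  by (auto simp: in_keys_iff lookup_add)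

definition smul :: "nat \<Rightarrow> mono \<Rightarrow> mono" where
  "smul q \<mu> = Poly_Mapping.map (\<lambda>k. q * k) \<mu>"

lemma lookup_smul [simp]: "lookup (smul q \<mu>) v = q * lookup \<mu> v"
  by (simp add: smul_def Poly_Mapping.map.rep_eq when_def)

text \<open>A matching is stored as its squarefree monomial, so matchings and the monomials of a
  Pfaffian are the same objects.\<close>

definition perfect_matchings :: "nat set \<Rightarrow> mono set" where
  "perfect_matchings S = {M. (\<forall>v\<in>keys M. fst v < snd v \<and> fst v \<in> S \<and> snd v \<in> S \<and> lookup M v = 1) \<and>
     (\<forall>i\<in>S. \<exists>!v. v \<in> keys M \<and> v \<in> touch i)}"

lemma perfect_matchingsD:
  assumes "M \<in> perfect_matchings S" "v \<in> keys M"
  shows "fst v < snd v" "fst v \<in> S" "snd v \<in> S" "lookup M v = 1"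
  using assms by (auto simp: perfect_matchings_def)

lemma perfect_matchings_unique:
  assumes "M \<in> perfect_matchings S" "i \<in> S" "v \<in> keys M" "v \<in> touch i" "w \<in> keys M" "w \<in> touch i"
  shows "v = w"
  using assms unfolding perfect_matchings_def by blast

lemma perfect_matchings_ex:
  assumes "M \<in> perfect_matchings S" "i \<in> S"
  obtains v where "v \<in> keys M" "v \<in> touch i"
  using assms unfolding perfect_matchings_def by blast

lemma perfect_matchings_touch:
  assumes "M \<in> perfect_matchings S" "v \<in> keys M" "v \<in> touch i"
  shows "i \<in> S"
  using perfect_matchingsD[OF assms(1,2)] assms(3) by (auto simp: touch_def)

lemma perfect_matchings_lookup:
  assumes "M \<in> perfect_matchings S"
  shows "lookup M v = (if v \<in> keys M then 1 else 0)"
  using perfect_matchingsD(4)[OF assms, of v] by (simp add: in_keys_iff)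

lemma perfect_matchings_empty: "perfect_matchings {} = {0}"
proof -
  have "M = 0" if "M \<in> perfect_matchings {}" for M
  proof -
    have "keys M = {}" using perfect_matchingsD(2)[OF that] by blast
    then show ?thesis by simp
  qed
  moreover have "0 \<in> perfect_matchings {}" by (simp add: perfect_matchings_def)
  ultimately show ?thesis by blast
qed

lemma perfect_matchings_insert:
  assumes M: "M \<in> perfect_matchings (S - {i, j})" and ij: "i \<in> S" "j \<in> S" "i \<noteq> j"
  shows "Poly_Mapping.single (edge i j) 1 + M \<in> perfect_matchings S"
proof -
  let ?e = "edge i j"
  let ?N = "Poly_Mapping.single ?e 1 + M"
  have k: "keys ?N = insert ?e (keys M)" by (simp add: keys_add_mono)
  have eM: "?e \<notin> keys M" using perfect_matchings_touch[OF M, of ?e i] by auto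
  have l: "lookup ?N v = (if v = ?e then 1 else lookup M v)" for v
    using eM by (auto simp: lookup_add lookup_single when_def in_keys_iff)
  have "fst v < snd v \<and> fst v \<in> S \<and> snd v \<in> S \<and> lookup ?N v = 1" if "v \<in> keys ?N" for v
  proof (cases "v = ?e")
    case True
    then show ?thesis using ij l edge_less[OF ij(3)] by (simp add: edge_def min_def max_def)
  next
    case False
    then have "v \<in> keys M" using that k by simp
    then show ?thesis using perfect_matchingsD[OF M, of v] l False by auto
  qed
  moreover have "\<exists>!v. v \<in> keys ?N \<and> v \<in> touch k" if kS: "k \<in> S" for k
  proof (cases "k = i \<or> k = j")
    case True
    then have "?e \<in> touch k" by auto
    moreover have "v = ?e" if "v \<in> keys ?N \<and> v \<in> touch k" for v
      using that perfect_matchings_touch[OF M, of v k] True k by auto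
    ultimately show ?thesis using k by (intro ex1I[of _ ?e]) auto
  next
    case False
    then have kS': "k \<in> S - {i, j}" using kS by simp
    obtain v where v: "v \<in> keys M" "v \<in> touch k" by (rule perfect_matchings_ex[OF M kS'])
    have "w = v" if "w \<in> keys ?N \<and> w \<in> touch k" for w
    proof -
      have "w \<noteq> ?e" using that False touch_edge by blast
      then have "w \<in> keys M" using that k by simp
      then show ?thesis using perfect_matchings_unique[OF M kS' _ _ v] that by blast
    qed
    then show ?thesis using v k by (intro ex1I[of _ v]) auto
  qed
  ultimately show ?thesis unfolding perfect_matchings_def by blast
qed

lemma perfect_matchings_remove:
  assumes M: "M \<in> perfect_matchings S" and e: "edge i j \<in> keys M"
  shows "M - Poly_Mapping.single (edge i j) 1 \<in> perfect_matchings (S - {i, j})"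
    and "Poly_Mapping.single (edge i j) 1 + (M - Poly_Mapping.single (edge i j) 1) = M"
proof -
  let ?e = "edge i j"
  let ?N = "M - Poly_Mapping.single ?e 1"
  have S: "i \<in> S" "j \<in> S" using perfect_matchings_touch[OF M e] by simp_all
  have l: "lookup ?N v = (if v = ?e then 0 else lookup M v)" for v
    using perfect_matchingsD(4)[OF M e] by (auto simp: lookup_minus lookup_single when_def)
  have k: "keys ?N = keys M - {?e}"
    by (rule Set.set_eqI) (unfold Diff_iff in_keys_iff l, simp)
  show "Poly_Mapping.single ?e 1 + ?N = M"
    using perfect_matchingsD(4)[OF M e]
    by (intro poly_mapping_eqI) (unfold lookup_add l lookup_single when_def, simp)
  have uniq: "v = ?e" if "v \<in> keys M" "v \<in> touch k" "k = i \<or> k = j" for v k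
    using perfect_matchings_unique[OF M _ that(1,2) e] that(3) S by auto
  have "fst v < snd v \<and> fst v \<in> S - {i, j} \<and> snd v \<in> S - {i, j} \<and> lookup ?N v = 1"
    if "v \<in> keys ?N" for v
  proof -
    have v: "v \<in> keys M" "v \<noteq> ?e" using that k by auto
    have "v \<in> touch (fst v)" "v \<in> touch (snd v)" by (simp_all add: touch_def)
    then have "fst v \<notin> {i, j}" "snd v \<notin> {i, j}" using uniq[OF v(1)] v(2) by blast+
    then show ?thesis using perfect_matchingsD[OF M v(1)] l v(2) by simp
  qed
  moreover have "\<exists>!v. v \<in> keys ?N \<and> v \<in> touch m" if "m \<in> S - {i, j}" for m
  proof -
    have m: "m \<in> S" "m \<noteq> i" "m \<noteq> j" using that by simp_all
    obtain v where v: "v \<in> keys M" "v \<in> touch m" by (rule perfect_matchings_ex[OF M m(1)])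
    have "v \<noteq> ?e" using v(2) m touch_edge by blast
    then have vN: "v \<in> keys ?N \<and> v \<in> touch m" using v unfolding k by blast
    have "w = v" if "w \<in> keys ?N \<and> w \<in> touch m" for w
      using perfect_matchings_unique[OF M m(1) _ _ v, of w] that k by simp
    with vN show ?thesis by (rule ex1I[of _ v])
  qed
  ultimately show "?N \<in> perfect_matchings (S - {i, j})" unfolding perfect_matchings_def by blast
qed

lemma perfect_matchings_through:
  assumes "i \<in> S" "j \<in> S" "i \<noteq> j"
  shows "{M\<in>perfect_matchings S. edge i j \<in> keys M} =
    (\<lambda>M. Poly_Mapping.single (edge i j) 1 + M) ` perfect_matchings (S - {i, j})"
proof (rule equalityI; rule subsetI)
  fix M assume "M \<in> {M\<in>perfect_matchings S. edge i j \<in> keys M}"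
  then have M: "M \<in> perfect_matchings S" "edge i j \<in> keys M" by simp_all
  show "M \<in> (\<lambda>M. Poly_Mapping.single (edge i j) 1 + M) ` perfect_matchings (S - {i, j})"
    using perfect_matchings_remove[OF M] by (metis image_eqI)
next
  fix M assume "M \<in> (\<lambda>M. Poly_Mapping.single (edge i j) 1 + M) ` perfect_matchings (S - {i, j})"
  then obtain N where "N \<in> perfect_matchings (S - {i, j})" "M = Poly_Mapping.single (edge i j) 1 + N"
    by blast
  then show "M \<in> {M\<in>perfect_matchings S. edge i j \<in> keys M}"
    using perfect_matchings_insert[OF _ assms] by (simp add: keys_add_mono)
qed

text \<open>The matchings are split by the partner of a fixed vertex. For \<open>m = 0\<close>
  truncated subtraction gives \<open>2*m-1 = 0\<close>, and \<open>dfact 0 = 1\<close> counts the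
  empty matching.\<close>

lemma card_perfect_matchings:
  assumes "finite S" "card S = 2*m"
  shows "finite (perfect_matchings S) \<and> card (perfect_matchings S) = dfact (2*m-1)"
  using assms
proof (induction m arbitrary: S)
  case 0
  then show ?case by (simp add: perfect_matchings_empty)
next
  case (Suc m)
  then obtain i where i: "i \<in> S" by fastforce
  let ?C = "\<lambda>j. {M\<in>perfect_matchings S. edge i j \<in> keys M}"
  have C: "finite (?C j) \<and> card (?C j) = dfact (2*m-1)" if "j \<in> S - {i}" for j
  proof -
    have "card (S - {i, j}) = 2*m" using Suc.prems i that by (simp add: card_Diff_subset)
    then have "finite (perfect_matchings (S - {i, j})) \<and> card (perfect_matchings (S - {i, j})) = dfact (2*m-1)"
      using Suc.IH Suc.prems(1) by simp
    moreover have "?C j = (\<lambda>M. Poly_Mapping.single (edge i j) 1 + M) ` perfect_matchings (S - {i, j})"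
      using i that by (intro perfect_matchings_through) auto
    ultimately show ?thesis by (simp add: card_image)
  qed
  have U: "perfect_matchings S = (\<Union>j\<in>S - {i}. ?C j)"
  proof
    show "perfect_matchings S \<subseteq> (\<Union>j\<in>S - {i}. ?C j)"
    proof
      fix M assume M: "M \<in> perfect_matchings S"
      obtain v where v: "v \<in> keys M" "v \<in> touch i" by (rule perfect_matchings_ex[OF M i])
      have "v = edge i (other i v)" "other i v \<noteq> i" "other i v \<in> S"
        using edge_other[OF v(2)] other_neq[OF v(2)] perfect_matchingsD[OF M v(1)] v(2)
        by (auto simp: other_def)
      then show "M \<in> (\<Union>j\<in>S - {i}. ?C j)" using M v(1) by (intro UN_I[of "other i v"]) auto
    qed
  qed blast
  have disj: "?C j \<inter> ?C k = {}" if "j \<noteq> k" for j k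
  proof -
    have False if "M \<in> perfect_matchings S" "edge i j \<in> keys M" "edge i k \<in> keys M" for M
      using perfect_matchings_unique[OF that(1) i that(2) edge_touch(1) that(3) edge_touch(1)] edge_inj
        \<open>j \<noteq> k\<close> by blast
    then show ?thesis by blast
  qed
  have "finite (\<Union>j\<in>S - {i}. ?C j)" using C Suc.prems(1) by blast
  then have "finite (perfect_matchings S)" unfolding U[symmetric] .
  moreover have "card (\<Union>j\<in>S - {i}. ?C j) = (\<Sum>j\<in>S - {i}. card (?C j))"
    using C Suc.prems(1) disj by (intro card_UN_disjoint) blast+
  then have "card (perfect_matchings S) = (\<Sum>j\<in>S - {i}. card (?C j))" unfolding U[symmetric] .
  then have "card (perfect_matchings S) = (2*m+1) * dfact (2*m-1)" using C i Suc.prems by simp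
  moreover have "(2*m+1) * dfact (2*m-1) = dfact (2 * Suc m - 1)" by (cases m) auto
  ultimately show ?case by simp
qed

lemma perfect_matchings_nonempty:
  assumes "finite S" "even (card S)"
  obtains M where "M \<in> perfect_matchings S"
proof -
  obtain m where "card S = 2*m" using assms(2) by blast
  then have "card (perfect_matchings S) > 0" using card_perfect_matchings[OF assms(1)] dfact_pos by simp
  then show ?thesis using that by (metis card.empty all_not_in_conv less_irrefl)
qed

lemma perfect_matchings_edge:
  assumes "finite S" "even (card S)" "v \<in> S" "w \<in> S" "v \<noteq> w"
  obtains M where "M \<in> perfect_matchings S" "edge v w \<in> keys M"
proof -
  have "card (S - {v, w}) = card S - 2" using assms by (simp add: card_Diff_subset)
  then have "even (card (S - {v, w}))" using assms(2) by simp
  then obtain M where "M \<in> perfect_matchings (S - {v, w})"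
    using perfect_matchings_nonempty[of "S - {v, w}"] assms(1) by auto
  from perfect_matchings_insert[OF this assms(3-5)] show ?thesis
    by (rule that) (simp add: keys_add_mono)
qed

lemma perfect_matchings_two_edges:
  assumes "finite S" "even (card S)" "{v, w, x, y} \<subseteq> S" "distinct [v, w, x, y]"
  obtains M where "M \<in> perfect_matchings S" "edge v w \<in> keys M" "edge x y \<in> keys M"
proof -
  have "card (S - {v, w}) = card S - 2" using assms by (simp add: card_Diff_subset)
  then have "even (card (S - {v, w}))" using assms(2) by simp
  then obtain M where M: "M \<in> perfect_matchings (S - {v, w})" "edge x y \<in> keys M"
    using perfect_matchings_edge[of "S - {v, w}" x y] assms by auto
  from perfect_matchings_insert[OF M(1)] assms M(2) show ?thesis
    by (intro that[of "Poly_Mapping.single (edge v w) 1 + M"]) (simp_all add: keys_add_mono)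
qed

section \<open>Supports of extremal sums\<close>


text \<open>Meaningful for a row with exactly one variable in the term, as at the branching rows of
  a reduced extremal sum.\<close>

definition partner :: "mono \<Rightarrow> nat \<Rightarrow> nat" where
  "partner \<mu> i = (THE j. lookup \<mu> (edge i j) \<noteq> 0)"

text \<open>The factor \<open>\<nu>\<close> and the exponent \<open>q\<close> are left free because
  the induction is applied to star classes: these share the variables of one row even if the whole
  sum is reduced, and their \<open>q\<close> are not known to agree.\<close>

definition matching_support :: "nat \<Rightarrow> nat \<Rightarrow> mono set \<Rightarrow> bool" where
  "matching_support p h X \<longleftrightarrow> (\<exists>\<nu> q S. finite S \<and> card S = 2*h+2 \<and> (\<exists>e. q = p ^ e) \<and>
     X = (\<lambda>M. \<nu> + smul q M) ` perfect_matchings S)"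

lemma char_exp_pos: "char_exp TYPE('a::semiring_1) > 0"
  by (simp add: char_exp_def)

lemma card_image_le_fibers:
  assumes "finite X" "\<And>x y. x \<in> X \<Longrightarrow> y \<in> X \<Longrightarrow> g x = g y \<Longrightarrow> f x = f y"
  shows "card (f ` X) \<le> card (g ` X)"
proof -
  have "f ` X \<subseteq> (\<lambda>b. f (SOME x. x \<in> X \<and> g x = b)) ` (g ` X)"
  proof
    fix a assume "a \<in> f ` X"
    then obtain x where x: "x \<in> X" "a = f x" by blast
    let ?y = "SOME y. y \<in> X \<and> g y = g x"
    have "?y \<in> X \<and> g ?y = g x" by (rule someI[of _ x]) (simp add: x(1))
    then have "a = f ?y" using assms(2)[of ?y x] x by simp
    then show "a \<in> (\<lambda>b. f (SOME x. x \<in> X \<and> g x = b)) ` (g ` X)"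
      using x(1) by (intro image_eqI[of _ _ "g x"]) simp_all
  qed
  then have "card (f ` X) \<le> card ((\<lambda>b. f (SOME x. x \<in> X \<and> g x = b)) ` (g ` X))"
    using assms(1) by (intro card_mono) simp_all
  also have "\<dots> \<le> card (g ` X)" using assms(1) by (intro card_image_le) simp
  finally show ?thesis .
qed

lemma exists_plane_points:
  fixes g :: "nat \<Rightarrow> 'a::comm_ring_1"
  assumes "h > 0"
  obtains b where "\<And>v. edge_val h b v = g (snd v) - g (fst v)"
proof
  define b where "b j k = (if k = 0 then 1 else if k = 1 then g j else 0)" for j k :: nat
  show "edge_val h b v = g (snd v) - g (fst v)" for v
    unfolding edge_val_def by (subst sform_plane[OF assms]) (auto simp: b_def)
qed

section \<open>Extremal sums without common factor\<close>

locale reduced_extremal =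
  fixes h :: nat and c :: "mono \<Rightarrow> 'a::{field,infinite}" and X :: "mono set"
  assumes ext: "extremal (Suc h) c X" and red: "reduced X"
begin

text \<open>For a reduced sum the branching rows are all the rows that occur: a constant star is
  empty, since each variable is absent from some term.\<close>

definition V :: "nat set" where
  "V = {i. card (star i ` X) \<noteq> 1}"

text \<open>By homogeneity in row \<open>i\<close> the choice of the term is immaterial.\<close>

definition d :: "nat \<Rightarrow> nat" where
  "d i = star_deg (star i (SOME \<mu>. \<mu> \<in> X))"

lemma finite_X: "finite X" and edge_mons_X: "edge_mons X" and coeff_X: "\<mu> \<in> X \<Longrightarrow> c \<mu> \<noteq> 0"
  and vanishes_X: "vanishes (Suc h) c X" and card_X: "card X = dfact (2*h+3)"
proof -
  have "2 * Suc h + 1 = 2*h+3" by simp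
  then show "finite X" "edge_mons X" "\<mu> \<in> X \<Longrightarrow> c \<mu> \<noteq> 0" "vanishes (Suc h) c X" "card X = dfact (2*h+3)"
    using ext unfolding extremal_def by metis+
qed

lemma X_nonempty: "X \<noteq> {}"
  using extremal_minimal_vanishing[OF ext] by (simp add: minimal_vanishing_def)

lemma V_iff: "i \<in> V \<longleftrightarrow> card (star i ` X) \<noteq> 1"
  by (simp add: V_def)

lemma star_deg_eq:
  assumes "\<mu> \<in> X"
  shows "star_deg (star i \<mu>) = d i"
proof -
  have "(SOME \<mu>. \<mu> \<in> X) \<in> X" using X_nonempty some_in_eq by blast
  from minimal_vanishing_star_deg[OF extremal_minimal_vanishing[OF ext] assms this]
  show ?thesis unfolding d_def .
qed

lemma lookup_touch_outside:
  assumes "i \<notin> V" "\<mu> \<in> X" "v \<in> touch i"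
  shows "lookup \<mu> v = 0"
proof -
  obtain \<nu> where nu: "\<nu> \<in> X" "lookup \<nu> v = 0" using red[unfolded reduced_def, rule_format, of v] by blast
  have "card (star i ` X) = 1" using assms(1) by (simp add: V_iff)
  from card_image_eq_1D[OF this assms(2) nu(1)] show ?thesis
    using assms(3) nu(2) unfolding star_eq_iff by simp
qed

lemma touch_in_V:
  assumes "\<mu> \<in> X" "v \<in> touch i" "lookup \<mu> v \<noteq> 0"
  shows "i \<in> V"
  using lookup_touch_outside[OF _ assms(1,2)] assms(3) by auto

lemma star_edge:
  assumes i: "i \<in> V" and mu: "\<mu> \<in> X"
  obtains v where "v \<in> touch i" "fst v < snd v" "lookup \<mu> v = d i" "d i > 0"
    "\<forall>w\<in>touch i. lookup \<mu> w \<noteq> 0 \<longrightarrow> w = v"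
proof -
  have i': "card (star i ` X) \<noteq> 1" using i by (simp add: V_iff)
  obtain v where v: "v \<in> touch i" "fst v < snd v" "star i \<mu> v \<noteq> 0"
    by (rule extremal_star_nonzero[OF ext i' mu])
  have single: "w = v" if "star i \<mu> w \<noteq> 0" for w
    by (rule extremal_star_single[OF ext red i' mu that v(3)])
  have "{w. star i \<mu> w \<noteq> 0} = {v}"
  proof
    show "{w. star i \<mu> w \<noteq> 0} \<subseteq> {v}"
    proof
      fix w assume "w \<in> {w. star i \<mu> w \<noteq> 0}"
      then have "star i \<mu> w \<noteq> 0" by simp
      then have "w = v" by (rule single)
      then show "w \<in> {v}" by simp
    qed
    show "{v} \<subseteq> {w. star i \<mu> w \<noteq> 0}" using v(3) by simp
  qed
  then have "star_deg (star i \<mu>) = star i \<mu> v" by (simp add: star_deg_def)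
  then have l: "lookup \<mu> v = d i" using star_deg_eq[OF mu, of i] v(1) by (simp add: star_def)
  moreover have "d i > 0" using l v(1,3) by (simp add: star_def)
  moreover have "w = v" if "w \<in> touch i" "lookup \<mu> w \<noteq> 0" for w
    by (rule single) (use that in \<open>simp add: star_def\<close>)
  ultimately show ?thesis using that[of v] v(1,2) by blast
qed

lemma partnerI:
  assumes "i \<in> V" "\<mu> \<in> X" "lookup \<mu> (edge i j) \<noteq> 0"
  shows "partner \<mu> i = j"
proof -
  obtain v where "v \<in> touch i" "fst v < snd v" "lookup \<mu> v = d i" "d i > 0"
    and v: "\<forall>w\<in>touch i. lookup \<mu> w \<noteq> 0 \<longrightarrow> w = v" by (rule star_edge[OF assms(1,2)])
  have "k = j" if "lookup \<mu> (edge i k) \<noteq> 0" for k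
    using v[rule_format, OF edge_touch(1) that] v[rule_format, OF edge_touch(1) assms(3)] edge_inj by metis
  then show ?thesis unfolding partner_def using assms(3) by (rule the_equality[rotated])
qed

lemma partner:
  assumes i: "i \<in> V" and mu: "\<mu> \<in> X"
  shows "partner \<mu> i \<noteq> i" "lookup \<mu> (edge i (partner \<mu> i)) = d i" "d i > 0"
    "partner \<mu> i \<in> V" "partner \<mu> (partner \<mu> i) = i" "d (partner \<mu> i) = d i"
proof -
  obtain v where v: "v \<in> touch i" "fst v < snd v" "lookup \<mu> v = d i" "d i > 0"
    by (rule star_edge[OF assms])
  have e: "v = edge i (other i v)" by (rule edge_other[OF v(1,2)])
  then have p: "partner \<mu> i = other i v" using v(3,4) by (intro partnerI[OF i mu]) simp
  show "partner \<mu> i \<noteq> i" using other_neq[OF v(1,2)] p by simp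
  show l: "lookup \<mu> (edge i (partner \<mu> i)) = d i" using e p v(3) by simp
  show "d i > 0" by (rule v(4))
  show V: "partner \<mu> i \<in> V"
  proof (rule ccontr)
    assume "partner \<mu> i \<notin> V"
    then have "lookup \<mu> (edge i (partner \<mu> i)) = 0"
      by (rule lookup_touch_outside[OF _ mu edge_touch(2)])
    then show False using l v(4) by simp
  qed
  have l': "lookup \<mu> (edge (partner \<mu> i) i) = d i" using l by (simp add: edge_commute)
  show "partner \<mu> (partner \<mu> i) = i" using l' v(4) by (intro partnerI[OF V mu]) simp
  obtain v' where "v' \<in> touch (partner \<mu> i)" "fst v' < snd v'"
    and v': "lookup \<mu> v' = d (partner \<mu> i)" "d (partner \<mu> i) > 0"
      "\<forall>w\<in>touch (partner \<mu> i). lookup \<mu> w \<noteq> 0 \<longrightarrow> w = v'"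
    by (rule star_edge[OF V mu])
  have "edge (partner \<mu> i) i = v'" using l' v(4) by (intro v'(3)[rule_format]) simp_all
  then show "d (partner \<mu> i) = d i" using l' v'(1) by simp
qed

lemma finite_V: "finite V"
proof -
  obtain \<mu> where mu: "\<mu> \<in> X" using X_nonempty by blast
  have "V \<subseteq> fst ` keys \<mu> \<union> snd ` keys \<mu>"
  proof
    fix i assume i: "i \<in> V"
    obtain v where v: "v \<in> touch i" "fst v < snd v" "lookup \<mu> v = d i" "d i > 0"
      by (rule star_edge[OF i mu])
    then have "v \<in> keys \<mu>" by (simp add: in_keys_iff)
    then show "i \<in> fst ` keys \<mu> \<union> snd ` keys \<mu>" using v(1) by (auto simp: touch_def)
  qed
  then show ?thesis by (rule finite_subset) simp
qed

lemma V_nonempty: "V \<noteq> {}"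
proof -
  obtain i where "card (star i ` X) \<noteq> 1"
    by (rule minimal_vanishing_branches[OF zero_less_Suc extremal_minimal_vanishing[OF ext] coeff_X])
  then show ?thesis using V_iff by blast
qed

lemma star_eq_iff_partner:
  assumes i: "i \<in> V" and mu: "\<mu> \<in> X" and nu: "\<nu> \<in> X"
  shows "star i \<mu> = star i \<nu> \<longleftrightarrow> partner \<mu> i = partner \<nu> i"
proof
  assume "star i \<mu> = star i \<nu>"
  then have "lookup \<mu> (edge i j) = lookup \<nu> (edge i j)" for j
    unfolding star_eq_iff by simp
  then show "partner \<mu> i = partner \<nu> i" by (simp add: partner_def)
next
  assume eq: "partner \<mu> i = partner \<nu> i"
  show "star i \<mu> = star i \<nu>"
  proof (rule extremal_star_unique[OF ext red mu _ nu])
    show "star i \<mu> (edge i (partner \<mu> i)) \<noteq> 0" "star i \<nu> (edge i (partner \<mu> i)) \<noteq> 0"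
      using partner(2,3)[OF i mu] partner(2)[OF i nu] by (simp_all add: star_def eq)
  qed
qed

lemma card_partners:
  assumes "i \<in> V"
  shows "card ((\<lambda>\<mu>. partner \<mu> i) ` X) = 2*h+3"
proof -
  have "card ((\<lambda>\<mu>. partner \<mu> i) ` X) = card (star i ` X)"
  proof (rule order_antisym; rule card_image_le_fibers[OF finite_X])
    fix x y assume xy: "x \<in> X" "y \<in> X"
    note iff = star_eq_iff_partner[OF assms xy]
    show "partner x i = partner y i" if "star i x = star i y" using that iff by simp
    show "star i x = star i y" if "partner x i = partner y i" using that iff by simp
  qed
  then show ?thesis using extremal_stars(1)[OF ext] assms by (simp add: V_iff)
qed

lemma extremal_class:
  assumes i: "i \<in> V" and mu: "\<mu> \<in> X"
  shows "extremal h c {\<nu>\<in>X. partner \<nu> i = partner \<mu> i}"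
proof -
  have "{\<nu>\<in>X. partner \<nu> i = partner \<mu> i} = {\<nu>\<in>X. star i \<nu> = star i \<mu>}"
    using star_eq_iff_partner[OF i _ mu] by (intro Collect_cong) blast
  then show ?thesis using extremal_stars(2)[OF ext, of i "star i \<mu>"] i mu by (simp add: V_iff)
qed

text \<open>The varying rows of a class form exactly the vertex set \<open>S\<close> given by the
  induction, on which all perfect matchings occur. For \<open>h > 0\<close> this set has at least
  four elements, so partners really vary; for \<open>h = 0\<close> a class is a single term.\<close>

lemma class_nonconstant:
  assumes IH: "matching_support p h {\<nu>\<in>X. partner \<nu> i = partner \<mu> i}" and p: "p > 0" and h: "h > 0"
  defines "T \<equiv> {\<nu>\<in>X. partner \<nu> i = partner \<mu> i}"
  defines "N \<equiv> {v\<in>V. \<exists>\<kappa>\<in>T. \<exists>\<nu>\<in>T. partner \<kappa> v \<noteq> partner \<nu> v}"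
  shows "card N = 2*h+2"
    and "\<And>v w. v \<in> N \<Longrightarrow> w \<in> N \<Longrightarrow> v \<noteq> w \<Longrightarrow> \<exists>\<nu>\<in>T. partner \<nu> v = w"
    and "\<And>v w x y. {v,w,x,y} \<subseteq> N \<Longrightarrow> distinct [v,w,x,y] \<Longrightarrow>
      \<exists>\<nu>\<in>T. partner \<nu> v = w \<and> partner \<nu> x = y"
proof -
  from IH[folded T_def, unfolded matching_support_def] obtain \<nu>0 q S e where
    S: "finite S" "card S = 2*h+2" and q: "q = p ^ e"
    and T: "T = (\<lambda>M. \<nu>0 + smul q M) ` perfect_matchings S" by blast
  have q0: "q > 0" using p q by simp
  have ev: "even (card S)" using S(2) by simp
  have TX: "T \<subseteq> X" by (auto simp: T_def)
  have p1: "v \<in> V \<and> partner (\<nu>0 + smul q M) v = w"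
    if M: "M \<in> perfect_matchings S" and e: "edge v w \<in> keys M" for M v w
  proof -
    have X: "\<nu>0 + smul q M \<in> X" using M T TX by blast
    have l: "lookup (\<nu>0 + smul q M) (edge v w) \<noteq> 0"
      using e q0 by (simp add: lookup_add in_keys_iff)
    have "v \<in> V" using lookup_touch_outside[OF _ X edge_touch(1), of v w] l by blast
    then show ?thesis using partnerI[OF _ X l] by blast
  qed
  have NS: "N = S"
  proof
    show "N \<subseteq> S"
    proof (rule subsetI, rule ccontr)
      fix v assume vN: "v \<in> N" and vS: "v \<notin> S"
      have l: "lookup \<nu> (edge v j) = lookup \<nu>0 (edge v j)" if nuT: "\<nu> \<in> T" for \<nu> j
      proof -
        obtain M where M: "M \<in> perfect_matchings S" "\<nu> = \<nu>0 + smul q M" using nuT T by blast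
        have "edge v j \<notin> keys M" using perfect_matchings_touch[OF M(1) _ edge_touch(1)] vS by blast
        then show ?thesis by (simp add: M(2) lookup_add in_keys_iff)
      qed
      have "partner \<nu> v = partner \<nu>0 v" if "\<nu> \<in> T" for \<nu>
        using l[OF that] by (simp add: partner_def)
      then show False using vN by (simp add: N_def)
    qed
    show "S \<subseteq> N"
    proof
      fix v assume v: "v \<in> S"
      have "card (S - {v}) \<ge> 2" using S h v by simp
      then obtain C where "C \<subseteq> S - {v}" "card C = 2" by (rule obtain_subset_with_card_n)
      then obtain w w' where w: "w \<in> S" "w' \<in> S" "w \<noteq> v" "w' \<noteq> v" "w \<noteq> w'"
        by (auto simp: card_2_iff)
      obtain M where M: "M \<in> perfect_matchings S" "edge v w \<in> keys M"
        by (rule perfect_matchings_edge[OF S(1) ev v w(1) w(3)[symmetric]])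
      obtain M' where M': "M' \<in> perfect_matchings S" "edge v w' \<in> keys M'"
        by (rule perfect_matchings_edge[OF S(1) ev v w(2) w(4)[symmetric]])
      have "partner (\<nu>0 + smul q M) v \<noteq> partner (\<nu>0 + smul q M') v" "v \<in> V"
        using p1[OF M] p1[OF M'] w(5) by simp_all
      moreover have "\<nu>0 + smul q M \<in> T" "\<nu>0 + smul q M' \<in> T" using M(1) M'(1) T by blast+
      ultimately show "v \<in> N" unfolding N_def by blast
    qed
  qed
  show "card N = 2*h+2" using NS S(2) by simp
  show "\<exists>\<nu>\<in>T. partner \<nu> v = w" if vw: "v \<in> N" "w \<in> N" "v \<noteq> w" for v w
  proof -
    obtain M where M: "M \<in> perfect_matchings S" "edge v w \<in> keys M"
      using perfect_matchings_edge[OF S(1) ev, of v w] vw NS by blast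
    then show ?thesis using p1[OF M] T by blast
  qed
  show "\<exists>\<nu>\<in>T. partner \<nu> v = w \<and> partner \<nu> x = y" if d: "{v,w,x,y} \<subseteq> N" "distinct [v,w,x,y]" for v w x y
  proof -
    obtain M where M: "M \<in> perfect_matchings S" "edge v w \<in> keys M" "edge x y \<in> keys M"
      using perfect_matchings_two_edges[OF S(1) ev, of v w x y] d NS by blast
    then show ?thesis using p1[OF M(1,2)] p1[OF M(1,3)] T by blast
  qed
qed

text \<open>Three edge-disjoint matchings on at least five vertices: collapsing an edge of the first and a
  disjoint edge of the second kills these two and leaves the third one.\<close>

lemma card_V_0:
  assumes h: "h = 0"
  shows "card V = 4"
proof (rule ccontr)
  assume c4: "card V \<noteq> 4"
  have cX: "card X = 3" using card_X h by (simp add: numeral_3_eq_3)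
  then obtain \<mu>1 \<mu>2 \<mu>3 where X: "X = {\<mu>1, \<mu>2, \<mu>3}" "\<mu>1 \<noteq> \<mu>2" "\<mu>1 \<noteq> \<mu>3" "\<mu>2 \<noteq> \<mu>3"
    by (auto simp: card_3_iff)
  have m: "\<mu>1 \<in> X" "\<mu>2 \<in> X" "\<mu>3 \<in> X" using X by simp_all
  have inj: "\<mu> = \<nu>" if "i \<in> V" "\<mu> \<in> X" "\<nu> \<in> X" "partner \<mu> i = partner \<nu> i" for i \<mu> \<nu>
  proof -
    have "card ((\<lambda>\<mu>. partner \<mu> i) ` X) = card X" using card_partners[OF that(1)] h cX by simp
    then have "inj_on (\<lambda>\<mu>. partner \<mu> i) X" by (rule eq_card_imp_inj_on[OF finite_X])
    from inj_onD[OF this that(4,2,3)] show ?thesis .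
  qed
  obtain i where i: "i \<in> V" using V_nonempty by blast
  let ?P = "(\<lambda>\<mu>. partner \<mu> i) ` X"
  have "i \<notin> ?P" using partner(1)[OF i] by (metis imageE)
  then have "card (insert i ?P) = 4" using card_partners[OF i] h finite_X by simp
  moreover have "?P \<subseteq> V" by (rule image_subsetI) (rule partner(4)[OF i])
  then have "insert i ?P \<subseteq> V" using i by simp
  ultimately have "4 \<le> card V" using card_mono[OF finite_V] by metis
  then have c5: "5 \<le> card V" using c4 by simp
  define j where "j = partner \<mu>1 i"
  define i2 where "i2 = partner \<mu>2 i"
  define j2 where "j2 = partner \<mu>2 j"
  have j: "j \<in> V" "j \<noteq> i" "partner \<mu>1 j = i" using partner[OF i m(1)] by (simp_all add: j_def)
  have "card {i, j, i2, j2} \<le> 4" by (simp add: card_insert_if)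
  then have "\<not> V \<subseteq> {i, j, i2, j2}" using c5 card_mono[of "{i, j, i2, j2}" V] by auto
  \<comment> \<open>A fifth vertex makes the choice possible; avoiding \<open>i2\<close> and
    \<open>j2\<close> keeps the partner \<open>l\<close> of \<open>k\<close> in
    \<open>\<mu>2\<close> away from \<open>i\<close> and \<open>j\<close>.\<close>
  then obtain k where k: "k \<in> V" "k \<noteq> i" "k \<noteq> j" "k \<noteq> i2" "k \<noteq> j2" by blast
  define l where "l = partner \<mu>2 k"
  have l: "l \<in> V" "l \<noteq> k" "partner \<mu>2 l = k" using partner[OF k(1) m(2)] by (simp_all add: l_def)
  have lij: "l \<noteq> i" "l \<noteq> j" using l(3) k(4,5) by (auto simp: i2_def j2_def)
  obtain g0 :: "nat \<Rightarrow> 'a" where g0: "inj g0"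
    using infinite_countable_subset[OF infinite_UNIV] by blast
  define rep where "rep x = (if x = j then i else if x = l then k else x)" for x
  obtain b where b: "\<And>v. edge_val (Suc h) b v = g0 (rep (snd v)) - g0 (rep (fst v))"
    using exists_plane_points[OF zero_less_Suc, of h "\<lambda>x. g0 (rep x)"] by blast
  have b0: "edge_val (Suc h) b (edge x y) = 0 \<longleftrightarrow> rep x = rep y" for x y
    using g0 unfolding b edge_def by (cases "x \<le> y") (auto simp: min_def max_def dest: injD)
  have mval0: "mval {} (Suc h) b \<mu> = 0"
    if "x \<in> V" "\<mu> \<in> X" "rep x = rep (partner \<mu> x)" for x \<mu>
  proof -
    have ed: "edge x (partner \<mu> x) \<in> keys \<mu>" using partner(2,3)[OF that(1,2)] by (simp add: in_keys_iff)
    have z: "edge_val (Suc h) b (edge x (partner \<mu> x)) = 0" using b0 that(3) by blast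
    have "edge_val (Suc h) b (edge x (partner \<mu> x)) ^ lookup \<mu> (edge x (partner \<mu> x)) = 0"
      unfolding z using partner(2,3)[OF that(1,2)] by simp
    then show ?thesis unfolding mval_def using ed by (intro prod_zero) auto
  qed
  have z1: "mval {} (Suc h) b \<mu>1 = 0" by (rule mval0[OF i m(1)]) (simp add: rep_def j_def[symmetric] lij lij[symmetric] j)
  have z2: "mval {} (Suc h) b \<mu>2 = 0"
    by (rule mval0[OF k(1) m(2)]) (use k lij(1)[symmetric] lij l(2) in \<open>simp add: rep_def l_def[symmetric]\<close>)
  have "edge_val (Suc h) b v \<noteq> 0" if v: "v \<in> keys \<mu>3" for v
  proof
    assume z: "edge_val (Suc h) b v = 0"
    define x where "x = fst v"
    define y where "y = snd v"
    have "fst v < snd v" using edge_mons_X v m(3) by (simp add: edge_mons_def)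
    then have vxy: "v = edge x y" "x \<noteq> y" using edge_fst_snd by (simp_all add: x_def y_def)
    have l3: "lookup \<mu>3 (edge x y) \<noteq> 0" "lookup \<mu>3 (edge y x) \<noteq> 0"
      using v vxy(1) by (simp_all add: in_keys_iff edge_commute)
    have xV: "x \<in> V" "y \<in> V"
      using touch_in_V[OF m(3) edge_touch(1)] l3 by simp_all
    have px: "partner \<mu>3 x = y" "partner \<mu>3 y = x" using partnerI[OF _ m(3)] xV l3 by blast+
    have rep: "rep x = rep y" using z b0 vxy(1) by simp
    have "(x = i \<and> y = j) \<or> (x = j \<and> y = i) \<or> (x = k \<and> y = l) \<or> (x = l \<and> y = k)"
      using rep vxy(2) k(2,3) lij l(2) j(2) unfolding rep_def by metis
    \<comment> \<open>A vanishing edge of \<open>\<mu>3\<close> would be one of the two collapsed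
      edges, but at each vertex of \<open>V\<close> the three partners are distinct.\<close>
    then have "partner \<mu>3 x = partner \<mu>1 x \<or> partner \<mu>3 x = partner \<mu>2 x"
      using px j(3) l(3) by (auto simp: j_def l_def)
    then show False using inj[OF xV(1) m(3) m(1)] inj[OF xV(1) m(3) m(2)] X by blast
  qed
  then have "mval {} (Suc h) b \<mu>3 \<noteq> 0" unfolding mval_def by (subst prod_zero_iff) auto
  moreover have "(\<Sum>\<mu>\<in>X. c \<mu> * mval {} (Suc h) b \<mu>) = 0" using vanishes_X by (simp add: vanishes_def)
  then have "c \<mu>3 * mval {} (Suc h) b \<mu>3 = 0" using X z1 z2 by simp
  ultimately show False using coeff_X[OF m(3)] by simp
qed

lemma card_V:
  assumes IH: "\<And>Y. extremal h c Y \<Longrightarrow> matching_support p h Y" and p: "p > 0"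
  shows "card V = 2*h+4"
proof (cases "h = 0")
  case True
  then show ?thesis using card_V_0 by simp
next
  case False
  then have h: "h > 0" by simp
  have "card V = (2*h+2) + 2"
  \<comment> \<open>\<open>N\<close> is the number of terms of a star class, and
    \<open>2*h+2\<close> the size of the vertex set found by induction in each class.\<close>
  proof (rule matching_family_card[where P = partner and N = "dfact (2*h+1)"])
    show "finite X" "finite V" "X \<noteq> {}" "V \<noteq> {}" "4 \<le> 2*h+2"
      using finite_X finite_V X_nonempty V_nonempty h by simp_all
    fix i \<mu> assume i: "i \<in> V" and mu: "\<mu> \<in> X"
    show "partner \<mu> i \<in> V \<and> partner \<mu> i \<noteq> i \<and> partner \<mu> (partner \<mu> i) = i"
      using partner[OF i mu] by simp
    show "card {\<nu>\<in>X. partner \<nu> i = partner \<mu> i} = dfact (2*h+1)"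
      using extremal_class[OF i mu] by (simp add: extremal_def)
    note cl = class_nonconstant[OF IH[OF extremal_class[OF i mu]] p h]
    show "card {v\<in>V. \<exists>\<kappa>\<in>{\<nu>\<in>X. partner \<nu> i = partner \<mu> i}. \<exists>\<nu>\<in>{\<nu>\<in>X. partner \<nu> i = partner \<mu> i}.
       partner \<kappa> v \<noteq> partner \<nu> v} = 2*h+2" by (rule cl(1))
    show "\<exists>\<nu>\<in>{\<nu>\<in>X. partner \<nu> i = partner \<mu> i}. partner \<nu> v = w"
      if "v \<in> {v\<in>V. \<exists>\<kappa>\<in>{\<nu>\<in>X. partner \<nu> i = partner \<mu> i}. \<exists>\<nu>\<in>{\<nu>\<in>X. partner \<nu> i = partner \<mu> i}.
          partner \<kappa> v \<noteq> partner \<nu> v}"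
        "w \<in> {v\<in>V. \<exists>\<kappa>\<in>{\<nu>\<in>X. partner \<nu> i = partner \<mu> i}. \<exists>\<nu>\<in>{\<nu>\<in>X. partner \<nu> i = partner \<mu> i}.
          partner \<kappa> v \<noteq> partner \<nu> v}" "v \<noteq> w" for v w
      by (rule cl(2)[OF that])
    show "\<exists>\<nu>\<in>{\<nu>\<in>X. partner \<nu> i = partner \<mu> i}. partner \<nu> v = w \<and> partner \<nu> x = y"
      if "{v,w,x,y} \<subseteq> {v\<in>V. \<exists>\<kappa>\<in>{\<nu>\<in>X. partner \<nu> i = partner \<mu> i}. \<exists>\<nu>\<in>{\<nu>\<in>X. partner \<nu> i = partner \<mu> i}.
          partner \<kappa> v \<noteq> partner \<nu> v}" "distinct [v,w,x,y]" for v w x y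
      by (rule cl(3)[OF that])
  next
    fix i assume "i \<in> V"
    then show "card ((\<lambda>\<mu>. partner \<mu> i) ` X) = 2*h+2 + 1" using card_partners by simp
  qed
  then show ?thesis by simp
qed

text \<open>With \<open>2*h+4\<close> rows and \<open>2*h+3\<close> partners for each, every two
  rows are joined in some term; as partners have equal degree, all degrees are one number
  \<open>q\<close>. Each term is then \<open>q\<close> times a perfect matching, and both sides
  count \<open>dfact (2*h+3)\<close>.\<close>

lemma reduced_support:
  assumes IH: "\<And>Y. extremal h c Y \<Longrightarrow> matching_support (char_exp TYPE('a)) h Y"
  shows "matching_support (char_exp TYPE('a)) (Suc h) X"
proof -
  have cV: "card V = 2*h+4" by (rule card_V[OF IH char_exp_pos])
  have all: "(\<lambda>\<mu>. partner \<mu> i) ` X = V - {i}" if i: "i \<in> V" for i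
  proof (rule card_subset_eq)
    show "finite (V - {i})" using finite_V by simp
    show "(\<lambda>\<mu>. partner \<mu> i) ` X \<subseteq> V - {i}" 
      by (rule image_subsetI) (simp add: partner(1,4)[OF i])
    show "card ((\<lambda>\<mu>. partner \<mu> i) ` X) = card (V - {i})" using card_partners[OF i] cV i by simp
  qed
  obtain i0 where i0: "i0 \<in> V" using V_nonempty by blast
  obtain \<mu>0 where mu0: "\<mu>0 \<in> X" using X_nonempty by blast
  define q where "q = d i0"
  have dq: "d i = q" if i: "i \<in> V" for i
  proof (cases "i = i0")
    case False
    then have "i \<in> (\<lambda>\<mu>. partner \<mu> i0) ` X" using all[OF i0] i by blast
    then obtain \<mu> where "\<mu> \<in> X" "i = partner \<mu> i0" by blast
    then show ?thesis using partner(6)[OF i0] by (simp add: q_def)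
  qed (simp add: q_def)
  have q0: "q > 0" using partner(3)[OF i0 mu0] by (simp add: q_def)
  have qe: "\<exists>e. q = char_exp TYPE('a) ^ e"
    using extremal_star_deg[OF ext red _ mu0, of i0] i0 star_deg_eq[OF mu0, of i0] by (simp add: V_iff q_def)
  have sub: "X \<subseteq> smul q ` perfect_matchings V"
  proof
    fix \<mu> assume mu: "\<mu> \<in> X"
    define M :: mono where "M = Poly_Mapping.map (\<lambda>k. if k = 0 then 0 else 1) \<mu>"
    have lM: "lookup M v = (if lookup \<mu> v = 0 then 0 else 1)" for v
      by (simp add: M_def Poly_Mapping.map.rep_eq when_def)
    have kM: "keys M = keys \<mu>" by (rule Set.set_eqI) (simp add: in_keys_iff lM)
    have ends: "fst v < snd v" "fst v \<in> V" "snd v \<in> V" "lookup \<mu> v = q" if v: "v \<in> keys \<mu>" for v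
    proof -
      show lt: "fst v < snd v" using edge_mons_X mu v by (simp add: edge_mons_def)
      have l: "lookup \<mu> v \<noteq> 0" using v by (simp add: in_keys_iff)
      have t: "v \<in> touch (fst v)" "v \<in> touch (snd v)" by (simp_all add: touch_def)
      show V: "fst v \<in> V" "snd v \<in> V" using touch_in_V[OF mu] t l by simp_all
      have e: "edge (fst v) (snd v) = v" by (rule edge_fst_snd[OF lt])
      have "partner \<mu> (fst v) = snd v" using l e by (intro partnerI[OF V(1) mu]) simp
      then show "lookup \<mu> v = q" using partner(2)[OF V(1) mu] e dq[OF V(1)] by simp
    qed
    have "\<mu> = smul q M"
    proof (rule poly_mapping_eqI)
      fix v
      show "lookup \<mu> v = lookup (smul q M) v"
        using ends(4)[of v] by (cases "v \<in> keys \<mu>") (simp_all add: lM in_keys_iff)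
    qed
    moreover have "M \<in> perfect_matchings V"
    proof -
      have "\<exists>!v. v \<in> keys M \<and> v \<in> touch i" if i: "i \<in> V" for i
      proof -
        obtain v where v: "v \<in> touch i" "lookup \<mu> v = d i" "d i > 0"
          "\<forall>w\<in>touch i. lookup \<mu> w \<noteq> 0 \<longrightarrow> w = v"
          by (rule star_edge[OF i mu])
        show ?thesis
        proof (rule ex1I[of _ v])
          show "v \<in> keys M \<and> v \<in> touch i" using v(1-3) kM by (simp add: in_keys_iff)
          show "w = v" if "w \<in> keys M \<and> w \<in> touch i" for w
            using that kM by (intro v(4)[rule_format]) (simp_all add: in_keys_iff)
        qed
      qed
      moreover have "fst v < snd v \<and> fst v \<in> V \<and> snd v \<in> V \<and> lookup M v = 1" if "v \<in> keys M" for v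
        using ends[of v] that q0 by (simp add: kM lM)
      ultimately show ?thesis unfolding perfect_matchings_def by blast
    qed
    ultimately show "\<mu> \<in> smul q ` perfect_matchings V" by blast
  qed
  have "2*(h+2) - 1 = 2*h+3" "card V = 2*(h+2)" using cV by simp_all
  then have PM: "finite (perfect_matchings V)" "card (perfect_matchings V) = card X"
    using card_perfect_matchings[OF finite_V, of "h+2"] card_X by metis+
  have "card (smul q ` perfect_matchings V) \<le> card X"
    using card_image_le[OF PM(1), of "smul q"] PM(2) by simp
  from card_seteq[OF finite_imageI[OF PM(1)] sub this] have "X = smul q ` perfect_matchings V" .
  then have X0: "X = (\<lambda>M. 0 + smul q M) ` perfect_matchings V" by simp
  show ?thesis unfolding matching_support_def
  proof (intro exI conjI)
    show "X = (\<lambda>M. 0 + smul q M) ` perfect_matchings V" by (rule X0)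
    show "finite V" by (rule finite_V)
    show "card V = 2 * Suc h + 2" using cV by simp
    from qe show "q = char_exp TYPE('a) ^ (SOME e. q = char_exp TYPE('a) ^ e)" by (rule someI_ex)
  qed
qed

end

section \<open>Common factors and the induction on the rank\<close>

lemma vanishes_cancel:
  fixes c :: "mono \<Rightarrow> 'a::{field,infinite}"
  assumes h: "h > 0" and nu: "edge_mons {\<nu>}" and van: "vanishes h c ((\<lambda>\<mu>. \<nu> + \<mu>) ` X)"
  shows "vanishes h (\<lambda>\<mu>. c (\<nu> + \<mu>)) X"
  unfolding vanishes_def
proof
  fix b0 :: "nat \<Rightarrow> nat \<Rightarrow> 'a"
  obtain b1 :: "nat \<Rightarrow> nat \<Rightarrow> 'a" where b1: "\<forall>v. fst v \<noteq> snd v \<longrightarrow> edge_val h b1 v \<noteq> 0"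
    using exists_generic_points[OF h] by blast
  \<comment> \<open>The line from \<open>b0\<close> to a point where the common factor
    \<open>\<nu>\<close> is nonzero.\<close>
  define B where "B t j k = (1 - t) * b0 j k + t * b1 j k" for t j k
  have pB: "polyfun (\<lambda>t. B t j k)" for j k unfolding B_def by (intro polyfun_intros)
  define f where "f t = mval {} h (B t) \<nu>" for t
  define g where "g t = (\<Sum>\<mu>\<in>X. c (\<nu> + \<mu>) * mval {} h (B t) \<mu>)" for t
  have "f t * g t = 0" for t
  proof -
    have "f t * g t = (\<Sum>\<mu>\<in>X. c (\<nu> + \<mu>) * mval {} h (B t) (\<nu> + \<mu>))"
      unfolding f_def g_def sum_distrib_left by (simp add: mval_add mult_ac)
    also have "\<dots> = (\<Sum>\<mu>\<in>(\<lambda>\<mu>. \<nu> + \<mu>) ` X. c \<mu> * mval {} h (B t) \<mu>)"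
      by (subst sum.reindex) (auto simp: inj_on_def)
    also have "\<dots> = 0" using van by (simp add: vanishes_def)
    finally show ?thesis .
  qed
  moreover have "polyfun f" "polyfun g" unfolding f_def g_def by (intro polyfun_intros pB)+
  moreover have "f 1 \<noteq> 0"
  proof -
    have "B 1 = b1" by (simp add: B_def fun_eq_iff)
    then show ?thesis unfolding f_def mval_def using b1 nu by (subst prod_zero_iff) (auto simp: edge_mons_def)
  qed
  ultimately have "g 0 = 0" using polyfun_mult_eq_0[of f g 1 0] by blast
  moreover have "B 0 = b0" by (simp add: B_def fun_eq_iff)
  ultimately show "(\<Sum>\<mu>\<in>X. c (\<nu> + \<mu>) * mval {} h b0 \<mu>) = 0" by (simp add: g_def)
qed

lemma exists_monomial_gcd:
  assumes fin: "finite X" and ne: "X \<noteq> {}"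
  obtains \<nu> Y where "X = (\<lambda>\<mu>. \<nu> + \<mu>) ` Y" "reduced Y"
proof -
  define f where "f v = Min ((\<lambda>\<mu>. lookup \<mu> v) ` X)" for v
  obtain \<mu>0 where mu0: "\<mu>0 \<in> X" using ne by blast
  have le: "f v \<le> lookup \<mu> v" if "\<mu> \<in> X" for \<mu> v unfolding f_def using that fin by simp
  have att: "\<exists>\<mu>\<in>X. lookup \<mu> v = f v" for v
  proof -
    have "f v \<in> (\<lambda>\<mu>. lookup \<mu> v) ` X" unfolding f_def using fin ne by (intro Min_in) auto
    then show ?thesis by auto
  qed
  have "{v. f v \<noteq> 0} \<subseteq> keys \<mu>0"
  proof
    fix v assume "v \<in> {v. f v \<noteq> 0}"
    then show "v \<in> keys \<mu>0" using le[OF mu0, of v] by (simp add: in_keys_iff)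
  qed
  then have ff: "finite {v. f v \<noteq> 0}" by (rule finite_subset) simp
  define \<nu> where "\<nu> = Abs_poly_mapping f"
  have l: "lookup \<nu> = f" unfolding \<nu>_def by (rule lookup_Abs_poly_mapping[OF ff])
  have eq: "\<nu> + (\<mu> - \<nu>) = \<mu>" if "\<mu> \<in> X" for \<mu>
    by (rule poly_mapping_eqI) (simp add: lookup_add lookup_minus l le[OF that])
  define Y where "Y = (\<lambda>\<mu>. \<mu> - \<nu>) ` X"
  have "(\<lambda>\<mu>. \<nu> + \<mu>) ` Y = X" unfolding Y_def image_image using eq by simp
  moreover have "reduced Y"
    unfolding reduced_def
  proof
    fix v
    obtain \<mu> where mu: "\<mu> \<in> X" "lookup \<mu> v = f v" using att by blast
    have "\<mu> - \<nu> \<in> Y" unfolding Y_def using mu(1) by blast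
    moreover have "lookup (\<mu> - \<nu>) v = 0" using mu(2) by (simp add: lookup_minus l)
    ultimately show "\<exists>\<mu>\<in>Y. lookup \<mu> v = 0" by blast
  qed
  ultimately show ?thesis using that by metis
qed

theorem extremal_matching_support:
  fixes c :: "mono \<Rightarrow> 'a::{field,infinite}"
  assumes "extremal h c X"
  shows "matching_support (char_exp TYPE('a)) h X"
  using assms
proof (induction h arbitrary: c X)
  case 0
  then have X: "finite X" "edge_mons X" "vanishes 0 c X" "card X = 1" "\<And>\<mu>. \<mu> \<in> X \<Longrightarrow> c \<mu> \<noteq> 0"
    by (auto simp: extremal_def)
  then obtain \<mu> where mu: "X = {\<mu>}" by (auto simp: card_1_singleton_iff)
  \<comment> \<open>At \<open>h = 0\<close> every entry is 0, so vanishing of the single term means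
    that it is not constant; any of its variables is then a matching of two rows, with
    \<open>q = 1\<close> and the rest of the monomial as common factor.\<close>
  have "keys \<mu> \<noteq> {}"
  proof
    assume "keys \<mu> = {}"
    then have "c \<mu> = 0" using X(3) by (simp add: mu vanishes_def mval_def)
    then show False using X(5) mu by simp
  qed
  then obtain v where v: "v \<in> keys \<mu>" by blast
  then have lt: "fst v < snd v" using X(2) by (simp add: mu edge_mons_def)
  let ?S = "{fst v, snd v}"
  let ?e = "Poly_Mapping.single v (1::nat)"
  have "edge (fst v) (snd v) = v" by (rule edge_fst_snd[OF lt])
  then have e: "?e \<in> perfect_matchings ?S"
    using perfect_matchings_insert[of 0 ?S "fst v" "snd v"] lt by (simp add: perfect_matchings_empty)
  have "card ?S = 2 * 1" using lt by simp
  from card_perfect_matchings[OF _ this] have "card (perfect_matchings ?S) = 1" by simp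
  then have PM: "perfect_matchings ?S = {?e}" using e by (auto simp: card_1_singleton_iff)
  have "(\<mu> - ?e) + smul 1 ?e = \<mu>"
  proof (rule poly_mapping_eqI)
    fix w
    show "lookup ((\<mu> - ?e) + smul 1 ?e) w = lookup \<mu> w"
      using v by (cases "w = v") (simp_all add: lookup_add lookup_minus lookup_single when_def in_keys_iff)
  qed
  then have "X = (\<lambda>M. (\<mu> - ?e) + smul 1 M) ` perfect_matchings ?S" by (simp add: PM mu)
  then show ?case unfolding matching_support_def using lt
    by (intro exI[of _ "\<mu> - ?e"] exI[of _ 1] exI[of _ ?S]) (auto intro!: exI[of _ 0])
next
  case (Suc h)
  have X: "finite X" "edge_mons X" "vanishes (Suc h) c X" "card X = dfact (2*Suc h+1)"
    "\<And>\<mu>. \<mu> \<in> X \<Longrightarrow> c \<mu> \<noteq> 0"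
    using Suc.prems by (auto simp: extremal_def)
  have "X \<noteq> {}" using X(4) dfact_pos[of "2*Suc h+1"] by (metis card.empty less_irrefl)
  with X(1) obtain \<nu> Y where Y: "X = (\<lambda>\<mu>. \<nu> + \<mu>) ` Y" "reduced Y" by (rule exists_monomial_gcd)
  have inj: "inj_on (\<lambda>\<mu>. \<nu> + \<mu>) Y" by (simp add: inj_on_def)
  have "Y \<noteq> {}" using \<open>X \<noteq> {}\<close> Y(1) by blast
  then obtain \<mu>0 where mu0: "\<mu>0 \<in> Y" by blast
  then have "\<nu> + \<mu>0 \<in> X" using Y(1) by blast
  then have nu: "edge_mons {\<nu>}" using X(2) by (simp add: edge_mons_def keys_add_mono)
  have eY: "edge_mons Y"
    using X(2) unfolding Y(1) edge_mons_def by (simp add: keys_add_mono)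
  have "vanishes (Suc h) (\<lambda>\<mu>. c (\<nu> + \<mu>)) Y"
    using X(3) unfolding Y(1) by (rule vanishes_cancel[OF zero_less_Suc nu])
  moreover have "finite Y" using X(1) inj unfolding Y(1) by (simp add: finite_image_iff)
  moreover have "card Y = dfact (2*Suc h+1)" using X(4) inj unfolding Y(1) by (simp add: card_image)
  ultimately have "extremal (Suc h) (\<lambda>\<mu>. c (\<nu> + \<mu>)) Y"
    using X(5) eY unfolding extremal_def Y(1) by simp
  then interpret reduced_extremal h "\<lambda>\<mu>. c (\<nu> + \<mu>)" Y using Y(2) by unfold_locales
  have "matching_support (char_exp TYPE('a)) (Suc h) Y" by (rule reduced_support[OF Suc.IH])
  then obtain \<nu>' q S e where S: "finite S" "card S = 2*Suc h+2" "q = char_exp TYPE('a) ^ e"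
    "Y = (\<lambda>M. \<nu>' + smul q M) ` perfect_matchings S" unfolding matching_support_def by blast
  have "X = (\<lambda>M. (\<nu> + \<nu>') + smul q M) ` perfect_matchings S"
    unfolding Y(1) S(4) image_image by (simp add: add.assoc)
  then show ?case unfolding matching_support_def using S(1-3) by blast
qed

section \<open>Coefficients of extremal sums\<close>


definition matching_of :: "nat \<Rightarrow> (nat \<Rightarrow> nat) \<Rightarrow> mono" where
  "matching_of n t = (\<Sum>k<n. Poly_Mapping.single (edge (t (2*k)) (t (2*k+1))) 1)"

text \<open>The sign by which the product of the entries at \<open>(t (2*k), t (2*k+1))\<close>
  differs from the monomial in variables with increasing indices. Coefficients multiplied by it
  become alternating in the labels.\<close>

definition orientation :: "nat \<Rightarrow> (nat \<Rightarrow> nat) \<Rightarrow> 'a::comm_ring_1" where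
  "orientation n t = (\<Prod>k<n. if t (2*k) < t (2*k+1) then 1 else - 1)"

lemma matching_of_Suc:
  "matching_of (Suc n) t = Poly_Mapping.single (edge (t (2*n)) (t (2*n+1))) 1 + matching_of n t"
  by (simp add: matching_of_def add.commute)

lemma matching_of_perfect:
  assumes "inj_on t {..<2*n}"
  shows "matching_of n t \<in> perfect_matchings (t ` {..<2*n})"
  using assms
proof (induction n)
  case 0
  then show ?case by (simp add: matching_of_def perfect_matchings_empty)
next
  case (Suc n)
  let ?S = "t ` {..<2 * Suc n}"
  have I: "{..<2 * Suc n} = insert (2*n) (insert (2*n+1) {..<2*n})" by auto
  have inj: "inj_on t (insert (2*n) (insert (2*n+1) {..<2*n}))" using Suc.prems unfolding I .
  have "t (2*n) \<notin> t ` {..<2*n}" "t (2*n+1) \<notin> t ` {..<2*n}" "t (2*n) \<noteq> t (2*n+1)"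
    using inj by (auto simp: inj_on_def)
  then have "?S - {t (2*n), t (2*n+1)} = t ` {..<2*n}" unfolding I by auto
  moreover have "inj_on t {..<2*n}" by (rule inj_on_subset[OF inj]) auto
  ultimately have "matching_of n t \<in> perfect_matchings (?S - {t (2*n), t (2*n+1)})"
    using Suc.IH by simp
  from perfect_matchings_insert[OF this] \<open>t (2*n) \<noteq> t (2*n+1)\<close>
  show ?case unfolding matching_of_Suc I by simp
qed

lemma keys_matching_of: "keys (matching_of n t) = (\<lambda>k. edge (t (2*k)) (t (2*k+1))) ` {..<n}"
  by (induction n) (simp_all add: matching_of_Suc keys_add_mono lessThan_Suc, simp add: matching_of_def)

lemma mval_single: "mval {} h b (Poly_Mapping.single v 1) = edge_val h b v"
  by (simp add: mval_def)

lemma mval_matching_of: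
  "mval {} h b (matching_of n t) = (\<Prod>k<n. edge_val h b (edge (t (2*k)) (t (2*k+1))))"
proof (induction n)
  case 0
  then show ?case by (simp add: matching_of_def mval_def)
next
  case (Suc n)
  then show ?case unfolding matching_of_Suc mval_add mval_single by (simp add: mult.commute)
qed

lemma edge_val_edge:
  "edge_val h b (edge x y) = (if x < y then 1 else - 1) * sform h (b x) (b y)"
  using sform_swap[of h "b x" "b y"] by (auto simp: edge_val_def edge_def min_def max_def)

lemma mval_matching_of_orientation:
  "mval {} h b (matching_of n t) = orientation n t * (\<Prod>k<n. sform h (b (t (2*k))) (b (t (2*k+1))))"
  by (simp add: mval_matching_of edge_val_edge orientation_def prod.distrib)

lemma mval_smul: "q > 0 \<Longrightarrow> mval {} h b (smul q \<mu>) = mval {} h b \<mu> ^ q"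
proof -
  assume q: "q > 0"
  have "keys (smul q \<mu>) = keys \<mu>" using q by (intro Set.set_eqI) (simp add: in_keys_iff)
  then show ?thesis by (simp add: mval_def prod_power_distrib mult.commute flip: power_mult)
qed

text \<open>Freshman's dream applied to \<open>(1 + (- 1)) ^ q = 0\<close> treats characteristic 2
  together with the odd ones; in characteristic 0 the exponent is 1.\<close>

lemma neg_one_power_char_exp:
  assumes "q = char_exp TYPE('a::field) ^ e"
  shows "(- 1 :: 'a) ^ q = - 1"
proof (cases "CHAR('a) = 0")
  case True
  then show ?thesis using assms by (simp add: char_exp_def)
next
  case False
  then have p: "prime CHAR('a)" using prime_CHAR_semidom[where ?'a = 'a] by simp
  have q: "q = CHAR('a) ^ e" using assms False by (simp add: char_exp_def)
  have "q > 0" using p q by (simp add: prime_gt_0_nat)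
  have "(1 + (- 1) :: 'a) ^ q = 1 ^ q + (- 1) ^ q" by (rule freshmans_dream'[OF p q])
  moreover have "(1 + (- 1) :: 'a) ^ q = 0" using \<open>q > 0\<close> by (simp add: zero_power)
  ultimately have "1 + (- 1 :: 'a) ^ q = 0" by simp
  then show ?thesis by (simp add: add_eq_0_iff)
qed

lemma orientation_cases: "orientation n t = (1::'a::comm_ring_1) \<or> orientation n t = (- 1 :: 'a)"
  unfolding orientation_def by (induction n) auto

lemma perfect_matchings_eqI:
  assumes M: "M \<in> perfect_matchings S" and N: "N \<in> perfect_matchings S" and sub: "keys M \<subseteq> keys N"
  shows "M = N"
proof -
  have "keys N \<subseteq> keys M"
  proof
    fix v assume v: "v \<in> keys N"
    have S: "fst v \<in> S" using perfect_matchingsD(2)[OF N v] .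
    obtain w where w: "w \<in> keys M" "w \<in> touch (fst v)" by (rule perfect_matchings_ex[OF M S])
    have "v \<in> touch (fst v)" by (simp add: touch_def)
    then have "v = w" using perfect_matchings_unique[OF N S v _ _ w(2)] w(1) sub by blast
    then show "v \<in> keys M" using w(1) by simp
  qed
  then have "keys M = keys N" using sub by simp
  then show ?thesis
    by (intro poly_mapping_eqI) (simp add: perfect_matchings_lookup[OF M] perfect_matchings_lookup[OF N])
qed

definition mate :: "nat \<Rightarrow> nat" where
  "mate i = (if even i then i + 1 else i - 1)"

lemma mate_props: "mate i div 2 = i div 2" "mate i \<noteq> i" "mate (mate i) = i"
  by (auto simp: mate_def elim!: evenE oddE)

lemma same_pair: "j div 2 = i div 2 \<Longrightarrow> j = i \<or> j = mate i"
  unfolding mate_def by presburger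

lemma mate_less: "i < 2*n \<Longrightarrow> mate i < 2*n"
  unfolding mate_def by presburger

lemma mate_double [simp]: "mate (2*k) = Suc (2*k)" "mate (Suc (2*k)) = 2*k"
  by (simp_all add: mate_def)

lemma keys_matching_of_mate:
  assumes "i < 2*n"
  shows "edge (t i) (t (mate i)) \<in> keys (matching_of n t)"
proof -
  have k: "i div 2 < n" using assms by simp
  have "edge (t i) (t (mate i)) = edge (t (2*(i div 2))) (t (2*(i div 2)+1))"
  proof (cases "even i")
    case True
    then have "2*(i div 2) = i" by simp
    then show ?thesis using True by (simp add: mate_def)
  next
    case False
    then have "i = Suc (2*(i div 2))" by presburger
    then have "mate i = 2*(i div 2)" "2*(i div 2)+1 = i" by (metis mate_double(2), simp)
    then show ?thesis by (simp add: edge_commute)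
  qed
  then show ?thesis unfolding keys_matching_of using k by blast
qed

lemma matching_of_eqI:
  assumes t: "bij_betw t {..<2*n} S" and M: "M \<in> perfect_matchings S"
    and e: "\<And>i. i < 2*n \<Longrightarrow> edge (t i) (t (mate i)) \<in> keys M"
  shows "M = matching_of n t"
proof -
  have "matching_of n t \<in> perfect_matchings S"
    using matching_of_perfect[of t n] t by (simp add: bij_betw_def)
  moreover have "keys (matching_of n t) \<subseteq> keys M"
  proof
    fix v assume "v \<in> keys (matching_of n t)"
    then obtain k where "k < n" "v = edge (t (2*k)) (t (2*k+1))" unfolding keys_matching_of by blast
    then show "v \<in> keys M" using e[of "2*k"] by simp
  qed
  ultimately show ?thesis using perfect_matchings_eqI M by blast
qed

lemma sform_unit:
  assumes "A < h" "B < h" "\<alpha> < 2" "\<beta> < 2"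
  shows "sform h (\<lambda>m. if m = 2*A+\<alpha> then 1 else 0) (\<lambda>m. if m = 2*B+\<beta> then 1 else 0) =
    (if A = B then if \<alpha> < \<beta> then 1 else if \<beta> < \<alpha> then - 1 else 0 else 0 :: 'a::comm_ring_1)"
proof -
  have a: "\<alpha> = 0 \<or> \<alpha> = 1" and b: "\<beta> = 0 \<or> \<beta> = 1" using assms by auto
  have ne: "2 * i \<noteq> Suc (2 * l)" "Suc (2 * l) \<noteq> 2 * i" for i l :: nat by presburger+
  have "sform h (\<lambda>m. if m = 2*A+\<alpha> then 1 else 0) (\<lambda>m. if m = 2*B+\<beta> then 1 else 0) =
    (\<Sum>k<h. if k = A then (if A = B then if \<alpha> < \<beta> then 1 else if \<beta> < \<alpha> then - 1 else 0 else 0 :: 'a) else 0)"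
    unfolding sform_def using a b ne by (intro sum.cong) auto
  then show ?thesis using assms(1) by simp
qed

lemma orientation_swap_pair:
  assumes "inj_on t {..<2*n}" "k < n"
  shows "orientation n (t \<circ> Transposition.transpose (2*k) (2*k+1)) = - (orientation n t :: 'a::comm_ring_1)"
    and "matching_of n (t \<circ> Transposition.transpose (2*k) (2*k+1)) = matching_of n t"
proof -
  let ?t = "t \<circ> Transposition.transpose (2*k) (2*k+1)"
  have off: "?t (2*j) = t (2*j)" "?t (2*j+1) = t (2*j+1)" if "j \<noteq> k" for j
  proof -
    have "2*j \<noteq> 2*k" "2*j \<noteq> 2*k+1" "2*j+1 \<noteq> 2*k" "2*j+1 \<noteq> 2*k+1" using that by presburger+
    then show "?t (2*j) = t (2*j)" "?t (2*j+1) = t (2*j+1)" by (simp_all add: Transposition.transpose_def)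
  qed
  have on: "?t (2*k) = t (2*k+1)" "?t (2*k+1) = t (2*k)" by simp_all
  have "t (2*k) \<noteq> t (2*k+1)" using inj_onD[OF assms(1), of "2*k" "2*k+1"] assms(2) by auto
  then have f: "(if ?t (2*k) < ?t (2*k+1) then 1 else - 1 :: 'a) = - (if t (2*k) < t (2*k+1) then 1 else - 1)"
    unfolding on by auto
  have r: "(\<Prod>j\<in>{..<n} - {k}. if ?t (2*j) < ?t (2*j+1) then 1 else - 1 :: 'a) =
     (\<Prod>j\<in>{..<n} - {k}. if t (2*j) < t (2*j+1) then 1 else - 1)"
    using off by (intro prod.cong) auto
  have "orientation n ?t = (if ?t (2*k) < ?t (2*k+1) then 1 else - 1 :: 'a) *
     (\<Prod>j\<in>{..<n} - {k}. if ?t (2*j) < ?t (2*j+1) then 1 else - 1)"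
    unfolding orientation_def using assms(2) by (intro prod.remove) auto
  also have "\<dots> = - ((if t (2*k) < t (2*k+1) then 1 else - 1) *
     (\<Prod>j\<in>{..<n} - {k}. if t (2*j) < t (2*j+1) then 1 else - 1))" unfolding f r by simp
  also have "(if t (2*k) < t (2*k+1) then 1 else - 1 :: 'a) *
     (\<Prod>j\<in>{..<n} - {k}. if t (2*j) < t (2*j+1) then 1 else - 1) = orientation n t"
    unfolding orientation_def using assms(2) by (intro prod.remove[symmetric]) auto
  finally show "orientation n ?t = - (orientation n t :: 'a)" .
  show "matching_of n ?t = matching_of n t"
    unfolding matching_of_def
  proof (rule sum.cong[OF refl])
    fix j
    have "edge (?t (2*j)) (?t (2*j+1)) = edge (t (2*j)) (t (2*j+1))"
      using off[of j] on by (cases "j = k") (simp_all only: edge_commute, simp_all)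
    then show "Poly_Mapping.single (edge (?t (2*j)) (?t (2*j+1))) (1::nat) =
       Poly_Mapping.single (edge (t (2*j)) (t (2*j+1))) 1" by simp
  qed
qed

text \<open>The coefficients are antisymmetric: place two of the \<open>h + 1\<close> pairs of a labelled matching in
  one common symplectic plane and every other pair in a plane of its own.  Only the matching itself
  and the one with two labels exchanged survive.\<close>

lemma coeff_swap:
  fixes c :: "mono \<Rightarrow> 'a::{field,infinite}"
  assumes n: "n = Suc h" and t: "bij_betw t {..<2*n} S" and q: "q = char_exp TYPE('a) ^ e"
    and van: "h > 0 \<Longrightarrow> vanishes h c (smul q ` perfect_matchings S)"
    and xy: "x < 2*n" "y < 2*n" "x \<noteq> y"
  defines "t' \<equiv> t \<circ> Transposition.transpose x y"
  shows "orientation n t' * c (smul q (matching_of n t')) = - (orientation n t * c (smul q (matching_of n t)))"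
proof (cases "x div 2 = y div 2")
  case True
  have inj: "inj_on t {..<2*n}" using t by (simp add: bij_betw_def)
  define k where "k = x div 2"
  have k: "k < n" using xy(1) by (simp add: k_def)
  \<comment> \<open>Exchanging the two ends of one pair keeps the matching and reverses its
    orientation. For \<open>h = 0\<close> there is only one pair and this is the only case, which is
    why vanishing is assumed for \<open>h > 0\<close>.\<close>
  have "(x = 2*k \<and> y = 2*k+1) \<or> (x = 2*k+1 \<and> y = 2*k)" using True xy(3) unfolding k_def by presburger
  then have t'k: "t' = t \<circ> Transposition.transpose (2*k) (2*k+1)"
    unfolding t'_def by (metis Transposition.transpose_commute)
  show ?thesis unfolding t'k orientation_swap_pair[OF inj k] by simp
next
  case False
  define k where "k = x div 2"
  define l where "l = y div 2"
  have kl: "k \<noteq> l" "k < n" "l < n" using False xy by (auto simp: k_def l_def)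
  then have h: "h > 0" using n by auto
  have inj: "inj_on t {..<2*n}" and img: "t ` {..<2*n} = S" using t by (simp_all add: bij_betw_def)
  have finS: "finite S" "card S = 2*n" using img inj card_image[OF inj] by auto
  have q0: "q > 0" using q char_exp_pos[where ?'a = 'a] by simp
  define mx where "mx = mate x"
  define my where "my = mate y"
  have m: "mx div 2 = k" "my div 2 = l" "mx \<noteq> x" "my \<noteq> y" "mate mx = x" "mate my = y" "mx < 2*n" "my < 2*n"
    unfolding mx_def my_def k_def l_def using mate_props mate_less xy by simp_all
  have dist: "x \<noteq> y" "x \<noteq> my" "mx \<noteq> y" "mx \<noteq> my" using m kl xy by (auto simp: k_def l_def)
  have in_k: "i = x \<or> i = mx" if "i div 2 = k" for i using same_pair[of i x] that by (simp add: k_def mx_def)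
  have in_l: "i = y \<or> i = my" if "i div 2 = l" for i using same_pair[of i y] that by (simp add: l_def my_def)
  \<comment> \<open>There are \<open>h + 1\<close> pairs but only \<open>h\<close> planes: the pairs
    \<open>k\<close> and \<open>l\<close> share a plane, and the number \<open>h\<close>, if it
    still occurs, is replaced by the free number \<open>l\<close>.\<close>
  define idx where "idx j = (let j' = (if j = l then k else j) in if j' = h then l else j')" for j
  have idx_less: "idx j < h" if "j < n" for j using that kl n by (auto simp: idx_def Let_def)
  have idx_eq: "idx i = idx j \<longleftrightarrow> i = j \<or> (i \<in> {k, l} \<and> j \<in> {k, l})" if "i < n" "j < n" for i j
    using that kl n by (auto simp: idx_def Let_def)
  \<comment> \<open>Outside the two chosen pairs parity decides which basis vector of the plane is
    used; \<open>x\<close> and \<open>y\<close> get the same one, so exchanging them changes no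
    vector.\<close>
  define sd where "sd i = (if i \<in> {x, y} then 0 else if i \<in> {mx, my} then 1 else i mod 2)" for i
  have sd2: "sd i < 2" for i by (simp add: sd_def)
  have mates: "mate x = mx" "mate y = my" "mate mx = x" "mate my = y"
    by (simp_all add: mx_def my_def mate_props)
  have sdv: "sd x = 0" "sd y = 0" "sd mx = 1" "sd my = 1" using dist m(3,4) by (auto simp: sd_def)
  have sd_mate: "sd i \<noteq> sd (mate i)" for i
  proof (cases "i \<in> {x, mx, y, my}")
    case True
    then consider "i = x" | "i = mx" | "i = y" | "i = my" by blast
    then show ?thesis by cases (simp_all add: mates sdv)
  next
    case False
    have "mate i \<notin> {x, mx, y, my}"
    proof
      assume "mate i \<in> {x, mx, y, my}"
      then have "mate (mate i) \<in> {x, mx, y, my}" using mates by auto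
      then show False using False by (simp add: mate_props)
    qed
    moreover have "i mod 2 \<noteq> mate i mod 2" unfolding mate_def by (cases "even i") (auto elim!: evenE oddE)
    moreover have "sd j = j mod 2" if "j \<notin> {x, mx, y, my}" for j
    proof -
      have "j \<notin> {x, y}" "j \<notin> {mx, my}" using that by blast+
      then show ?thesis by (simp only: sd_def if_False)
    qed
    ultimately show ?thesis using False by metis
  qed
  define \<beta> :: "nat \<Rightarrow> nat \<Rightarrow> 'a" where "\<beta> i = (\<lambda>m. if m = 2 * idx (i div 2) + sd i then 1 else 0)" for i
  have w: "sform h (\<beta> i) (\<beta> j) \<noteq> 0 \<longleftrightarrow> idx (i div 2) = idx (j div 2) \<and> sd i \<noteq> sd j"
    if "i < 2*n" "j < 2*n" for i j
  proof -
    have "idx (i div 2) < h" "idx (j div 2) < h" using idx_less that by simp_all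
    then have e: "sform h (\<beta> i) (\<beta> j) = (if idx (i div 2) = idx (j div 2) then
        if sd i < sd j then 1 else if sd j < sd i then - 1 else 0 else 0)"
      unfolding \<beta>_def by (rule sform_unit[OF _ _ sd2 sd2])
    show ?thesis unfolding e by (auto simp: neq_iff)
  qed
  have \<beta>xy: "\<beta> x = \<beta> y" unfolding \<beta>_def k_def[symmetric] l_def[symmetric]
    using idx_eq[OF kl(2,3)] by (simp add: sd_def)
  define b where "b v = \<beta> (inv_into {..<2*n} t v)" for v
  have bt: "b (t i) = \<beta> i" if "i < 2*n" for i using inj that by (simp add: b_def)
  let ?\<tau> = "Transposition.transpose x y"
  have \<tau>: "?\<tau> i < 2*n" if "i < 2*n" for i using that xy by (simp add: Transposition.transpose_def)
  have bt': "b (t' i) = \<beta> i" if "i < 2*n" for i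
    using bt[OF \<tau>[OF that]] \<beta>xy by (simp add: t'_def Transposition.transpose_def split: if_splits)
  have t'v: "t' x = t y" "t' y = t x" "\<And>i. i \<noteq> x \<Longrightarrow> i \<noteq> y \<Longrightarrow> t' i = t i"
    by (simp_all add: t'_def)
  have bij': "bij_betw t' {..<2*n} S"
  proof -
    have "?\<tau> permutes {..<2*n}" using xy by (intro permutes_swap_id) auto
    then have "bij_betw ?\<tau> {..<2*n} {..<2*n}" by (rule permutes_imp_bij)
    then show ?thesis unfolding t'_def using t by (rule bij_betw_trans)
  qed
  define \<Delta> where "\<Delta> = (\<Prod>k<n. sform h (\<beta> (2*k)) (\<beta> (2*k+1)))"
  have "\<Delta> \<noteq> 0"
  proof -
    have "sform h (\<beta> (2*j)) (\<beta> (2*j+1)) \<noteq> 0" if "j < n" for j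
    proof -
      have "sd (2*j) \<noteq> sd (2*j+1)" using sd_mate[of "2*j"] by simp
      then show ?thesis using w[of "2*j" "2*j+1"] that by simp
    qed
    then show ?thesis unfolding \<Delta>_def by (subst prod_zero_iff) auto
  qed
  \<comment> \<open>Both labelled matchings meet the same vectors at the same positions, so their
    values differ by orientation only; a sign is its own \<open>q\<close>-th power.\<close>
  have val: "mval {} h b (smul q (matching_of n u)) = orientation n u * \<Delta> ^ q"
    if "\<And>i. i < 2*n \<Longrightarrow> b (u i) = \<beta> i" for u
  proof -
    have "(\<Prod>k<n. sform h (b (u (2*k))) (b (u (2*k+1)))) = \<Delta>"
      unfolding \<Delta>_def using that by (intro prod.cong) auto
    then have "mval {} h b (smul q (matching_of n u)) = orientation n u ^ q * \<Delta> ^ q"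
      by (simp add: mval_smul[OF q0] mval_matching_of_orientation power_mult_distrib)
    moreover have "(orientation n u :: 'a) ^ q = orientation n u"
      using orientation_cases[of n u, where ?'a = 'a] neg_one_power_char_exp[OF q] by auto
    ultimately show ?thesis by simp
  qed
  let ?M = "matching_of n t"
  let ?M' = "matching_of n t'"
  have PM: "?M \<in> perfect_matchings S" "?M' \<in> perfect_matchings S"
    using matching_of_perfect[of t n] matching_of_perfect[of t' n] t bij' by (auto simp: bij_betw_def)
  have kM: "edge (t x) (t mx) \<in> keys ?M" unfolding mx_def by (rule keys_matching_of_mate[OF xy(1)])
  have kM': "edge (t x) (t my) \<in> keys ?M'"
    using keys_matching_of_mate[OF xy(2), of t'] t'v(2) t'v(3)[of my] dist m by (simp add: my_def[symmetric])
  have tinj: "i = j" if "t i = t j" "i < 2*n" "j < 2*n" for i j using inj that by (auto dest: inj_onD)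
  have uniq: "i = j" if "M \<in> perfect_matchings S" "edge (t u) (t i) \<in> keys M" "edge (t u) (t j) \<in> keys M"
    "u < 2*n" "i < 2*n" "j < 2*n" for M u i j
  proof -
    have "t u \<in> S" using that(4) img by blast
    then have "edge (t u) (t i) = edge (t u) (t j)"
      using perfect_matchings_unique[OF that(1) _ that(2) edge_touch(1) that(3) edge_touch(1)] by blast
    then show ?thesis using edge_inj tinj that(5,6) by blast
  qed
  have MM': "?M \<noteq> ?M'" using uniq[OF PM(2) _ kM' xy(1) m(7,8)] kM dist by metis
  \<comment> \<open>Outside the shared plane a vertex can only be joined to its mate; inside it,
    \<open>x\<close> and \<open>y\<close> must go to the two mates \<open>mx\<close> and
    \<open>my\<close>, in one of two ways.\<close>
  have survive: "M = ?M \<or> M = ?M'" if M: "M \<in> perfect_matchings S" and nz: "mval {} h b (smul q M) \<noteq> 0" for M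
  proof -
    have nz': "edge_val h b v \<noteq> 0" if "v \<in> keys M" for v
    proof
      assume "edge_val h b v = 0"
      moreover have "lookup M v = 1" using perfect_matchingsD(4)[OF M that] .
      ultimately have "mval {} h b M = 0" unfolding mval_def using that
        by (intro prod_zero) (auto intro!: bexI[of _ v])
      then show False using nz q0 by (simp add: mval_smul)
    qed
    have ex: "\<exists>j<2*n. edge (t i) (t j) \<in> keys M \<and> idx (i div 2) = idx (j div 2) \<and> sd i \<noteq> sd j"
      if i: "i < 2*n" for i
    proof -
      have "t i \<in> S" using i img by blast
      then obtain v where v: "v \<in> keys M" "v \<in> touch (t i)" by (rule perfect_matchings_ex[OF M])
      have lt: "fst v < snd v" using perfect_matchingsD(1)[OF M v(1)] .
      have e: "v = edge (t i) (other (t i) v)" by (rule edge_other[OF v(2) lt])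
      have "other (t i) v \<in> S" using perfect_matchingsD[OF M v(1)] by (simp add: other_def)
      then obtain j where j: "j < 2*n" "other (t i) v = t j" using img by auto
      have "sform h (b (t i)) (b (t j)) \<noteq> 0"
        using nz'[OF v(1)] edge_val_eq_0_iff[OF v(2), of h b] j(2) by simp
      then have "idx (i div 2) = idx (j div 2) \<and> sd i \<noteq> sd j" using w[OF i j(1)] bt i j(1) by simp
      then show ?thesis using v(1) e j by auto
    qed
    have rest: "edge (t i) (t (mate i)) \<in> keys M" if i: "i < 2*n" "i \<notin> {x, mx, y, my}" for i
    proof -
      obtain j where j: "j < 2*n" "edge (t i) (t j) \<in> keys M" "idx (i div 2) = idx (j div 2)" "sd i \<noteq> sd j"
        using ex[OF i(1)] by blast
      have "i div 2 \<noteq> k" "i div 2 \<noteq> l" using in_k[of i] in_l[of i] i(2) by auto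
      then have "j div 2 = i div 2" using j(3) idx_eq[of "i div 2" "j div 2"] i(1) j(1) by auto
      moreover have "j \<noteq> i" using j(4) by auto
      ultimately have "j = mate i" using same_pair by blast
      then show ?thesis using j(2) by simp
    qed
    have opp: "edge (t i) (t mx) \<in> keys M \<or> edge (t i) (t my) \<in> keys M" if i: "i \<in> {x, y}" for i
    proof -
      have i2: "i < 2*n" using i xy by auto
      obtain j where j: "j < 2*n" "edge (t i) (t j) \<in> keys M" "idx (i div 2) = idx (j div 2)" "sd i \<noteq> sd j"
        using ex[OF i2] by blast
      have "i div 2 \<in> {k, l}" using i by (auto simp: k_def l_def)
      then have "j div 2 \<in> {k, l}" using j(3) idx_eq[of "i div 2" "j div 2"] i2 j(1) by auto
      then have "j \<in> {x, mx, y, my}" using in_k[of j] in_l[of j] by auto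
      moreover have "sd j \<noteq> 0" using j(4) i by (auto simp: sd_def)
      ultimately have "j = mx \<or> j = my" by (auto simp: sd_def)
      then show ?thesis using j(2) by auto
    qed
    have cross: False if "edge (t x) (t z) \<in> keys M" "edge (t y) (t z) \<in> keys M" "z < 2*n" for z
      using uniq[OF M, of z x y] that xy by (simp add: edge_commute)
    have c: "edge (t my) (t y) \<in> keys M \<longleftrightarrow> edge (t y) (t my) \<in> keys M"
      "edge (t mx) (t x) \<in> keys M \<longleftrightarrow> edge (t x) (t mx) \<in> keys M"
      "edge (t my) (t x) \<in> keys M \<longleftrightarrow> edge (t x) (t my) \<in> keys M"
      "edge (t mx) (t y) \<in> keys M \<longleftrightarrow> edge (t y) (t mx) \<in> keys M"
      by (simp_all add: edge_commute)
    consider "edge (t x) (t mx) \<in> keys M" "edge (t y) (t my) \<in> keys M"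
      | "edge (t x) (t my) \<in> keys M" "edge (t y) (t mx) \<in> keys M"
      using opp[of x] opp[of y] cross[of mx] cross[of my] m(7,8) by blast
    then show ?thesis
    proof cases
      case 1
      have "edge (t i) (t (mate i)) \<in> keys M" if "i < 2*n" for i
      proof (cases "i \<in> {x, mx, y, my}")
        case True
        then consider "i = x" | "i = mx" | "i = y" | "i = my" by blast
        then show ?thesis by cases (use 1 c in \<open>simp_all add: mates\<close>)
      next
        case False
        then show ?thesis using rest that by blast
      qed
      then show ?thesis using matching_of_eqI[OF t M] by blast
    next
      case 2
      have "edge (t' i) (t' (mate i)) \<in> keys M" if "i < 2*n" for i
      proof (cases "i \<in> {x, mx, y, my}")
        case True
        have v: "t' mx = t mx" "t' my = t my" using t'v(3) dist m by auto
        consider "i = x" | "i = mx" | "i = y" | "i = my" using True by blast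
        then show ?thesis
          by cases (use 2 c v t'v(1,2) in \<open>simp_all add: mates\<close>)
      next
        case False
        then have "mate i \<noteq> x" "mate i \<noteq> y" using mate_props(3)[of i] by (auto simp: mx_def my_def)
        then show ?thesis using rest[OF that False] t'v(3) False by simp
      qed
      then show ?thesis using matching_of_eqI[OF bij' M] by blast
    qed
  qed
  have finPM: "finite (perfect_matchings S)" using card_perfect_matchings[OF finS] by blast
  have injq: "inj_on (smul q) (perfect_matchings S)"
  proof (rule inj_onI)
    fix M N assume "smul q M = smul q N"
    then have "q * lookup M v = q * lookup N v" for v by (metis lookup_smul)
    then show "M = N" using q0 by (intro poly_mapping_eqI) simp
  qed
  have "0 = (\<Sum>\<mu>\<in>smul q ` perfect_matchings S. c \<mu> * mval {} h b \<mu>)"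
    using van[OF h] by (simp add: vanishes_def)
  also have "\<dots> = (\<Sum>M\<in>perfect_matchings S. c (smul q M) * mval {} h b (smul q M))"
    by (simp add: sum.reindex[OF injq])
  also have "\<dots> = (\<Sum>M\<in>{?M, ?M'}. c (smul q M) * mval {} h b (smul q M))"
    using finPM PM survive by (intro sum.mono_neutral_right) auto
  also have "\<dots> = c (smul q ?M) * (orientation n t * \<Delta> ^ q) + c (smul q ?M') * (orientation n t' * \<Delta> ^ q)"
    using MM' val[OF bt] val[OF bt'] by simp
  also have "\<dots> = (orientation n t * c (smul q ?M) + orientation n t' * c (smul q ?M')) * \<Delta> ^ q"
    by (simp add: algebra_simps)
  finally show ?thesis using \<open>\<Delta> \<noteq> 0\<close> by (simp add: add_eq_0_iff add.commute)
qed

text \<open>Transpositions generate the permutations and each reverses the sign. They are composed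
  on the right, acting on positions, so that \<open>coeff_swap\<close> applies to the labelling
  \<open>s \<circ> p\<close> already reached.\<close>

lemma coeff_permutation:
  fixes c :: "mono \<Rightarrow> 'a::{field,infinite}"
  assumes n: "n = Suc h" and s: "bij_betw s {..<2*n} S" and q: "q = char_exp TYPE('a) ^ e"
    and van: "h > 0 \<Longrightarrow> vanishes h c (smul q ` perfect_matchings S)"
    and \<sigma>: "\<sigma> permutes {..<2*n}"
  shows "orientation n (s \<circ> \<sigma>) * c (smul q (matching_of n (s \<circ> \<sigma>))) =
    of_int (sign \<sigma>) * (orientation n s * c (smul q (matching_of n s)))"
  using finite_lessThan \<sigma>
proof (induction \<sigma> rule: permutes_rev_induct)
  case id
  then show ?case by simp
next
  case (swap a b p)
  have bij: "bij_betw (s \<circ> p) {..<2*n} S" using permutes_imp_bij[OF swap(4)] s by (rule bij_betw_trans)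
  have "sign (p \<circ> Transposition.transpose a b) = - sign p"
  proof -
    have "permutation p" using swap(4) permutation_permutes by blast
    then show ?thesis using swap(3) by (simp add: sign_compose permutation_swap_id sign_swap_id)
  qed
  moreover have "orientation n ((s \<circ> p) \<circ> Transposition.transpose a b) *
      c (smul q (matching_of n ((s \<circ> p) \<circ> Transposition.transpose a b))) =
      - (orientation n (s \<circ> p) * c (smul q (matching_of n (s \<circ> p))))"
    using swap(1-3) by (intro coeff_swap[OF n bij q van]) auto
  ultimately show ?case by (simp only: swap(5) comp_assoc of_int_minus mult_minus_left)
qed

section \<open>Pfaffians and rank\<close>


definition nth_elem :: "nat set \<Rightarrow> nat \<Rightarrow> nat" where
  "nth_elem S i = sorted_list_of_set S ! i"

lemma nth_elem_less:
  assumes "finite S" "j < card S" "i < j"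
  shows "nth_elem S i < nth_elem S j"
  unfolding nth_elem_def
  using sorted_wrt_nth_less[OF strict_sorted_list_of_set assms(3)] assms(1,2) by simp

lemma nth_elem_bij: "finite S \<Longrightarrow> bij_betw (nth_elem S) {..<card S} S"
  unfolding nth_elem_def[abs_def] by (rule bij_betw_nth) auto

lemma nth_elem_less_iff:
  assumes "finite S" "i < card S" "j < card S"
  shows "nth_elem S i < nth_elem S j \<longleftrightarrow> i < j"
  using nth_elem_less[OF assms(1)] assms(2,3) by (metis less_asym less_irrefl nat_neq_iff)

lemma pf_permsD:
  assumes "\<sigma> \<in> pf_perms n"
  shows "\<sigma> permutes {..<2*n}" "k < n \<Longrightarrow> \<sigma> (2*k) < \<sigma> (2*k+1)" "Suc k < n \<Longrightarrow> \<sigma> (2*k) < \<sigma> (2*k+2)"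
    "i < 2*n \<Longrightarrow> \<sigma> i < 2*n"
proof -
  show p: "\<sigma> permutes {..<2*n}" using assms by (simp add: pf_perms_def)
  show "i < 2*n \<Longrightarrow> \<sigma> i < 2*n" using permutes_in_image[OF p, of i] by simp
qed (use assms in \<open>auto simp: pf_perms_def\<close>)

lemma pf_perms_edge:
  assumes S: "finite S" "card S = 2*n" and \<sigma>: "\<sigma> \<in> pf_perms n" and k: "k < n"
  shows "nth_elem S (\<sigma> (2*k)) < nth_elem S (\<sigma> (2*k+1))"
    "edge (nth_elem S (\<sigma> (2*k))) (nth_elem S (\<sigma> (2*k+1))) = (nth_elem S (\<sigma> (2*k)), nth_elem S (\<sigma> (2*k+1)))"
proof -
  have "\<sigma> (2*k+1) < card S" using pf_permsD(4)[OF \<sigma>, of "2*k+1"] k S(2) by simp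
  then show l: "nth_elem S (\<sigma> (2*k)) < nth_elem S (\<sigma> (2*k+1))"
    using nth_elem_less[OF S(1)] pf_permsD(2)[OF \<sigma> k] by blast
  show "edge (nth_elem S (\<sigma> (2*k))) (nth_elem S (\<sigma> (2*k+1))) = (nth_elem S (\<sigma> (2*k)), nth_elem S (\<sigma> (2*k+1)))"
    using l by (simp add: edge_def)
qed

text \<open>The first ends increase along the positions, so their set determines their order, and
  each of them occurs in only one pair.\<close>

lemma pf_perms_determined:
  assumes \<sigma>: "\<sigma> \<in> pf_perms n" and \<tau>: "\<tau> \<in> pf_perms n"
    and eq: "(\<lambda>k. (\<sigma> (2*k), \<sigma> (2*k+1))) ` {..<n} = (\<lambda>k. (\<tau> (2*k), \<tau> (2*k+1))) ` {..<n}"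
  shows "\<sigma> = \<tau>"
proof -
  have sorted: "sorted_wrt (<) (map (\<lambda>k. \<rho> (2*k)) [0..<n])" if "\<rho> \<in> pf_perms n" for \<rho>
    using pf_permsD(3)[OF that] by (subst sorted_wrt_iff_nth_Suc_transp) auto
  have "fst ` ((\<lambda>k. (\<sigma> (2*k), \<sigma> (2*k+1))) ` {..<n}) = fst ` ((\<lambda>k. (\<tau> (2*k), \<tau> (2*k+1))) ` {..<n})"
    using eq by simp
  then have "set (map (\<lambda>k. \<sigma> (2*k)) [0..<n]) = set (map (\<lambda>k. \<tau> (2*k)) [0..<n])"
    by (simp add: image_image atLeast0LessThan)
  then have "map (\<lambda>k. \<sigma> (2*k)) [0..<n] = map (\<lambda>k. \<tau> (2*k)) [0..<n]"
    using sorted[OF \<sigma>] sorted[OF \<tau>] by (metis strict_sorted_equal)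
  then have ev: "\<sigma> (2*k) = \<tau> (2*k)" if "k < n" for k using that by auto
  have od: "\<sigma> (2*k+1) = \<tau> (2*k+1)" if k: "k < n" for k
  proof -
    have "(\<sigma> (2*k), \<sigma> (2*k+1)) \<in> (\<lambda>k. (\<tau> (2*k), \<tau> (2*k+1))) ` {..<n}" using eq k by blast
    then obtain l where l: "l < n" "\<sigma> (2*k) = \<tau> (2*l)" "\<sigma> (2*k+1) = \<tau> (2*l+1)" by auto
    then have "\<tau> (2*k) = \<tau> (2*l)" using ev[OF k] by simp
    then have "k = l" using permutes_inj[OF pf_permsD(1)[OF \<tau>]] by (simp add: inj_eq)
    then show ?thesis using l(3) by simp
  qed
  show ?thesis
  proof
    fix i
    show "\<sigma> i = \<tau> i"
    proof (cases "i < 2*n")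
      case True
      then have "i div 2 < n" by simp
      moreover have "i = 2*(i div 2) \<or> i = 2*(i div 2)+1" by presburger
      ultimately show ?thesis using ev od by metis
    next
      case False
      then show ?thesis 
        using permutes_not_in[OF pf_permsD(1)[OF \<sigma>], of i] permutes_not_in[OF pf_permsD(1)[OF \<tau>], of i]
        by simp
    qed
  qed
qed

lemma pf_perms_inj:
  assumes S: "finite S" "card S = 2*n"
  shows "inj_on (\<lambda>\<sigma>. matching_of n (nth_elem S \<circ> \<sigma>)) (pf_perms n)"
proof (rule inj_onI)
  fix \<sigma> \<tau> assume \<sigma>: "\<sigma> \<in> pf_perms n" and \<tau>: "\<tau> \<in> pf_perms n"
    and eq: "matching_of n (nth_elem S \<circ> \<sigma>) = matching_of n (nth_elem S \<circ> \<tau>)"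
  let ?A = "\<lambda>\<rho>. (\<lambda>k. (\<rho> (2*k), \<rho> (2*k+1))) ` {..<n}"
  let ?s = "map_prod (nth_elem S) (nth_elem S)"
  have keys: "keys (matching_of n (nth_elem S \<circ> \<rho>)) = ?s ` ?A \<rho>" if "\<rho> \<in> pf_perms n" for \<rho>
    unfolding keys_matching_of image_image using pf_perms_edge(2)[OF S that] by (intro image_cong) auto
  have "?s ` ?A \<sigma> = ?s ` ?A \<tau>" using eq keys[OF \<sigma>] keys[OF \<tau>] by simp
  moreover have i: "inj_on ?s ({..<2*n} \<times> {..<2*n})"
    using nth_elem_bij[OF S(1)] S(2) by (intro map_prod_inj_on) (simp_all add: bij_betw_def)
  moreover have sub: "?A \<rho> \<subseteq> {..<2*n} \<times> {..<2*n}" if "\<rho> \<in> pf_perms n" for \<rho>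
    using pf_permsD(4)[OF that] by auto
  ultimately have "?A \<sigma> = ?A \<tau>" using inj_on_image_eq_iff[OF i sub[OF \<sigma>] sub[OF \<tau>]] by simp
  then show "\<sigma> = \<tau>" by (rule pf_perms_determined[OF \<sigma> \<tau>])
qed

text \<open>The smaller ends of the edges are listed in increasing order, each followed by its
  partner; \<open>\<sigma>\<close> records the positions of this list in the sorted enumeration of
  \<open>S\<close>.\<close>

lemma pf_perms_surj:
  assumes S: "finite S" "card S = 2*n" and M: "M \<in> perfect_matchings S"
  obtains \<sigma> where "\<sigma> \<in> pf_perms n" "matching_of n (nth_elem S \<circ> \<sigma>) = M"
proof -
  define K where "K = keys M"
  have K: "fst v < snd v" "fst v \<in> S" "snd v \<in> S" if "v \<in> K" for v
    using perfect_matchingsD[OF M, of v] that by (simp_all add: K_def)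
  have finK: "finite K" by (simp add: K_def)
  have uniq: "v = w" if "v \<in> K" "w \<in> K" "v \<in> touch i" "w \<in> touch i" for v w i
  proof -
    have "i \<in> S" using perfect_matchings_touch[OF M] that(1,3) by (simp add: K_def)
    then show ?thesis using perfect_matchings_unique[OF M] that by (simp add: K_def)
  qed
  have tf: "v \<in> touch (fst v)" "v \<in> touch (snd v)" for v by (simp_all add: touch_def)
  have inj1: "inj_on fst K" by (rule inj_onI) (metis uniq tf(1))
  have inj2: "inj_on snd K" by (rule inj_onI) (metis uniq tf(2))
  have disj: "fst ` K \<inter> snd ` K = {}"
  proof (rule equals0I)
    fix x assume "x \<in> fst ` K \<inter> snd ` K"
    then obtain v w where vw: "v \<in> K" "w \<in> K" "x = fst v" "x = snd w" by blast
    then have "v = w" using uniq[of v w x] tf by metis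
    then show False using K(1)[OF vw(1)] vw by simp
  qed
  have un: "fst ` K \<union> snd ` K = S"
  proof
    show "fst ` K \<union> snd ` K \<subseteq> S" using K by blast
    show "S \<subseteq> fst ` K \<union> snd ` K"
    proof
      fix i assume i: "i \<in> S"
      obtain v where "v \<in> keys M" "v \<in> touch i" by (rule perfect_matchings_ex[OF M i])
      then show "i \<in> fst ` K \<union> snd ` K" by (auto simp: K_def touch_def)
    qed
  qed
  have "card (fst ` K \<union> snd ` K) = card (fst ` K) + card (snd ` K)"
    using finK disj by (intro card_Un_disjoint) auto
  then have cK: "card (fst ` K) = n" using un S(2) card_image[OF inj1] card_image[OF inj2] by simp
  define xs where "xs = sorted_list_of_set (fst ` K)"
  have xs: "length xs = n" "set xs = fst ` K" "sorted_wrt (<) xs"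
    using cK finK by (simp_all add: xs_def)
  define g where "g x = snd (inv_into K fst x)" for x
  have gK: "(x, g x) \<in> K" if "x \<in> fst ` K" for x
    using inv_into_into[OF that] f_inv_into_f[OF that] unfolding g_def by (metis prod.collapse)
  define t where "t i = (if even i then xs ! (i div 2) else g (xs ! (i div 2)))" for i
  have tk: "(t (2*k), t (2*k+1)) \<in> K" if "k < n" for k
  proof -
    have "xs ! k \<in> fst ` K" using that xs(1,2) by (metis nth_mem)
    then show ?thesis using gK by (simp add: t_def)
  qed
  have half: "i div 2 < n \<and> (i = 2*(i div 2) \<or> i = 2*(i div 2)+1)" if "i < 2*n" for i
    using that by presburger
  have tS: "t i \<in> S" if "i < 2*n" for i
    using K(2,3)[OF tk[of "i div 2"]] half[OF that] by (metis fst_conv snd_conv)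
  have "S \<subseteq> t ` {..<2*n}"
  proof
    fix v assume "v \<in> S"
    then consider "v \<in> fst ` K" | e where "e \<in> K" "v = snd e" using un by blast
    then show "v \<in> t ` {..<2*n}"
    proof cases
      case 1
      then obtain k where "k < n" "xs ! k = v" using xs(1,2) by (metis in_set_conv_nth)
      then show ?thesis by (intro image_eqI[of _ _ "2*k"]) (simp_all add: t_def)
    next
      case 2
      then have f: "fst e \<in> fst ` K" by blast
      then obtain k where k: "k < n" "xs ! k = fst e" using xs(1,2) by (metis in_set_conv_nth)
      have "(fst e, g (fst e)) = e" using inj_onD[OF inj1 _ gK[OF f] 2(1)] by simp
      then have "v = g (xs ! k)" using 2(2) k(2) by (metis snd_conv)
      then show ?thesis using k(1) by (intro image_eqI[of _ _ "2*k+1"]) (simp_all add: t_def)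
    qed
  qed
  then have timg: "t ` {..<2*n} = S" using tS by blast
  have tinj: "inj_on t {..<2*n}" using timg S(2) by (intro eq_card_imp_inj_on) simp_all
  have bij: "bij_betw (nth_elem S) {..<2*n} S" using nth_elem_bij[OF S(1)] S(2) by simp
  define \<sigma> where "\<sigma> i = (if i < 2*n then inv_into {..<2*n} (nth_elem S) (t i) else i)" for i
  have \<sigma>: "\<sigma> i < 2*n" "nth_elem S (\<sigma> i) = t i" if "i < 2*n" for i
  proof -
    have "t i \<in> nth_elem S ` {..<2*n}" using tS[OF that] bij by (simp add: bij_betw_def)
    then show "\<sigma> i < 2*n" "nth_elem S (\<sigma> i) = t i"
      using that inv_into_into[of "t i" "nth_elem S" "{..<2*n}"] f_inv_into_f[of "t i" "nth_elem S" "{..<2*n}"]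
      by (simp_all add: \<sigma>_def)
  qed
  have "inj_on \<sigma> {..<2*n}"
  proof (rule inj_onI)
    fix i j assume ij: "i \<in> {..<2*n}" "j \<in> {..<2*n}" "\<sigma> i = \<sigma> j"
    then have "t i = t j" using \<sigma>(2)[of i] \<sigma>(2)[of j] by simp
    then show "i = j" using inj_onD[OF tinj _ ij(1,2)] by blast
  qed
  moreover have "\<sigma> ` {..<2*n} \<subseteq> {..<2*n}" using \<sigma>(1) by auto
  ultimately have "bij_betw \<sigma> {..<2*n} {..<2*n}"
    by (simp add: bij_betw_def endo_inj_surj)
  then have perm: "\<sigma> permutes {..<2*n}" by (rule bij_imp_permutes) (simp add: \<sigma>_def)
  have lt: "\<sigma> i < \<sigma> j" if "i < 2*n" "j < 2*n" "t i < t j" for i j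
    using nth_elem_less_iff[OF S(1), of "\<sigma> i" "\<sigma> j"] \<sigma>[OF that(1)] \<sigma>[OF that(2)] that(3) S(2) by simp
  have "\<sigma> \<in> pf_perms n"
    unfolding pf_perms_def
  proof (intro CollectI conjI allI impI perm)
    fix k assume "k < n"
    then show "\<sigma> (2*k) < \<sigma> (2*k+1)" using K(1)[OF tk] by (intro lt) simp_all
  next
    fix k assume k: "Suc k < n"
    then have "xs ! k < xs ! Suc k" using xs(1,3) by (intro sorted_wrt_nth_less[OF xs(3)]) simp_all
    then show "\<sigma> (2*k) < \<sigma> (2*k+2)" using k by (intro lt) (simp_all add: t_def)
  qed
  moreover have "matching_of n (nth_elem S \<circ> \<sigma>) = M"
  proof (rule perfect_matchings_eqI[OF _ M])
    have "bij_betw (nth_elem S \<circ> \<sigma>) {..<2*n} S" using permutes_imp_bij[OF perm] bij by (rule bij_betw_trans)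
    then show "matching_of n (nth_elem S \<circ> \<sigma>) \<in> perfect_matchings S"
      using matching_of_perfect[of "nth_elem S \<circ> \<sigma>" n] by (simp add: bij_betw_def)
    show "keys (matching_of n (nth_elem S \<circ> \<sigma>)) \<subseteq> keys M"
    proof
      fix v assume "v \<in> keys (matching_of n (nth_elem S \<circ> \<sigma>))"
      then obtain k where k: "k < n" "v = edge (t (2*k)) (t (2*k+1))"
        unfolding keys_matching_of using \<sigma>(2) by auto
      have "edge (t (2*k)) (t (2*k+1)) = (t (2*k), t (2*k+1))" using K(1)[OF tk[OF k(1)]] by (simp add: edge_def)
      then show "v \<in> keys M" using tk[OF k(1)] k(2) by (simp add: K_def)
    qed
  qed
  ultimately show ?thesis by (rule that)
qed

lemma pf_perms_bij:
  assumes "finite S" "card S = 2*n"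
  shows "bij_betw (\<lambda>\<sigma>. matching_of n (nth_elem S \<circ> \<sigma>)) (pf_perms n) (perfect_matchings S)"
proof (rule bij_betw_imageI[OF pf_perms_inj[OF assms]])
  have "matching_of n (nth_elem S \<circ> \<sigma>) \<in> perfect_matchings S" if "\<sigma> \<in> pf_perms n" for \<sigma>
  proof -
    have "bij_betw (nth_elem S) {..<2*n} S" using nth_elem_bij[OF assms(1)] assms(2) by simp
    with permutes_imp_bij[OF pf_permsD(1)[OF that]] have "bij_betw (nth_elem S \<circ> \<sigma>) {..<2*n} S"
      by (rule bij_betw_trans)
    then show ?thesis using matching_of_perfect[of "nth_elem S \<circ> \<sigma>" n] by (simp add: bij_betw_def)
  qed
  moreover have "\<exists>\<sigma>\<in>pf_perms n. M = matching_of n (nth_elem S \<circ> \<sigma>)" if M: "M \<in> perfect_matchings S" for M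
  proof -
    obtain \<sigma> where "\<sigma> \<in> pf_perms n" "matching_of n (nth_elem S \<circ> \<sigma>) = M" by (rule pf_perms_surj[OF assms M])
    then show ?thesis by blast
  qed
  ultimately show "(\<lambda>\<sigma>. matching_of n (nth_elem S \<circ> \<sigma>)) ` pf_perms n = perfect_matchings S" by blast
qed

section \<open>Powers of the Pfaffian\<close>

lemma CHAR_poly_mapping: "CHAR('a::comm_semiring_1 skpoly) = CHAR('a)"
proof -
  have "of_nat n = (0 :: 'a skpoly) \<longleftrightarrow> of_nat n = (0 :: 'a)" for n
  proof -
    have "of_nat n = (0 :: 'a skpoly) \<longleftrightarrow> Poly_Mapping.single (0::mono) (of_nat n :: 'a) = 0" by simp
    also have "\<dots> \<longleftrightarrow> of_nat n = (0 :: 'a)" by (metis lookup_single_eq lookup_zero single_zero)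
    finally show ?thesis .
  qed
  then show ?thesis by (intro CHAR_eqI) (simp_all add: of_nat_eq_0_iff_char_dvd)
qed

text \<open>Freshman's dream in the polynomial ring, which has the characteristic of its
  coefficients; in characteristic 0 the exponent is 1.\<close>

lemma skpoly_sum_power_char_exp:
  fixes g :: "'b \<Rightarrow> 'a::field skpoly"
  assumes "q = char_exp TYPE('a) ^ e"
  shows "(\<Sum>x\<in>A. g x) ^ q = (\<Sum>x\<in>A. g x ^ q)"
proof (cases "CHAR('a) = 0")
  case True
  then show ?thesis using assms by (simp add: char_exp_def)
next
  case False
  then have "prime CHAR('a)" using prime_CHAR_semidom[where ?'a = 'a] by simp
  then have p: "prime CHAR('a skpoly)" by (simp only: CHAR_poly_mapping)
  have "q = CHAR('a skpoly) ^ e" using assms False by (simp add: char_exp_def CHAR_poly_mapping)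
  then show ?thesis by (rule freshmans_dream_sum'[OF p])
qed

lemma single_power: "(Poly_Mapping.single \<mu> a :: 'a::comm_semiring_1 skpoly) ^ q = Poly_Mapping.single (smul q \<mu>) (a ^ q)"
proof (induction q)
  case 0
  have "smul 0 \<mu> = 0" by (rule poly_mapping_eqI) simp
  then show ?case by simp
next
  case (Suc q)
  have "\<mu> + smul q \<mu> = smul (Suc q) \<mu>" by (rule poly_mapping_eqI) (simp add: lookup_add)
  then show ?case using Suc by (simp add: mult_single)
qed

text \<open>Raising to the power \<open>q\<close> is additive here and fixes the signs, so it only
  multiplies the exponents by \<open>q\<close>.\<close>

lemma pfaffian_poly_power:
  assumes S: "finite S" "card S = 2*n" and q: "q = char_exp TYPE('a::field) ^ e"
  shows "(pfaffian_poly S :: 'a skpoly) ^ q =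
    (\<Sum>\<sigma>\<in>pf_perms n. Poly_Mapping.single (smul q (matching_of n (nth_elem S \<circ> \<sigma>))) (of_int (sign \<sigma>)))"
proof -
  have "(\<Sum>k<n. Poly_Mapping.single (nth_elem S (\<sigma> (2*k)), nth_elem S (\<sigma> (2*k+1))) (1::nat)) =
     matching_of n (nth_elem S \<circ> \<sigma>)" if "\<sigma> \<in> pf_perms n" for \<sigma>
    unfolding matching_of_def using pf_perms_edge(2)[OF S that] by (intro sum.cong) auto
  then have P: "pfaffian_poly S = (\<Sum>\<sigma>\<in>pf_perms n.
      Poly_Mapping.single (matching_of n (nth_elem S \<circ> \<sigma>)) (of_int (sign \<sigma>) :: 'a))"
    unfolding pfaffian_poly_def Let_def using S(2) by (simp add: nth_elem_def[symmetric])
  have "(of_int (sign \<sigma>) :: 'a) ^ q = of_int (sign \<sigma>)" for \<sigma> :: "nat \<Rightarrow> nat"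
    by (cases \<sigma> rule: sign_cases) (simp_all add: neg_one_power_char_exp[OF q])
  then show ?thesis unfolding P skpoly_sum_power_char_exp[OF q] single_power by simp
qed

section \<open>Gram matrices and their rank\<close>

definition gram :: "nat \<Rightarrow> nat \<Rightarrow> (nat \<Rightarrow> nat \<Rightarrow> 'a::comm_ring_1) \<Rightarrow> 'a mat" where
  "gram m h b = mat m m (\<lambda>(i, j). sform h (b i) (b j))"

lemma skew_mat_gram: "skew_mat m (gram m h b)"
  unfolding skew_mat_def gram_def using sform_swap by auto

lemma eval_at_gram:
  assumes "skew_vars m f"
  shows "eval_at f (gram m h b) = (\<Sum>\<mu>\<in>keys f. lookup f \<mu> * mval {} h b \<mu>)"
  unfolding eval_at_def
proof (rule sum.cong[OF refl])
  fix \<mu> assume mu: "\<mu> \<in> keys f"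
  have "gram m h b $$ v = edge_val h b v" if "v \<in> keys \<mu>" for v
    using assms mu that unfolding skew_vars_def gram_def edge_val_def by (cases v) force
  then show "lookup f \<mu> * (\<Prod>v\<in>keys \<mu>. (gram m h b $$ v) ^ lookup \<mu> v) = lookup f \<mu> * mval {} h b \<mu>"
    by (simp add: mval_def)
qed

text \<open>Each symplectic plane adds two matrices that are products of a column and a row.\<close>

lemma rank_gram_le: "vec_space.rank m (gram m h b :: 'a::field mat) \<le> 2*h"
proof (induction h)
  case 0
  have "gram m 0 b = 0\<^sub>m m m" by (rule eq_matI) (simp_all add: gram_def sform_def)
  then show ?case using vec_space.rank_0I[of m m, where ?'a = 'a] by simp
next
  case (Suc h)
  define P where "P = mat m m (\<lambda>(i, j). b i (2*h) * b j (2*h+1))"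
  define Q where "Q = mat m m (\<lambda>(i, j). - b i (2*h+1) * b j (2*h))"
  have P: "P \<in> carrier_mat m m" "vec_space.rank m P \<le> 1"
    using vec_space.rank_le_1_product_entries[of P m m "\<lambda>i. b i (2*h)" "\<lambda>j. b j (2*h+1)"]
    by (simp_all add: P_def)
  have Q: "Q \<in> carrier_mat m m" "vec_space.rank m Q \<le> 1"
    using vec_space.rank_le_1_product_entries[of Q m m "\<lambda>i. - b i (2*h+1)" "\<lambda>j. b j (2*h)"]
    by (simp_all add: Q_def)
  have G: "gram m h b \<in> carrier_mat m m" by (simp add: gram_def)
  have "gram m (Suc h) b = gram m h b + (P + Q)"
    by (rule eq_matI) (simp_all add: gram_def P_def Q_def sform_def)
  then have "vec_space.rank m (gram m (Suc h) b) \<le> vec_space.rank m (gram m h b) + vec_space.rank m (P + Q)"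
    using vec_space.rank_subadditive[OF G add_carrier_mat[OF Q(1), of P]] by simp
  also have "vec_space.rank m (P + Q) \<le> vec_space.rank m P + vec_space.rank m Q"
    by (rule vec_space.rank_subadditive[OF P(1) Q(1)])
  finally show ?case using Suc.IH P(2) Q(2) by simp
qed

text \<open>\<open>gram r h b\<close> is the leading principal submatrix of
  \<open>gram m h b\<close>, so its determinant is a minor.\<close>

lemma rank_gram_ge:
  fixes b :: "nat \<Rightarrow> nat \<Rightarrow> 'a::field"
  assumes "r \<le> m" "det (gram r h b) \<noteq> 0"
  shows "r \<le> vec_space.rank m (gram m h b)"
proof -
  have I: "{i. i < m \<and> i < r} = {..<r}" using assms(1) by auto
  have "submatrix (gram m h b) {..<r} {..<r} = gram r h b"
  proof (rule eq_matI)
    fix i j assume "i < dim_row (gram r h b)" "j < dim_col (gram r h b)"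
    then have ij: "i < r" "j < r" by (simp_all add: gram_def)
    have c: "card {a\<in>{..<r}. a < k} = k" if "k < r" for k
    proof -
      have "{a\<in>{..<r}. a < k} = {..<k}" using that by auto
      then show ?thesis by simp
    qed
    show "submatrix (gram m h b) {..<r} {..<r} $$ (i, j) = gram r h b $$ (i, j)"
      using submatrix_index_card[of i "gram m h b" j "{..<r}" "{..<r}"] ij assms(1) c
      by (simp add: gram_def)
  qed (simp_all add: dim_submatrix gram_def I)
  then have "card {j. j < m \<and> j \<in> {..<r}} \<le> vec_space.rank m (gram m h b)"
    using assms(2) by (intro vec_space.rank_gt_minor[of _ _ _ "{..<r}"]) (simp_all add: gram_def)
  then show ?thesis by (simp add: I)
qed

lemma sform_basis:
  "sform h (\<lambda>m. if m = i then 1 else 0) y =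
    (if i < 2*h then if even i then y (i+1) else - y (i-1) else (0::'a::comm_ring_1))"
proof -
  have ne: "2 * i \<noteq> Suc (2 * l)" "Suc (2 * l) \<noteq> 2 * i" for i l :: nat by presburger+
  show ?thesis
  proof (cases "even i")
    case True
    then obtain l where l: "i = 2*l" by (elim evenE)
    have "sform h (\<lambda>m. if m = i then 1 else 0) y = (\<Sum>k<h. if k = l then y (i+1) else 0)"
      unfolding sform_def using l ne by (intro sum.cong) auto
    then show ?thesis using l by simp
  next
    case False
    then obtain l where l: "i = 2*l+1" by (elim oddE)
    have "sform h (\<lambda>m. if m = i then 1 else 0) y = (\<Sum>k<h. if k = l then - y (i-1) else 0)"
      unfolding sform_def using l ne by (intro sum.cong) auto
    then show ?thesis using l by simp
  qed
qed

text \<open>A kernel vector pairs to 0 with every basis vector, and these pairings are its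
  coordinates up to order and sign.\<close>

lemma det_gram_basis: "det (gram (2*h) h (\<lambda>i m. if m = i then 1 else 0 :: 'a::field)) \<noteq> 0"
proof
  let ?u = "\<lambda>(i::nat) m. if m = i then 1 else 0 :: 'a"
  let ?J = "gram (2*h) h ?u"
  have J: "?J \<in> carrier_mat (2*h) (2*h)" by (simp add: gram_def)
  assume "det ?J = 0"
  then obtain v where v: "v \<in> carrier_vec (2*h)" "v \<noteq> 0\<^sub>v (2*h)" "?J *\<^sub>v v = 0\<^sub>v (2*h)"
    using det_0_iff_vec_prod_zero_field[OF J] by blast
  define y where "y k = (if k < 2*h then v $ k else 0)" for k
  have row: "sform h (?u i) y = 0" if i: "i < 2*h" for i
  proof -
    have "0 = (?J *\<^sub>v v) $ i" using v(3) i by simp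
    also have "\<dots> = (\<Sum>k<2*h. sform h (?u i) (?u k) * y k)"
      using i v(1) by (simp add: gram_def scalar_prod_def y_def atLeast0LessThan)
    also have "\<dots> = sform h (?u i) y"
    proof -
      have "(\<Sum>k<2*h. sform h (?u i) (?u k) * y k) =
          (\<Sum>k<2*h. if k = (if even i then i+1 else i-1) then (if even i then y k else - y k) else 0)"
        unfolding sform_basis using i by (intro sum.cong) auto
      also have "\<dots> = sform h (?u i) y"
        unfolding sform_basis using i by (auto elim!: evenE)
      finally show ?thesis .
    qed
    finally show ?thesis by simp
  qed
  have "v $ k = 0" if k: "k < 2*h" for k
  proof (cases "even k")
    case True
    then have k1: "k + 1 < 2*h" using k by presburger
    from row[OF k1] show ?thesis using True k k1 unfolding sform_basis by (simp add: y_def)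
  next
    case False
    then have "even (k - 1)" "k - 1 < 2*h" "k - 1 + 1 = k" using k by presburger+
    from row[OF this(2)] this show ?thesis using k unfolding sform_basis by (simp add: y_def)
  qed
  then have "v = 0\<^sub>v (2*h)" using v(1) by (intro eq_vecI) auto
  then show False using v(2) by simp
qed

lemma polyfun_det_gram [polyfun_intros]:
  assumes "\<And>j k. polyfun (\<lambda>t. b t j k)"
  shows "polyfun (\<lambda>t. det (gram r h (b t)))"
proof -
  have "det (gram r h (b t)) = (\<Sum>p | p permutes {0..<r}. of_int (sign p) * (\<Prod>i = 0..<r. sform h (b t i) (b t (p i))))" for t
  proof -
    have "gram r h (b t) \<in> carrier_mat r r" by (simp add: gram_def)
    then have "det (gram r h (b t)) = (\<Sum>p | p permutes {0..<r}. of_int (sign p) * (\<Prod>i = 0..<r. gram r h (b t) $$ (i, p i)))"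
      by (rule det_def')
    also have "\<dots> = (\<Sum>p | p permutes {0..<r}. of_int (sign p) * (\<Prod>i = 0..<r. sform h (b t i) (b t (p i))))"
    proof (intro sum.cong[OF refl] arg_cong2[where f = "(*)"] refl prod.cong)
      fix p i assume "p \<in> {p. p permutes {0..<r}}" "i \<in> {0..<r}"
      then have "i < r" "p i < r" using permutes_in_image[of p "{0..<r}" i] by auto
      then show "gram r h (b t) $$ (i, p i) = sform h (b t i) (b t (p i))" by (simp add: gram_def)
    qed
    finally show ?thesis .
  qed
  then show ?thesis by (simp only:) (intro polyfun_intros assms)
qed

text \<open>On the line from any \<open>b0\<close> to the standard basis the leading minor of size
  \<open>2*h\<close> is nonzero at all but finitely many points, and there the Gram matrix has rank
  exactly \<open>2*h\<close>; the condition \<open>2*h \<le> m\<close> makes room for this minor.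
  Both halves of the theorem rest on this.\<close>

lemma vanishes_of_rank_eq:
  fixes f :: "'a::{field,infinite} skpoly"
  assumes f: "skew_vars m f" and r: "2*h \<le> m"
    and van: "\<And>A. skew_mat m A \<Longrightarrow> vec_space.rank m A = 2*h \<Longrightarrow> eval_at f A = 0"
  shows "vanishes h (lookup f) (keys f)"
  unfolding vanishes_def
proof
  fix b0 :: "nat \<Rightarrow> nat \<Rightarrow> 'a"
  let ?u = "\<lambda>(i::nat) m. if m = i then 1 else 0 :: 'a"
  define B where "B t j k = (1 - t) * b0 j k + t * ?u j k" for t j k
  have pB: "polyfun (\<lambda>t. B t j k)" for j k unfolding B_def by (intro polyfun_intros)
  define g where "g t = (\<Sum>\<mu>\<in>keys f. lookup f \<mu> * mval {} h (B t) \<mu>)" for t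
  have "det (gram (2*h) h (B t)) * g t = 0" for t
  proof (cases "det (gram (2*h) h (B t)) = 0")
    case False
    then have "vec_space.rank m (gram m h (B t)) = 2*h"
      using rank_gram_le[of m h "B t"] rank_gram_ge[OF r False] by simp
    then have "eval_at f (gram m h (B t)) = 0" by (rule van[OF skew_mat_gram])
    then show ?thesis by (simp add: eval_at_gram[OF f] g_def)
  qed simp
  moreover have "polyfun (\<lambda>t. det (gram (2*h) h (B t)))" "polyfun g"
    unfolding g_def by (intro polyfun_intros pB)+
  moreover have "det (gram (2*h) h (B 1)) \<noteq> 0"
  proof -
    have "B 1 = ?u" by (simp add: B_def fun_eq_iff)
    then show ?thesis using det_gram_basis by simp
  qed
  ultimately have "g 0 = 0" using polyfun_mult_eq_0[of "\<lambda>t. det (gram (2*h) h (B t))" g 1 0] by blast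
  moreover have "B 0 = b0" by (simp add: B_def fun_eq_iff)
  ultimately show "(\<Sum>\<mu>\<in>keys f. lookup f \<mu> * mval {} h b0 \<mu>) = 0" by (simp add: g_def)
qed

section \<open>From alternating coefficients to the Pfaffian\<close>

lemma skpoly_sum_singles: "(f :: 'a::comm_monoid_add skpoly) = (\<Sum>\<mu>\<in>keys f. Poly_Mapping.single \<mu> (lookup f \<mu>))"
proof (rule poly_mapping_eqI)
  fix \<kappa>
  have "lookup (\<Sum>\<mu>\<in>keys f. Poly_Mapping.single \<mu> (lookup f \<mu>)) \<kappa> = (\<Sum>\<mu>\<in>keys f. if \<mu> = \<kappa> then lookup f \<mu> else 0)"
    by (simp add: lookup_sum lookup_single when_def)
  also have "\<dots> = lookup f \<kappa>" by (simp add: in_keys_iff)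
  finally show "lookup f \<kappa> = lookup (\<Sum>\<mu>\<in>keys f. Poly_Mapping.single \<mu> (lookup f \<mu>)) \<kappa>" by simp
qed

lemma extremal_pfaffian:
  fixes f :: "'a::{field,infinite} skpoly"
  assumes f: "skew_vars m f" and ext: "extremal h (lookup f) (keys f)"
  shows "\<exists>c u e S. c \<noteq> 0 \<and> S \<subseteq> {..<m} \<and> card S = 2*h+2 \<and>
    f = monomial_term c u * pfaffian_poly S ^ (char_exp TYPE('a) ^ e)"
proof -
  from extremal_matching_support[OF ext, unfolded matching_support_def] obtain \<nu> q S e where
    S: "finite S" "card S = 2*h+2" and q: "q = char_exp TYPE('a) ^ e"
    and X: "keys f = (\<lambda>M. \<nu> + smul q M) ` perfect_matchings S" by blast
  define n where "n = Suc h"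
  have cS: "card S = 2*n" using S(2) by (simp add: n_def)
  have q0: "q > 0" using q char_exp_pos[where ?'a = 'a] by simp
  have edX: "edge_mons (keys f)" and vanX: "vanishes h (lookup f) (keys f)"
    using ext by (auto simp: extremal_def)
  obtain M0 where M0: "M0 \<in> perfect_matchings S" using perfect_matchings_nonempty[OF S(1)] cS by auto
  then have m0: "\<nu> + smul q M0 \<in> keys f" using X by blast
  have nu: "edge_mons {\<nu>}" using edX m0 by (simp add: edge_mons_def keys_add_mono)
  \<comment> \<open>The coefficients of \<open>f\<close> after division by the common monomial
    \<open>\<nu>\<close>.\<close>
  define c where "c \<mu> = lookup f (\<nu> + \<mu>)" for \<mu>
  have van: "vanishes h c (smul q ` perfect_matchings S)" if "h > 0"
    unfolding c_def using vanX X by (intro vanishes_cancel[OF that nu]) (simp add: image_image)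
  let ?s = "nth_elem S"
  have bij: "bij_betw ?s {..<2*n} S" using nth_elem_bij[OF S(1)] cS by simp
  \<comment> \<open>The Pfaffian lists every pair with its smaller end first, so all orientations
    are 1 and the alternating coefficients become the signs of the permutations.\<close>
  have or1: "orientation n (?s \<circ> \<sigma>) = (1::'a)" if "\<sigma> \<in> pf_perms n" for \<sigma>
    unfolding orientation_def using pf_perms_edge(1)[OF S(1) cS that] by (intro prod.neutral) simp
  have "id \<in> pf_perms n" by (simp add: pf_perms_def permutes_id)
  from or1[OF this] have ors: "orientation n ?s = (1::'a)" by simp
  \<comment> \<open>The coefficient belonging to the pairing of consecutive elements of
    \<open>S\<close>, whose permutation has sign 1, is the scalar in front of the Pfaffian
    power.\<close>
  define a where "a = c (smul q (matching_of n ?s))"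
  have co: "c (smul q (matching_of n (?s \<circ> \<sigma>))) = of_int (sign \<sigma>) * a" if "\<sigma> \<in> pf_perms n" for \<sigma>
    using coeff_permutation[OF n_def bij q van pf_permsD(1)[OF that]] or1[OF that] ors by (simp add: a_def)
  have a0: "a \<noteq> 0"
  proof -
    have "matching_of n ?s \<in> perfect_matchings S"
      using matching_of_perfect[of ?s n] bij by (simp add: bij_betw_def)
    then have "\<nu> + smul q (matching_of n ?s) \<in> keys f" using X by blast
    then show ?thesis by (simp add: a_def c_def in_keys_iff)
  qed
  have inj: "inj_on (\<lambda>M. \<nu> + smul q M) (perfect_matchings S)"
  proof (rule inj_onI)
    fix M N assume "\<nu> + smul q M = \<nu> + smul q N"
    then have "smul q M = smul q N" by simp
    then have "q * lookup M v = q * lookup N v" for v by (metis lookup_smul)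
    then show "M = N" using q0 by (intro poly_mapping_eqI) simp
  qed
  have "f = (\<Sum>\<mu>\<in>keys f. Poly_Mapping.single \<mu> (lookup f \<mu>))" by (rule skpoly_sum_singles)
  also have "\<dots> = (\<Sum>M\<in>perfect_matchings S. Poly_Mapping.single (\<nu> + smul q M) (c (smul q M)))"
    unfolding X by (simp add: sum.reindex[OF inj] c_def)
  also have "\<dots> = (\<Sum>\<sigma>\<in>pf_perms n. Poly_Mapping.single (\<nu> + smul q (matching_of n (?s \<circ> \<sigma>)))
      (c (smul q (matching_of n (?s \<circ> \<sigma>)))))"
    by (rule sum.reindex_bij_betw[OF pf_perms_bij[OF S(1) cS], symmetric])
  also have "\<dots> = (\<Sum>\<sigma>\<in>pf_perms n. Poly_Mapping.single \<nu> a *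
      Poly_Mapping.single (smul q (matching_of n (?s \<circ> \<sigma>))) (of_int (sign \<sigma>)))"
    by (rule sum.cong) (simp_all add: co mult_single mult.commute)
  also have "\<dots> = monomial_term a \<nu> * pfaffian_poly S ^ q"
    by (simp only: pfaffian_poly_power[OF S(1) cS q] monomial_term_def sum_distrib_left)
  finally have "f = monomial_term a \<nu> * pfaffian_poly S ^ q" .
  \<comment> \<open>Each element of \<open>S\<close> lies on an edge of \<open>M0\<close>, hence on
    a variable of a term of \<open>f\<close>.\<close>
  moreover have "S \<subseteq> {..<m}"
  proof
    fix i assume i: "i \<in> S"
    obtain v where v: "v \<in> keys M0" "v \<in> touch i" by (rule perfect_matchings_ex[OF M0 i])
    have "v \<in> keys (smul q M0)" using v(1) q0 by (simp add: in_keys_iff)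
    then have "v \<in> keys (\<nu> + smul q M0)" by (simp add: keys_add_mono)
    then have "fst v < snd v \<and> snd v < m" using f m0 unfolding skew_vars_def by blast
    then show "i \<in> {..<m}" using v(2) by (auto simp: touch_def)
  qed
  ultimately show ?thesis using a0 S(2) q by blast
qed

theorem theorem4p1:
  fixes r m :: nat
  assumes "even r" and "r \<le> m"
  shows "(\<forall>f :: 'a::alg_closed_field skpoly.
            skew_vars m f \<and> f \<noteq> 0 \<and>
            (\<forall>A. skew_mat m A \<and> vec_space.rank m A \<le> r \<longrightarrow> eval_at f A = 0)
            \<longrightarrow> card (Poly_Mapping.keys f) \<ge> dfact (r + 1))
       \<and> (\<forall>f :: 'a skpoly.
            skew_vars m f \<and> card (Poly_Mapping.keys f) = dfact (r + 1) \<and>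
            (\<forall>A. skew_mat m A \<and> vec_space.rank m A = r \<longrightarrow> eval_at f A = 0)
            \<longrightarrow> (\<exists>c u e S. c \<noteq> 0 \<and> S \<subseteq> {..<m} \<and> card S = r + 2 \<and>
                   f = monomial_term c u * pfaffian_poly S ^ (char_exp TYPE('a) ^ e)))"
proof -
  obtain h where r: "r = 2*h" using assms(1) by (elim evenE)
  have ed: "edge_mons (keys f)" if "skew_vars m f" for f :: "'a skpoly"
    using that unfolding skew_vars_def edge_mons_def by blast
  have nz: "lookup f \<mu> \<noteq> 0" if "\<mu> \<in> keys f" for f :: "'a skpoly" and \<mu>
    using that by (simp add: in_keys_iff)
  show ?thesis
  proof (intro conjI allI impI; elim conjE)
    fix f :: "'a skpoly"
    assume f: "skew_vars m f" "f \<noteq> 0"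
      "\<forall>A. skew_mat m A \<and> vec_space.rank m A \<le> r \<longrightarrow> eval_at f A = 0"
    have "vanishes h (lookup f) (keys f)"
      using f(3) r by (intro vanishes_of_rank_eq[OF f(1)]) (use assms(2) in auto)
    then show "dfact (r + 1) \<le> card (keys f)"
      using f(2) ed[OF f(1)] nz unfolding r by (intro vanishes_lower_bound) auto
  next
    fix f :: "'a skpoly"
    assume f: "skew_vars m f" "card (keys f) = dfact (r + 1)"
      "\<forall>A. skew_mat m A \<and> vec_space.rank m A = r \<longrightarrow> eval_at f A = 0"
    have "vanishes h (lookup f) (keys f)"
      using f(3) r by (intro vanishes_of_rank_eq[OF f(1)]) (use assms(2) in auto)
    then have "extremal h (lookup f) (keys f)"
      using f(2) ed[OF f(1)] nz r by (simp add: extremal_def)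
    from extremal_pfaffian[OF f(1) this]
    show "\<exists>c u e S. c \<noteq> 0 \<and> S \<subseteq> {..<m} \<and> card S = r + 2 \<and>
       f = monomial_term c u * pfaffian_poly S ^ (char_exp TYPE('a) ^ e)" unfolding r .
  qed
qed

end
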